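(* Let $N\ge1$ be an integer. Assume that $0<\sigma<\infty$ if $N\le4$ and $0<\sigma<\frac4{N-4}$ if $N\ge5$. Then for any $c>0$ we have $t(c)>0$ and the minimization problem $(\mathcal T_c)$ admits solutions. Moreover, for any sequence $(u_n)_{n\ge1}\subset H^2(\mathbb{R}^N)$ satisfying $\int_{\mathbb{R}^N}|u_n|^{2\sigma+2}dx\to1$ and $T_c(u_n)\to t(c)$ there exist a subsequence $(u_{n_k})_{k\ge1}$, a sequence $(x_k)_{k\ge1}\subset\mathbb{R}^N$ and a minimizer $u$ for $(\mathcal T_c)$ such that $u_{n_k}(\cdot+x_k)\to u$ strongly in $H^2(\mathbb{R}^N)$.
   Context: All functions are complex-valued. For $c\ge0$ and $u\in H^2(\mathbb{R}^N)$, $$T_c(u)=\int_{\mathbb{R}^N}|\Delta u|^2dx-2\int_{\mathbb{R}^N}|\nabla u|^2dx+(1+c)\int_{\mathbb{R}^N}|u|^2dx.$$ Let $U=\{u\in H^2(\mathbb{R}^N):\int_{\mathbb{R}^N}|u|^{2\sigma+2}dx=1\}$ and $t(c)=\inf\{T_c(u):u\in U\}$. Problem $(\mathcal T_c)$ is: minimize $T_c$ in $U$; a solution (minimizer) is $u\in U$ with $T_c(u)=t(c)$. *)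

theory Defs
  imports "HOL-Analysis.Analysis"
begin

text \<open>
  Euclidean space of dimension \<open>N\<close> is a type \<open>'a\<close> of class \<^class>\<open>euclidean_space\<close> with
  \<open>DIM('a) = N\<close>; the coordinate directions are the elements of \<^term>\<open>Basis\<close>. An element of a
  function space is a Borel representative of its almost-everywhere class.
\<close>

fun partial_derivs :: "'a::euclidean_space list \<Rightarrow> ('a \<Rightarrow> complex) \<Rightarrow> 'a \<Rightarrow> complex" where
  "partial_derivs [] f = f"
| "partial_derivs (i # is) f = (\<lambda>x. frechet_derivative (partial_derivs is f) (at x) i)"

text \<open>
  Differentiability of every iterated partial derivative is equivalent to being \<open>C\<^sup>\<infinity>\<close>, since it
  makes all of them continuous.
\<close>

definition test_functions :: "('a::euclidean_space \<Rightarrow> complex) set" where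
  "test_functions = {\<phi>. (\<forall>is. set is \<subseteq> Basis \<longrightarrow> (\<forall>x. partial_derivs is \<phi> differentiable (at x)))
                       \<and> compact (closure {x. \<phi> x \<noteq> 0})}"

definition locally_integrable :: "('a::euclidean_space \<Rightarrow> complex) \<Rightarrow> bool" where
  "locally_integrable f \<longleftrightarrow> (\<forall>K. compact K \<longrightarrow> set_integrable lborel K f)"

definition L2 :: "('a::euclidean_space \<Rightarrow> complex) set" where
  "L2 = {f \<in> borel_measurable lborel. integrable lborel (\<lambda>x. (cmod (f x))\<^sup>2)}"

definition has_weak_derivative ::
    "'a::euclidean_space list \<Rightarrow> ('a \<Rightarrow> complex) \<Rightarrow> ('a \<Rightarrow> complex) \<Rightarrow> bool" where
  "has_weak_derivative is u v \<longleftrightarrow> locally_integrable u \<and> locally_integrable v \<and>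
     (\<forall>\<phi>\<in>test_functions. (LINT x|lborel. u x * partial_derivs is \<phi> x)
        = (-1) ^ length is * (LINT x|lborel. v x * \<phi> x))"

text \<open>Weak derivatives are unique only almost everywhere; one representative is chosen.\<close>

definition weak_derivative :: "'a::euclidean_space list \<Rightarrow> ('a \<Rightarrow> complex) \<Rightarrow> 'a \<Rightarrow> complex" where
  "weak_derivative is u = (SOME v. has_weak_derivative is u v)"

definition derivative_indices :: "nat \<Rightarrow> 'a::euclidean_space list set" where
  "derivative_indices k = {is. set is \<subseteq> Basis \<and> length is \<le> k}"

definition H2 :: "('a::euclidean_space \<Rightarrow> complex) set" where
  "H2 = {u \<in> L2. \<forall>is\<in>derivative_indices 2. \<exists>v\<in>L2. has_weak_derivative is u v}"

text \<open>
  Indices are lists of directions rather than multi-indices, so each mixed second derivative is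
  counted twice, as in the Frobenius norm of the Hessian.
\<close>

definition H2_norm :: "('a::euclidean_space \<Rightarrow> complex) \<Rightarrow> real" where
  "H2_norm u = sqrt (\<Sum>is\<in>derivative_indices 2. LINT x|lborel. (cmod (weak_derivative is u x))\<^sup>2)"

definition weak_laplacian :: "('a::euclidean_space \<Rightarrow> complex) \<Rightarrow> 'a \<Rightarrow> complex" where
  "weak_laplacian u x = (\<Sum>i\<in>Basis. weak_derivative [i, i] u x)"

definition weak_gradient_sq :: "('a::euclidean_space \<Rightarrow> complex) \<Rightarrow> 'a \<Rightarrow> real" where
  "weak_gradient_sq u x = (\<Sum>i\<in>Basis. (cmod (weak_derivative [i] u x))\<^sup>2)"

definition T_fun :: "real \<Rightarrow> ('a::euclidean_space \<Rightarrow> complex) \<Rightarrow> real" where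
  "T_fun c u = (LINT x|lborel. (cmod (weak_laplacian u x))\<^sup>2)
           - 2 * (LINT x|lborel. weak_gradient_sq u x)
           + (1 + c) * (LINT x|lborel. (cmod (u x))\<^sup>2)"

text \<open>
  The Bochner integral of a non-integrable function is 0, so the constraint below entails
  integrability.
\<close>

definition U_set :: "real \<Rightarrow> ('a::euclidean_space \<Rightarrow> complex) set" where
  "U_set \<sigma> = {u \<in> H2. (LINT x|lborel. cmod (u x) powr (2 * \<sigma> + 2)) = 1}"

text \<open>
  The type argument fixes the space. For \<open>c \<ge> 0\<close> the functional is nonnegative on \<^term>\<open>H2\<close> (on the
  Fourier side its weight is \<open>(\<bar>\<xi>\<bar>\<^sup>2 - 1)\<^sup>2 + c\<close>), so this is the infimum of a set bounded below.
\<close>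

definition t_inf :: "'a::euclidean_space itself \<Rightarrow> real \<Rightarrow> real \<Rightarrow> real" where
  "t_inf _ \<sigma> c = (INF u\<in>(U_set \<sigma> :: ('a \<Rightarrow> complex) set). T_fun c u)"

definition minimizer :: "real \<Rightarrow> real \<Rightarrow> ('a::euclidean_space \<Rightarrow> complex) \<Rightarrow> bool" where
  "minimizer \<sigma> c u \<longleftrightarrow> u \<in> U_set \<sigma> \<and> T_fun c u = t_inf TYPE('a) \<sigma> c"

end

theory Submission
  imports Defs "HOL-Complex_Analysis.Great_Picard"
begin

text \<open>
  Write \<open>p = 2\<sigma> + 2\<close>. Integration by parts turns the functional into
  \<open>T(u) = \<integral>\<bar>\<Delta>u + u\<bar>\<^sup>2 + c\<integral>\<bar>u\<bar>\<^sup>2\<close>, a squared Hilbert norm that dominates the one of \<open>H\<^sup>2\<close>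
  and invariant under translations (\<open>T_fun_square\<close>, \<open>H2_norm_le_T_fun\<close>). A minimizing sequence is bounded
  in this norm. Three facts keep it from losing compactness. It cannot vanish: for subcritical \<open>p\<close>, if all
  averages of \<open>u\<close> over balls of a fixed small radius are small, then \<open>\<integral>\<bar>u\<bar>\<^sup>p\<close> is small
  (\<open>small_averages_imp_small_norm\<close>), so after a translation the average over a fixed ball stays away from
  zero and the weak limit \<open>v\<close> is not null. Energy and mass both split off the limit: up to \<open>o(1)\<close>,
  \<open>T(u\<^sub>n) \<ge> T(v) + T(u\<^sub>n - v)\<close> (\<open>H2_bounded_subsequence\<close>) and
  \<open>\<integral>\<bar>u\<^sub>n\<bar>\<^sup>p = \<integral>\<bar>v\<bar>\<^sup>p + \<integral>\<bar>u\<^sub>n - v\<bar>\<^sup>p\<close> (\<open>brezis_lieb\<close>). Finally,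
  homogeneity gives \<open>T(w) \<ge> t (\<integral>\<bar>w\<bar>\<^sup>p) powr (2/p)\<close>, where \<open>t\<close> is the infimum, so with \<open>a = \<integral>\<bar>v\<bar>\<^sup>p\<close> the
  splitting yields \<open>1 \<ge> a powr (2/p) + (1 - a) powr (2/p)\<close>, and strict concavity forces \<open>a = 1\<close>. Then \<open>T(v) = t\<close> and
  \<open>T(u\<^sub>n - v) \<rightarrow> 0\<close>.

  All the analysis rests on translations instead of the Fourier transform. If \<open>u\<close> has the weak derivative \<open>v\<close>
  along \<open>z\<close>, then \<open>u(\<cdot> + z) - u\<close> has \<open>L\<^sup>2\<close> norm at most that of \<open>v\<close> (\<open>translation_estimate\<close>); this follows
  by duality from the density of test functions. Applied to difference quotients it yields integration by parts
  and the bound of the Hessian by the Laplacian (\<open>hessian_le_laplacian\<close>). Applied twice it bounds symmetric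
  second differences, hence \<open>u\<close> minus its average over a ball of radius \<open>h\<close> is \<open>O(h\<^sup>2)\<close> in \<open>L\<^sup>2\<close>
  (\<open>avg_error_le\<close>). Ball averages are bounded and equicontinuous, so this one estimate gives both the Sobolev
  inequality (\<open>sobolev_inequality\<close>) and local compactness (\<open>vanishing_averages_imp_AE_subsequence\<close>).

  Weak compactness is replaced by the parallelogram law: among repeated midpoints of the tail of a bounded
  sequence, elements of nearly minimal norm form a Cauchy sequence
  (\<open>midpoint_closed_near_minimizers_Cauchy\<close>), and since ball averages of the sequence converge, the strong
  limit of the midpoints has these averages as well and is therefore the weak limit.
\<close>

section \<open>Square-integrable functions\<close>

text \<open>
  Fatou's lemma for real-valued integrands; the bound on the integrals also makes the limit integrable.
\<close>

lemma fatou_bound: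
  fixes h :: "'b \<Rightarrow> real"
  assumes meas: "h \<in> borel_measurable M"
    and int: "\<And>n. integrable M (f n)" and nn: "\<And>n x. 0 \<le> f n x"
    and lim: "AE x in M. (\<lambda>n. f n x) \<longlonglongrightarrow> h x"
    and bound: "\<forall>\<^sub>F n in sequentially. (LINT x|M. f n x) \<le> C"
  shows "integrable M h" "(LINT x|M. h x) \<le> C"
proof -
  have C0: "0 \<le> C"
  proof -
    obtain n where "(LINT x|M. f n x) \<le> C" 
      using eventually_happens'[OF sequentially_bot bound] by blast
    moreover have "0 \<le> (LINT x|M. f n x)" by (intro integral_nonneg_AE) (simp add: nn)
    ultimately show ?thesis by simp
  qed
  have hnn: "AE x in M. 0 \<le> h x"
    using lim by eventually_elim (rule LIMSEQ_le_const, auto simp: nn)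
  have "(\<integral>\<^sup>+x. ennreal (h x) \<partial>M) = (\<integral>\<^sup>+x. liminf (\<lambda>n. ennreal (f n x)) \<partial>M)"
  proof (rule nn_integral_cong_AE)
    show "AE x in M. ennreal (h x) = liminf (\<lambda>n. ennreal (f n x))"
      using lim by eventually_elim
        (rule lim_imp_Liminf[symmetric, OF sequentially_bot tendsto_ennrealI])
  qed
  also have "\<dots> \<le> liminf (\<lambda>n. \<integral>\<^sup>+x. ennreal (f n x) \<partial>M)"
    using int by (intro nn_integral_liminf) auto
  also have "\<dots> = liminf (\<lambda>n. ennreal (LINT x|M. f n x))"
    using int nn by (simp add: nn_integral_eq_integral)
  also have "\<dots> \<le> liminf (\<lambda>n. ennreal C)"
    by (rule Liminf_mono, rule eventually_mono[OF bound]) (rule ennreal_leI)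
  also have "\<dots> = ennreal C" by (simp add: Liminf_const)
  finally have le: "(\<integral>\<^sup>+x. ennreal (h x) \<partial>M) \<le> ennreal C" .
  show *: "integrable M h"
    using meas hnn le by (intro integrableI_nonneg) (auto intro: le_less_trans)
  show "(LINT x|M. h x) \<le> C"
    using le nn_integral_eq_integral[OF * hnn] C0 by (simp add: ennreal_le_iff)
qed

definition l2sq :: "('a::euclidean_space \<Rightarrow> complex) \<Rightarrow> real" where
  "l2sq f = (LINT x|lborel. (cmod (f x))\<^sup>2)"

lemma l2sq_nonneg [simp]: "0 \<le> l2sq f"
  by (simp add: l2sq_def)

lemma L2_measurable: "f \<in> L2 \<Longrightarrow> f \<in> borel_measurable borel"
  by (simp add: L2_def)

lemma L2_integrable_sq: "f \<in> L2 \<Longrightarrow> integrable lborel (\<lambda>x. (cmod (f x))\<^sup>2)"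
  by (simp add: L2_def)

lemma L2I: "f \<in> borel_measurable borel \<Longrightarrow> integrable lborel (\<lambda>x. (cmod (f x))\<^sup>2) \<Longrightarrow> f \<in> L2"
  by (simp add: L2_def)

lemma norm_add_sq_le: "(norm (a + b :: 'b::real_normed_vector))\<^sup>2 \<le> 2 * (norm a)\<^sup>2 + 2 * (norm b)\<^sup>2"
proof -
  have "(norm (a + b))\<^sup>2 \<le> (norm a + norm b)\<^sup>2"
    by (intro power_mono norm_triangle_ineq) auto
  also have "\<dots> \<le> 2 * (norm a)\<^sup>2 + 2 * (norm b)\<^sup>2"
    using sum_squares_ge_zero[of "norm a - norm b" 0] by (simp add: power2_eq_square algebra_simps)
  finally show ?thesis .
qed

lemma L2_add: assumes "f \<in> L2" "g \<in> L2" shows "(\<lambda>x. f x + g x) \<in> L2"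
proof (rule L2I)
  note [measurable] = L2_measurable[OF assms(1)] L2_measurable[OF assms(2)]
  show "integrable lborel (\<lambda>x. (cmod (f x + g x))\<^sup>2)"
    by (rule Bochner_Integration.integrable_bound[where
        f="\<lambda>x. 2 * (cmod (f x))\<^sup>2 + 2 * (cmod (g x))\<^sup>2"])
      (auto simp: L2_integrable_sq assms norm_add_sq_le)
qed (intro borel_measurable_add L2_measurable assms)

lemma L2_cmult: "f \<in> L2 \<Longrightarrow> (\<lambda>x. a * f x) \<in> L2"
  by (auto simp: L2_def norm_mult power_mult_distrib)

lemma L2_zero: "(\<lambda>x. 0) \<in> L2" by (simp add: L2_def)

lemma L2_minus: "f \<in> L2 \<Longrightarrow> (\<lambda>x. - f x) \<in> L2"
  by (auto simp: L2_def)

lemma L2_diff: "f \<in> L2 \<Longrightarrow> g \<in> L2 \<Longrightarrow> (\<lambda>x. f x - g x) \<in> L2"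
  using L2_add[of f "\<lambda>x. - g x"] L2_minus by auto

lemma L2_cnj: "f \<in> L2 \<Longrightarrow> (\<lambda>x. cnj (f x)) \<in> L2"
proof -
  assume f: "f \<in> L2"
  have "cnj \<in> borel_measurable borel"
    by (intro borel_measurable_continuous_onI continuous_intros)
  from measurable_compose[OF L2_measurable[OF f] this] show ?thesis
    using f by (simp add: L2_def)
qed

lemma L2_sum: "(\<And>i. i \<in> A \<Longrightarrow> f i \<in> L2) \<Longrightarrow> (\<lambda>x. \<Sum>i\<in>A. f i x) \<in> L2"
  by (induction A rule: infinite_finite_induct) (auto simp: L2_zero L2_add)

lemma lborel_distr_plus_right: "distr lborel borel (\<lambda>x. x + c) = (lborel :: 'a::euclidean_space measure)"
proof -
  have "(\<lambda>x. x + c) = (+) c" by (auto simp: add.commute)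
  then show ?thesis by (simp add: lborel_distr_plus)
qed

lemma integral_translate:
  fixes f :: "'a::euclidean_space \<Rightarrow> 'b::{banach,second_countable_topology}"
  assumes "f \<in> borel_measurable borel"
  shows "(LINT x|lborel. f (x + c)) = (LINT x|lborel. f x)"
  by (subst (2) lborel_distr_plus_right[of c, symmetric], subst integral_distr) (use assms in auto)

lemma integrable_translate:
  fixes f :: "'a::euclidean_space \<Rightarrow> 'b::{banach,second_countable_topology}"
  assumes "integrable lborel f"
  shows "integrable lborel (\<lambda>x. f (x + c))"
  using assms by (subst (asm) lborel_distr_plus_right[of c, symmetric], subst (asm) integrable_distr_eq) auto

lemma L2_translate: "f \<in> L2 \<Longrightarrow> (\<lambda>x. f (x + c)) \<in> L2"
  using integrable_translate[of "\<lambda>x. (cmod (f x))\<^sup>2" c] by (auto simp: L2_def)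

lemma l2sq_translate: "f \<in> L2 \<Longrightarrow> l2sq (\<lambda>x. f (x + c)) = l2sq f"
  unfolding l2sq_def by (rule integral_translate) (auto simp: L2_def)

lemma l2sq_cmult: "l2sq (\<lambda>x. a * f x) = (cmod a)\<^sup>2 * l2sq f"
  by (simp add: l2sq_def norm_mult power_mult_distrib)

lemma l2sq_cnj: "l2sq (\<lambda>x. cnj (f x)) = l2sq f" by (simp add: l2sq_def)

lemma l2sq_minus_commute: "l2sq (\<lambda>x. f x - g x) = l2sq (\<lambda>x. g x - f x)"
  by (simp add: l2sq_def norm_minus_commute)

lemma l2sq_cong_AE:
  assumes "f \<in> borel_measurable borel" "g \<in> borel_measurable borel" "AE x in lborel. f x = g x"
  shows "l2sq f = l2sq g"
  unfolding l2sq_def using assms(1,2) by (intro integral_cong_AE) (use assms(3) in auto)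

lemma L2_cong_AE:
  assumes "f \<in> L2" "g \<in> borel_measurable borel" "AE x in lborel. f x = g x"
  shows "g \<in> L2"
proof (rule L2I)
  show "integrable lborel (\<lambda>x. (cmod (g x))\<^sup>2)"
    using assms L2_measurable[OF assms(1)]
    by (subst integrable_cong_AE[of _ _ "\<lambda>x. (cmod (f x))\<^sup>2"]) (auto simp: L2_integrable_sq)
qed (rule assms)

lemma parallelogram_norm_sq:
  fixes a b :: complex
  shows "(cmod (a - b))\<^sup>2 = 2 * (cmod a)\<^sup>2 + 2 * (cmod b)\<^sup>2 - (cmod (a + b))\<^sup>2"
  unfolding cmod_power2 by (simp add: power2_eq_square algebra_simps)

lemma l2sq_parallelogram:
  assumes "f \<in> L2" "g \<in> L2"
  shows "l2sq (\<lambda>x. f x - g x) = 2 * l2sq f + 2 * l2sq g - l2sq (\<lambda>x. f x + g x)"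
  unfolding l2sq_def parallelogram_norm_sq
  using assms L2_add[OF assms] by (simp add: L2_integrable_sq)

lemma l2sq_add_le:
  assumes "f \<in> L2" "g \<in> L2"
  shows "l2sq (\<lambda>x. f x + g x) \<le> 2 * l2sq f + 2 * l2sq g"
  using l2sq_parallelogram[OF assms] l2sq_nonneg[of "\<lambda>x. f x - g x"] by simp

lemma l2sq_diff_le:
  assumes "f \<in> L2" "g \<in> L2"
  shows "l2sq (\<lambda>x. f x - g x) \<le> 2 * l2sq f + 2 * l2sq g"
  using l2sq_parallelogram[OF assms] l2sq_nonneg[of "\<lambda>x. f x + g x"] by simp

lemma l2sq_sum_le:
  assumes "\<And>i. i \<in> A \<Longrightarrow> f i \<in> L2"
  shows "l2sq (\<lambda>x. \<Sum>i\<in>A. f i x) \<le> card A * (\<Sum>i\<in>A. l2sq (f i))"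
proof -
  have *: "(cmod (\<Sum>i\<in>A. f i x))\<^sup>2 \<le> card A * (\<Sum>i\<in>A. (cmod (f i x))\<^sup>2)" for x
  proof -
    have "(cmod (\<Sum>i\<in>A. f i x))\<^sup>2 \<le> (\<Sum>i\<in>A. cmod (f i x))\<^sup>2"
      by (intro power_mono norm_sum) auto
    also have "\<dots> \<le> card A * (\<Sum>i\<in>A. (cmod (f i x))\<^sup>2)"
      using sum_squared_le_sum_of_squares[of "\<lambda>i. cmod (f i x)" A] by (cases "finite A") (auto simp: mult.commute)
    finally show ?thesis .
  qed
  have "l2sq (\<lambda>x. \<Sum>i\<in>A. f i x) \<le> (LINT x|lborel. card A * (\<Sum>i\<in>A. (cmod (f i x))\<^sup>2))"
    unfolding l2sq_def using L2_integrable_sq[OF L2_sum[of A f, OF assms]]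
    by (intro integral_mono *)
      (auto intro!: Bochner_Integration.integrable_sum L2_integrable_sq assms)
  also have "\<dots> = card A * (\<Sum>i\<in>A. l2sq (f i))"
    unfolding l2sq_def using assms by (simp add: L2_integrable_sq Bochner_Integration.integral_sum)
  finally show ?thesis .
qed

text \<open>
  Integrating \<open>\<bar>f g\<bar> \<le> a\<bar>f\<bar>\<^sup>2/2 + \<bar>g\<bar>\<^sup>2/(2a)\<close> and choosing the best weight \<open>a\<close>.
\<close>

lemma cauchy_schwarz_integral:
  fixes f g :: "'b \<Rightarrow> complex"
  assumes "f \<in> borel_measurable M" "g \<in> borel_measurable M"
    and "integrable M (\<lambda>x. (cmod (f x))\<^sup>2)" "integrable M (\<lambda>x. (cmod (g x))\<^sup>2)"
  shows "integrable M (\<lambda>x. f x * g x)"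
    and "cmod (LINT x|M. f x * g x)
           \<le> sqrt (LINT x|M. (cmod (f x))\<^sup>2) * sqrt (LINT x|M. (cmod (g x))\<^sup>2)"
proof -
  have amgm: "s * t \<le> a / 2 * s\<^sup>2 + 1 / (2 * a) * t\<^sup>2" if "a > 0" for a s t :: real
  proof -
    have "0 \<le> (a * s - t)\<^sup>2 / (2 * a)" using that by simp
    also have "\<dots> = a / 2 * s\<^sup>2 + 1 / (2 * a) * t\<^sup>2 - s * t"
      using that by (simp add: power2_eq_square field_simps)
    finally show ?thesis by simp
  qed
  show int: "integrable M (\<lambda>x. f x * g x)"
    by (rule Bochner_Integration.integrable_bound[where
          f="\<lambda>x. 1 / 2 * (cmod (f x))\<^sup>2 + 1 / 2 * (cmod (g x))\<^sup>2"])
      (use assms amgm[of 1] in \<open>auto simp: norm_mult\<close>)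
  define A B where "A = (LINT x|M. (cmod (f x))\<^sup>2)" and "B = (LINT x|M. (cmod (g x))\<^sup>2)"
  define I where "I = (LINT x|M. cmod (f x * g x))"
  have A0: "A \<ge> 0" "B \<ge> 0" by (auto simp: A_def B_def)
  have le: "I \<le> a / 2 * A + 1 / (2 * a) * B" if "a > 0" for a
  proof -
    have "I \<le> (LINT x|M. a / 2 * (cmod (f x))\<^sup>2 + 1 / (2 * a) * (cmod (g x))\<^sup>2)"
      unfolding I_def using assms integrable_norm[OF int]
      by (intro integral_mono) (auto simp: norm_mult amgm[OF that] simp del: times_divide_eq_left)
    also have "\<dots> = a / 2 * A + 1 / (2 * a) * B"
      using assms by (simp add: A_def B_def)
    finally show ?thesis .
  qed
  have "I \<le> sqrt A * sqrt B"
  proof (rule field_le_epsilon)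
    fix e :: real assume e: "e > 0"
    \<comment> \<open>The optimal weight is the quotient of the norms; the shift \<open>d\<close> keeps it positive and finite.\<close>
    obtain d where d: "d > 0" "(sqrt A + d) * (sqrt B + d) < sqrt A * sqrt B + e"
    proof -
      have "((\<lambda>d. (sqrt A + d) * (sqrt B + d)) \<longlongrightarrow> (sqrt A + 0) * (sqrt B + 0)) (at_right 0)"
        by (intro tendsto_intros)
      then have "\<forall>\<^sub>F d in at_right 0. (sqrt A + d) * (sqrt B + d) < sqrt A * sqrt B + e"
        by (rule order_tendstoD(2)) (use e in simp)
      then have "\<forall>\<^sub>F d in at_right 0. 0 < d \<and> (sqrt A + d) * (sqrt B + d) < sqrt A * sqrt B + e"
        using eventually_at_right_less[of "0::real"] by eventually_elim simp
      then show thesis using that eventually_happens'[OF trivial_limit_at_right_real] by blast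
    qed
    define s t where "s = sqrt A + d" and "t = sqrt B + d"
    have st0: "s > 0" "t > 0" using d(1) A0 by (auto simp: s_def t_def add_nonneg_pos)
    have "(sqrt A)\<^sup>2 \<le> s\<^sup>2" "(sqrt B)\<^sup>2 \<le> t\<^sup>2"
      using d(1) A0 by (intro power_mono; simp add: s_def t_def)+
    then have st: "s > 0" "t > 0" "A \<le> s\<^sup>2" "B \<le> t\<^sup>2"
      using st0 A0 by auto
    have "I \<le> (t / s) / 2 * A + 1 / (2 * (t / s)) * B" using st by (intro le) auto
    also have "\<dots> \<le> (t / s) / 2 * s\<^sup>2 + 1 / (2 * (t / s)) * t\<^sup>2"
      using st by (intro add_mono mult_left_mono) auto
    also have "\<dots> = s * t" using st by (simp add: power2_eq_square field_simps)
    finally show "I \<le> sqrt A * sqrt B + e" using d(2) by (simp add: s_def t_def)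
  qed
  then show "cmod (LINT x|M. f x * g x) \<le> sqrt A * sqrt B"
    using order_trans[OF integral_norm_bound[of M "\<lambda>x. f x * g x"]] unfolding I_def by blast
qed

lemma L2_integrable_mult: "f \<in> L2 \<Longrightarrow> g \<in> L2 \<Longrightarrow> integrable lborel (\<lambda>x. f x * g x)"
  by (rule cauchy_schwarz_integral) (auto simp: L2_def)

lemma L2_cauchy_schwarz:
  "f \<in> L2 \<Longrightarrow> g \<in> L2 \<Longrightarrow> cmod (LINT x|lborel. f x * g x) \<le> sqrt (l2sq f) * sqrt (l2sq g)"
  unfolding l2sq_def by (rule cauchy_schwarz_integral) (auto simp: L2_def)

lemma L2_pairing_tendsto:
  assumes "\<And>n. f n \<in> L2" "g \<in> L2" "h \<in> L2" and lim: "(\<lambda>n. l2sq (\<lambda>x. f n x - g x)) \<longlonglongrightarrow> 0"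
  shows "(\<lambda>n. LINT x|lborel. f n x * h x) \<longlonglongrightarrow> (LINT x|lborel. g x * h x)"
proof -
  have "(\<lambda>n. (LINT x|lborel. f n x * h x) - (LINT x|lborel. g x * h x)) \<longlonglongrightarrow> 0"
  proof (rule Lim_null_comparison)
    show "\<forall>\<^sub>F n in sequentially. cmod ((LINT x|lborel. f n x * h x) - (LINT x|lborel. g x * h x))
            \<le> sqrt (l2sq (\<lambda>x. f n x - g x)) * sqrt (l2sq h)"
    proof (rule always_eventually, rule allI)
      fix n
      have "(LINT x|lborel. f n x * h x) - (LINT x|lborel. g x * h x)
            = (LINT x|lborel. (f n x - g x) * h x)"
        using assms by (simp add: L2_integrable_mult algebra_simps)
      then show "cmod ((LINT x|lborel. f n x * h x) - (LINT x|lborel. g x * h x))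
            \<le> sqrt (l2sq (\<lambda>x. f n x - g x)) * sqrt (l2sq h)"
        using L2_cauchy_schwarz[OF L2_diff[OF assms(1)[of n] assms(2)] assms(3)] by simp
    qed
    show "(\<lambda>n. sqrt (l2sq (\<lambda>x. f n x - g x)) * sqrt (l2sq h)) \<longlonglongrightarrow> 0"
      using tendsto_mult_right[OF tendsto_real_sqrt[OF lim], of "sqrt (l2sq h)"] by simp
  qed
  then show ?thesis by (simp add: LIM_zero_iff)
qed

lemma l2sq_zero_imp_AE:
  assumes "f \<in> L2" "l2sq f = 0"
  shows "AE x in lborel. f x = 0"
  using assms integral_nonneg_eq_0_iff_AE[OF L2_integrable_sq[OF assms(1)]]
  by (simp add: l2sq_def)

lemma ennreal_le_suminf: "f k \<le> (\<Sum>k. f k :: ennreal)"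
  using sum_le_suminf[of f "{k}"] by simp

text \<open>
  Along a subsequence whose consecutive distances decay like \<open>8\<^sup>-\<^sup>k\<close>, the sum of \<open>4\<^sup>k\<close> times the squared
  increments has finite integral. Hence almost everywhere the increments are bounded by a multiple of \<open>2\<^sup>-\<^sup>k\<close> and
  the subsequence converges pointwise. Fatou's lemma then identifies the limit in the norm.
\<close>

theorem L2_complete:
  fixes f :: "nat \<Rightarrow> 'a::euclidean_space \<Rightarrow> complex"
  assumes f: "\<And>n. f n \<in> L2"
    and Cauchy: "\<And>e. e > 0 \<Longrightarrow> \<exists>M. \<forall>m\<ge>M. \<forall>n\<ge>M. l2sq (\<lambda>x. f m x - f n x) < e"
  obtains g where "g \<in> L2" "(\<lambda>n. l2sq (\<lambda>x. f n x - g x)) \<longlonglongrightarrow> 0"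
proof -
  note [measurable] = L2_measurable[OF f]
  have "\<exists>M. \<forall>k::nat. (\<forall>m\<ge>M k. \<forall>n\<ge>M k. l2sq (\<lambda>x. f m x - f n x) < (1/8)^k)"
    using Cauchy by (intro choice) simp
  then obtain M where M: "\<And>k m n. m \<ge> M k \<Longrightarrow> n \<ge> M k \<Longrightarrow> l2sq (\<lambda>x. f m x - f n x) < (1/8)^k"
    by blast
  define r where "r k = (\<Sum>j\<le>k. M j) + k" for k
  have rM: "r k \<ge> M k" for k
    unfolding r_def by (intro trans_le_add1 member_le_sum) auto
  have rSuc: "r (Suc k) \<ge> M k" "r k \<ge> k" for k
    using rM[of k] by (auto simp: r_def)
  define d where "d k x = cmod (f (r (Suc k)) x - f (r k) x)" for k x
  have [measurable]: "d k \<in> borel_measurable borel" for k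
    unfolding d_def
    by (rule measurable_compose[OF borel_measurable_diff borel_measurable_norm])
      (intro L2_measurable f)+
  have dint: "integrable lborel (\<lambda>x. 4 ^ k * (d k x)\<^sup>2)" for k
    using L2_integrable_sq[OF L2_diff[OF f[of "r (Suc k)"] f[of "r k"]]] by (simp add: d_def)
  have dle: "(LINT x|lborel. 4 ^ k * (d k x)\<^sup>2) \<le> (1/2)^k" for k
  proof -
    have "(LINT x|lborel. 4 ^ k * (d k x)\<^sup>2) = 4 ^ k * l2sq (\<lambda>x. f (r (Suc k)) x - f (r k) x)"
      by (simp add: d_def l2sq_def)
    also have "\<dots> \<le> 4 ^ k * (1/8)^k"
      using M[OF rSuc(1) rM] by (intro mult_left_mono less_imp_le) auto
    also have "\<dots> = (4 * (1/8))^k" by (rule power_mult_distrib[symmetric])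
    finally show ?thesis by simp
  qed
  have "(\<integral>\<^sup>+x. (\<Sum>k. ennreal (4 ^ k * (d k x)\<^sup>2)) \<partial>lborel)
        = (\<Sum>k. \<integral>\<^sup>+x. ennreal (4 ^ k * (d k x)\<^sup>2) \<partial>lborel)"
    by (rule nn_integral_suminf) auto
  also have "\<dots> \<le> (\<Sum>k. ennreal ((1/2)^k))"
    using dint dle by (intro suminf_le) (auto simp: nn_integral_eq_integral intro!: ennreal_leI)
  also have "\<dots> = ennreal (\<Sum>k. (1/2)^k)"
    by (intro suminf_ennreal2) (auto simp: summable_geometric)
  also have "\<dots> < \<infinity>" by simp
  finally have "AE x in lborel. (\<Sum>k. ennreal (4 ^ k * (d k x)\<^sup>2)) \<noteq> \<infinity>"
    by (intro nn_integral_PInf_AE) auto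
  then have conv: "AE x in lborel. convergent (\<lambda>k. f (r k) x)"
  proof eventually_elim
    case (elim x)
    define S where "S = enn2real (\<Sum>k. ennreal (4 ^ k * (d k x)\<^sup>2))"
    have S0: "0 \<le> S" by (simp add: S_def)
    have S: "4 ^ k * (d k x)\<^sup>2 \<le> S" for k
    proof -
      have "ennreal (4 ^ k * (d k x)\<^sup>2) \<le> (\<Sum>k. ennreal (4 ^ k * (d k x)\<^sup>2))"
        by (rule ennreal_le_suminf)
      also have "\<dots> = ennreal S"
        unfolding S_def using elim by (intro ennreal_enn2real[symmetric]) (simp only: less_top infinity_ennreal_def)
      finally show ?thesis using S0 by (simp only: ennreal_le_iff)
    qed
    have S': "d k x \<le> sqrt S * (1/2)^k" for k
    proof -
      have four: "(2 ^ k)\<^sup>2 = (4 :: real) ^ k"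
        using power_mult[of "2::real" k 2] power_mult[of "2::real" 2 k] by (simp add: mult.commute)
      have "(2 ^ k * d k x)\<^sup>2 \<le> S" using S[of k] four by (simp add: power_mult_distrib)
      then have "2 ^ k * d k x \<le> sqrt S" by (rule real_le_rsqrt)
      then show ?thesis by (simp add: power_one_over divide_simps mult.commute)
    qed
    have "summable (\<lambda>k. f (r (Suc k)) x - f (r k) x)"
      by (rule summable_comparison_test[where g="\<lambda>k. sqrt S * (1/2)^k"])
        (use S' in \<open>auto simp: d_def intro!: summable_mult summable_geometric\<close>)
    then have "convergent (\<lambda>n. \<Sum>k<n. f (r (Suc k)) x - f (r k) x)"
      by (simp add: summable_iff_convergent)
    then have "convergent (\<lambda>n. f (r n) x - f (r 0) x)"
      by (simp only: sum_lessThan_telescope[of "\<lambda>k. f (r k) x"])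
    from convergent_add[OF this convergent_const[of "f (r 0) x"]] show ?case by simp
  qed
  define g where "g x = lim (\<lambda>k. f (r k) x)" for x
  have [measurable]: "g \<in> borel_measurable borel" unfolding g_def by measurable
  have lim: "AE x in lborel. (\<lambda>k. f (r k) x) \<longlonglongrightarrow> g x"
    using conv by eventually_elim (simp add: g_def convergent_LIMSEQ_iff)
  have key: "integrable lborel (\<lambda>x. (cmod (f m x - g x))\<^sup>2) \<and> (LINT x|lborel. (cmod (f m x - g x))\<^sup>2) \<le> e"
    if M: "\<And>n. n \<ge> M \<Longrightarrow> l2sq (\<lambda>x. f m x - f n x) < e" for m M e
  proof -
    have 1: "AE x in lborel. (\<lambda>k. (cmod (f m x - f (r k) x))\<^sup>2) \<longlonglongrightarrow> (cmod (f m x - g x))\<^sup>2"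
      using lim by eventually_elim (intro tendsto_intros)
    have 2: "\<forall>\<^sub>F k in sequentially. (LINT x|lborel. (cmod (f m x - f (r k) x))\<^sup>2) \<le> e"
      using eventually_ge_at_top[of M]
    proof eventually_elim
      case (elim k)
      then have "l2sq (\<lambda>x. f m x - f (r k) x) < e" using rSuc(2)[of k] by (intro M) auto
      then show ?case by (simp add: l2sq_def)
    qed
    show ?thesis
      by (intro conjI fatou_bound[OF _ _ _ 1 2])
        (use L2_diff[OF f f] in \<open>auto intro: L2_integrable_sq\<close>)
  qed
  show thesis
  proof
    obtain M where "\<And>m n. m \<ge> M \<Longrightarrow> n \<ge> M \<Longrightarrow> l2sq (\<lambda>x. f m x - f n x) < 1"
      using Cauchy[of 1] by auto
    then have "integrable lborel (\<lambda>x. (cmod (f M x - g x))\<^sup>2)" using key[of M M 1] by auto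
    then have "(\<lambda>x. f M x - g x) \<in> L2" by (intro L2I) auto
    from L2_diff[OF f[of M] this] show "g \<in> L2" by simp
    show "(\<lambda>n. l2sq (\<lambda>x. f n x - g x)) \<longlonglongrightarrow> 0"
    proof (rule LIMSEQ_I)
      fix e :: real assume "e > 0"
      then obtain M where M: "\<And>m n. m \<ge> M \<Longrightarrow> n \<ge> M \<Longrightarrow> l2sq (\<lambda>x. f m x - f n x) < e / 2"
        using Cauchy[of "e/2"] by auto
      have "l2sq (\<lambda>x. f m x - g x) \<le> e / 2" if "m \<ge> M" for m
        using key[of M m "e/2"] M that by (auto simp: l2sq_def)
      then show "\<exists>no. \<forall>n\<ge>no. norm (l2sq (\<lambda>x. f n x - g x) - 0) < e"
        using \<open>e > 0\<close> by (intro exI[of _ M]) force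
    qed
  qed
qed

text \<open>
  The infima over the decreasing sets \<open>S n\<close> increase to a finite limit. If \<open>g m\<close> and \<open>g n\<close> nearly attain them,
  their midpoint still lies in the larger of the two sets and cannot be much shorter, so the parallelogram law
  makes their difference short. With a constant \<open>S\<close> this is the projection theorem; with \<open>S n\<close> made from the tails
  of a sequence it extracts strongly convergent convex combinations from a bounded sequence.
\<close>

lemma midpoint_closed_near_minimizers_Cauchy:
  fixes q :: "('b \<Rightarrow> complex) \<Rightarrow> real"
  assumes dec: "\<And>n. S (Suc n) \<subseteq> S n"
    and mid: "\<And>n f g. f \<in> S n \<Longrightarrow> g \<in> S n \<Longrightarrow> (\<lambda>x. (f x + g x) / 2) \<in> S n"
    and par: "\<And>f g. f \<in> S 0 \<Longrightarrow> g \<in> S 0 \<Longrightarrow>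
                q (\<lambda>x. f x - g x) = 2 * q f + 2 * q g - 4 * q (\<lambda>x. (f x + g x) / 2)"
    and nn: "\<And>f. f \<in> S 0 \<Longrightarrow> 0 \<le> q f"
    and bd: "\<And>n. \<exists>f\<in>S n. q f \<le> R"
  obtains g where "\<And>n. g n \<in> S n"
    "\<And>e. e > 0 \<Longrightarrow> \<exists>M. \<forall>m\<ge>M. \<forall>n\<ge>M. q (\<lambda>x. g m x - g n x) < e"
    "\<And>n f. f \<in> S n \<Longrightarrow> q (g n) \<le> q f + inverse (real (Suc n))"
proof -
  define i where "i n = Inf (q ` S n)" for n
  have sub: "S m \<subseteq> S n" if "n \<le> m" for m n using dec that by (rule lift_Suc_antimono_le)
  have bdd: "bdd_below (q ` S n)" for n using nn sub[of 0 n] by (intro bdd_belowI[of _ 0]) auto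
  have ne: "S n \<noteq> {}" for n using bd[of n] by auto
  have i_le: "i n \<le> q f" if "f \<in> S n" for f n
    unfolding i_def using that by (intro cInf_lower bdd) auto
  have inc: "incseq i" unfolding i_def
    by (intro incseq_SucI cInf_superset_mono bdd image_mono dec) (use ne in auto)
  have iR: "i n \<le> R" for n using bd[of n] i_le by force
  obtain l where l: "i \<longlonglongrightarrow> l" "\<And>n. i n \<le> l"
    using incseq_convergent[OF inc, of R] iR by auto
  have "\<exists>f. f \<in> S n \<and> q f < i n + inverse (real (Suc n))" for n
    using cInf_lessD[of "q ` S n" "i n + inverse (real (Suc n))"] ne[of n]
    unfolding i_def by (auto simp del: of_nat_Suc)
  then obtain g where g: "\<And>n. g n \<in> S n" "\<And>n. q (g n) < i n + inverse (real (Suc n))"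
    by metis
  show thesis
  proof
    show "g n \<in> S n" for n by (rule g)
    show "q (g n) \<le> q f + inverse (real (Suc n))" if "f \<in> S n" for n f
      using g(2)[of n] i_le[OF that] by linarith
    fix e :: real assume e: "e > 0"
    have "(\<lambda>n. 4 * (l - i n) + 4 * inverse (real (Suc n))) \<longlonglongrightarrow> 4 * (l - l) + 4 * 0"
      by (intro tendsto_intros l LIMSEQ_inverse_real_of_nat)
    then have "\<forall>\<^sub>F n in sequentially. 4 * (l - i n) + 4 * inverse (real (Suc n)) < e"
      by (rule order_tendstoD(2)) (use e in simp)
    then obtain M where M: "\<And>n. n \<ge> M \<Longrightarrow> 4 * (l - i n) + 4 * inverse (real (Suc n)) < e"
      by (auto simp: eventually_at_top_linorder)
    have A: "q (g n) \<le> l + inverse (real (Suc n))" for n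
      using g(2)[of n] l(2)[of n] by (simp del: of_nat_Suc)
    have "q (\<lambda>x. g m x - g n x) < e" if "m \<ge> M" "n \<ge> M" for m n
    proof -
      have in_M: "g m \<in> S M" "g n \<in> S M" using g sub that by blast+
      have in_0: "g m \<in> S 0" "g n \<in> S 0" using g sub[of 0] by blast+
      have "q (\<lambda>x. g m x - g n x) = 2 * q (g m) + 2 * q (g n) - 4 * q (\<lambda>x. (g m x + g n x) / 2)"
        by (rule par[OF in_0])
      also have "\<dots> \<le> 2 * (l + inverse (real (Suc m))) + 2 * (l + inverse (real (Suc n))) - 4 * i M"
        by (intro diff_mono add_mono mult_left_mono A i_le[OF mid[OF in_M]]) simp_all
      also have "\<dots> \<le> 2 * (l + inverse (real (Suc M))) + 2 * (l + inverse (real (Suc M))) - 4 * i M"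
        using that by (intro diff_right_mono add_mono mult_left_mono) (auto simp: field_simps)
      also have "\<dots> < e" using M[of M] by simp
      finally show ?thesis .
    qed
    then show "\<exists>M. \<forall>m\<ge>M. \<forall>n\<ge>M. q (\<lambda>x. g m x - g n x) < e" by blast
  qed
qed

section \<open>Smooth bump functions and test functions\<close>

text \<open>
  For \<open>k = 0\<close> this is the classical smooth function that is flat at the origin. The powers of \<open>t\<close> are included
  because they make the family closed under differentiation, up to linear combinations.
\<close>

definition flat :: "nat \<Rightarrow> real \<Rightarrow> real" where
  "flat k t = (if t > 0 then exp (- 1 / t) / t ^ k else 0)"

lemma flat_tendsto_0: "(flat k \<longlongrightarrow> 0) (at 0)"
proof -
  have "((\<lambda>t::real. (inverse t) ^ k / exp (inverse t)) \<longlongrightarrow> 0) (at_right 0)"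
    by (rule filterlim_compose[OF tendsto_power_div_exp_0 filterlim_inverse_at_top_right])
  moreover have "\<forall>\<^sub>F t in at_right 0. (inverse t) ^ k / exp (inverse t) = flat k t"
    using eventually_at_right_less[of "0::real"]
    by eventually_elim (simp add: flat_def exp_minus field_simps)
  ultimately have "(flat k \<longlongrightarrow> 0) (at_right 0)"
    using Lim_transform_eventually by blast
  moreover have "(flat k \<longlongrightarrow> 0) (at_left 0)"
  proof (rule Lim_transform_eventually)
    show "((\<lambda>_. 0) \<longlongrightarrow> (0::real)) (at_left (0::real))" by simp
    show "\<forall>\<^sub>F t in at_left 0. 0 = flat k t"
      by (auto simp: eventually_at flat_def intro!: exI[of _ 1])
  qed
  ultimately show ?thesis by (simp add: filterlim_at_split)
qed

lemma flat_has_derivative: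
  "(flat k has_real_derivative (flat (k + 2) t - real k * flat (k + 1) t)) (at t)"
proof -
  consider "t > 0" | "t < 0" | "t = 0" by linarith
  then show ?thesis
  proof cases
    case 1
    have "((\<lambda>t. exp (- 1 / t) / t ^ k) has_real_derivative
           (flat (k + 2) t - real k * flat (k + 1) t)) (at t)"
    proof -
      have "((\<lambda>t. exp (- 1 / t) / t ^ k) has_real_derivative
           ((exp (- 1 / t) * (1 / t\<^sup>2)) * t ^ k - exp (- 1 / t) * (real k * t ^ (k - 1))) / (t ^ k * t ^ k)) (at t)"
        using 1 by (auto intro!: derivative_eq_intros simp: power2_eq_square)
      moreover have "((exp (- 1 / t) * (1 / t\<^sup>2)) * t ^ k - exp (- 1 / t) * (real k * t ^ (k - 1))) / (t ^ k * t ^ k)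
          = flat (k + 2) t - real k * flat (k + 1) t"
        using 1 by (cases k) (auto simp: flat_def field_simps power2_eq_square)
      ultimately show ?thesis by simp
    qed
    then show ?thesis
      by (rule has_field_derivative_transform_within[where d=t]) (use 1 in \<open>auto simp: flat_def dist_real_def\<close>)
  next
    case 2
    have "((\<lambda>_. 0) has_real_derivative (flat (k + 2) t - real k * flat (k + 1) t)) (at t)"
      using 2 by (simp add: flat_def)
    then show ?thesis
      by (rule has_field_derivative_transform_within[where d="-t"])
        (use 2 in \<open>auto simp: flat_def dist_real_def\<close>)
  next
    case 3
    have "((\<lambda>h. (flat k (0 + h) - flat k 0) / h) \<longlongrightarrow> 0) (at 0)"
    proof (rule Lim_transform_eventually[OF flat_tendsto_0[of "Suc k"]])
      show "\<forall>\<^sub>F h in at 0. flat (Suc k) h = (flat k (0 + h) - flat k 0) / h"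
        by (rule always_eventually) (simp add: flat_def field_simps)
    qed
    then show ?thesis using 3 by (simp add: flat_def has_field_derivative_iff)
  qed
qed

text \<open>
  Generated by the flat functions of affine forms and closed under sums and products, this set is closed under
  partial differentiation. Membership therefore gives all derivatives at once, with no induction on their order.
\<close>

inductive_set smooth_alg :: "('a::euclidean_space \<Rightarrow> complex) set" where
  smooth_const: "(\<lambda>_. c) \<in> smooth_alg"
| smooth_flat: "(\<lambda>x. complex_of_real (flat k (x \<bullet> w + s))) \<in> smooth_alg"
| smooth_add: "f \<in> smooth_alg \<Longrightarrow> g \<in> smooth_alg \<Longrightarrow> (\<lambda>x. f x + g x) \<in> smooth_alg"
| smooth_mult: "f \<in> smooth_alg \<Longrightarrow> g \<in> smooth_alg \<Longrightarrow> (\<lambda>x. f x * g x) \<in> smooth_alg"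

lemma smooth_alg_derivative:
  assumes "f \<in> smooth_alg"
  shows "\<exists>f'. (\<forall>x. (f has_derivative f' x) (at x)) \<and> (\<forall>v. (\<lambda>x. f' x v) \<in> smooth_alg)"
  using assms
proof (induction rule: smooth_alg.induct)
  case (smooth_const c)
  show ?case by (intro exI[of _ "\<lambda>_ _. 0"]) (auto intro: smooth_alg.intros)
next
  case (smooth_flat k w s)
  let ?f' = "\<lambda>x v. complex_of_real (v \<bullet> w) * (complex_of_real (flat (k + 2) (x \<bullet> w + s))
               + complex_of_real (- real k) * complex_of_real (flat (k + 1) (x \<bullet> w + s)))"
  have "((\<lambda>x. complex_of_real (flat k (x \<bullet> w + s))) has_derivative ?f' x) (at x)" for x
  proof -
    have "((\<lambda>x. flat k (x \<bullet> w + s)) has_derivative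
            (\<lambda>v. (v \<bullet> w) * (flat (k + 2) (x \<bullet> w + s) - real k * flat (k + 1) (x \<bullet> w + s)))) (at x)"
      by (rule DERIV_compose_FDERIV[OF flat_has_derivative]) (auto intro!: derivative_eq_intros)
    from has_derivative_of_real[OF this] show ?thesis by (simp add: algebra_simps)
  qed
  moreover have "(\<lambda>x. ?f' x v) \<in> smooth_alg" for v by (intro smooth_alg.intros)
  ultimately show ?case by (intro exI[of _ ?f'] conjI allI)
next
  case (smooth_add f g)
  then obtain f' g' where "\<And>x. (f has_derivative f' x) (at x)" "\<And>v. (\<lambda>x. f' x v) \<in> smooth_alg"
     "\<And>x. (g has_derivative g' x) (at x)" "\<And>v. (\<lambda>x. g' x v) \<in> smooth_alg" by blast
  then show ?case
    by (intro exI[of _ "\<lambda>x v. f' x v + g' x v"]) (auto intro!: derivative_intros smooth_alg.intros)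
next
  case (smooth_mult f g)
  then obtain f' g' where "\<And>x. (f has_derivative f' x) (at x)" "\<And>v. (\<lambda>x. f' x v) \<in> smooth_alg"
     "\<And>x. (g has_derivative g' x) (at x)" "\<And>v. (\<lambda>x. g' x v) \<in> smooth_alg" by blast
  then show ?case using smooth_mult.hyps
    by (intro exI[of _ "\<lambda>x v. f x * g' x v + f' x v * g x"])
      (auto intro!: has_derivative_mult smooth_alg.intros)
qed

lemma smooth_alg_partial: "f \<in> smooth_alg \<Longrightarrow> partial_derivs is f \<in> smooth_alg"
proof (induction "is")
  case (Cons i "is")
  then obtain g' where g': "\<And>x. (partial_derivs is f has_derivative g' x) (at x)"
    "\<And>v. (\<lambda>x. g' x v) \<in> smooth_alg" using smooth_alg_derivative by blast
  have "partial_derivs (i # is) f = (\<lambda>x. g' x i)"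
    by (simp add: frechet_derivative_at[OF g'(1), symmetric])
  then show ?case using g'(2) by simp
qed simp

lemma smooth_alg_test:
  assumes "f \<in> smooth_alg" "\<And>x. f x \<noteq> 0 \<Longrightarrow> norm x \<le> R"
  shows "f \<in> test_functions"
  unfolding test_functions_def
proof (intro CollectI conjI allI impI)
  fix "is" and x :: 'a
  show "partial_derivs is f differentiable at x"
    using smooth_alg_derivative[OF smooth_alg_partial[OF assms(1)]] unfolding differentiable_def by blast
  show "compact (closure {x. f x \<noteq> 0})"
    unfolding compact_closure using assms(2) by (intro boundedI) auto
qed

text \<open>
  Supported in a box; as \<open>m\<close> grows the factors \<open>exp (- 1 / (m s))\<close> tend to \<open>1\<close> inside the box, so these functions
  increase to its indicator (\<open>bump_tendsto\<close>).
\<close>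

definition bump :: "real \<Rightarrow> 'a \<Rightarrow> 'a \<Rightarrow> 'a::euclidean_space \<Rightarrow> real" where
  "bump m a b x = (\<Prod>i\<in>Basis. flat 0 (m * (x \<bullet> i - a \<bullet> i)) * flat 0 (m * (b \<bullet> i - x \<bullet> i)))"

lemma flat_pos_iff: "m > 0 \<Longrightarrow> 0 < flat 0 (m * t) \<longleftrightarrow> 0 < t"
  by (simp add: flat_def zero_less_mult_iff)

lemma flat_nonneg: "0 \<le> flat 0 t" and flat_le_1: "flat 0 t \<le> 1"
  by (auto simp: flat_def)

lemma bump_range: "0 \<le> bump m a b x" "bump m a b x \<le> 1"
  unfolding bump_def
  by (auto intro!: prod_nonneg prod_le_1 mult_nonneg_nonneg mult_le_one flat_nonneg flat_le_1)

lemma bump_eq_0: "m > 0 \<Longrightarrow> x \<notin> box a b \<Longrightarrow> bump m a b x = 0"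
  unfolding bump_def box_def by (auto simp: flat_def zero_less_mult_iff)

lemma bump_pos: "m > 0 \<Longrightarrow> x \<in> box a b \<Longrightarrow> bump m a b x > 0"
  unfolding bump_def box_def by (auto intro!: prod_pos mult_pos_pos simp: flat_pos_iff)

lemma smooth_alg_prod: "(\<And>i. i \<in> A \<Longrightarrow> f i \<in> smooth_alg) \<Longrightarrow> (\<lambda>x. \<Prod>i\<in>A. f i x) \<in> smooth_alg"
  by (induction A rule: infinite_finite_induct) (auto intro: smooth_alg.intros)

lemma bump_test: 
  assumes m: "m > 0"
  shows "(\<lambda>x. complex_of_real (bump m a b x)) \<in> test_functions"
proof -
  have *: "(\<lambda>x. complex_of_real (bump m a b x)) = (\<lambda>x. \<Prod>i\<in>Basis.
      complex_of_real (flat 0 (x \<bullet> (m *\<^sub>R i) + - m * (a \<bullet> i))) *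
      complex_of_real (flat 0 (x \<bullet> ((- m) *\<^sub>R i) + m * (b \<bullet> i))))"
    by (auto simp: bump_def algebra_simps intro!: ext)
  obtain R where R: "\<And>x. x \<in> box a b \<Longrightarrow> norm x \<le> R"
    using bounded_box[of a b] unfolding bounded_iff by blast
  have "(\<lambda>x. complex_of_real (bump m a b x)) \<in> smooth_alg"
    unfolding * by (intro smooth_alg_prod smooth_alg.intros)
  then show ?thesis
    by (rule smooth_alg_test[of _ R]) (use bump_eq_0[OF m] R in force)
qed

lemma bump_tendsto: "(\<lambda>n. bump (real (Suc n)) a b x) \<longlonglongrightarrow> indicator (box a b) x"
proof (cases "x \<in> box a b")
  case True
  have *: "(\<lambda>n. flat 0 (real (Suc n) * t)) \<longlonglongrightarrow> 1" if "t > 0" for t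
  proof -
    have "(\<lambda>n. exp (- (inverse (real (Suc n)) * inverse t))) \<longlonglongrightarrow> exp (- (0 * inverse t))"
      by (intro tendsto_intros LIMSEQ_inverse_real_of_nat)
    then show ?thesis using that by (simp add: flat_def divide_inverse zero_less_mult_iff del: of_nat_Suc)
  qed
  have "(\<lambda>n. bump (real (Suc n)) a b x) \<longlonglongrightarrow> (\<Prod>i\<in>(Basis::'a set). 1 * 1)"
    unfolding bump_def using True by (intro tendsto_intros *) (auto simp: box_def)
  then show ?thesis using True by simp
next
  case False
  then show ?thesis by (simp add: bump_eq_0 del: of_nat_Suc)
qed

lemma partial_derivs_append: "partial_derivs (is @ js) f = partial_derivs is (partial_derivs js f)"
  by (induction "is") auto

lemma test_partial_differentiable:
  "\<phi> \<in> test_functions \<Longrightarrow> set is \<subseteq> Basis \<Longrightarrow> partial_derivs is \<phi> differentiable at x"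
  by (simp add: test_functions_def)

lemma test_differentiable: "\<phi> \<in> test_functions \<Longrightarrow> \<phi> differentiable at x"
  using test_partial_differentiable[of \<phi> "[]" x] by simp

lemma test_has_derivative:
  "\<phi> \<in> test_functions \<Longrightarrow> (\<phi> has_derivative frechet_derivative \<phi> (at x)) (at x)"
  using test_differentiable frechet_derivative_works by blast

lemma test_support:
  assumes "\<phi> \<in> test_functions"
  obtains R where "R > 0" "\<And>x. norm x > R \<Longrightarrow> \<phi> x = 0"
proof -
  have "bounded {x. \<phi> x \<noteq> 0}" using assms by (simp add: test_functions_def compact_closure)
  then obtain R where "R > 0" "\<forall>x\<in>{x. \<phi> x \<noteq> 0}. norm x \<le> R" using bounded_pos by blast
  then show thesis using that[of R] by force
qed

lemma partial_derivs_zero_outside: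
  assumes "\<And>x. norm x > R \<Longrightarrow> f x = 0" "norm x > R"
  shows "partial_derivs is f x = 0"
  using assms(2)
proof (induction "is" arbitrary: x)
  case (Cons i "is")
  have "open {x::'a. norm x > R}" by (intro open_Collect_less continuous_intros)
  then have "(partial_derivs is f has_derivative (\<lambda>_. 0)) (at x)"
    using Cons has_derivative_transform_within_open[where f="\<lambda>_. 0" and t=UNIV and x=x and f'="\<lambda>_. 0"
      and s="{x. norm x > R}" and g="partial_derivs is f"] by simp
  then show ?case by (simp add: frechet_derivative_at[symmetric])
qed (simp add: assms)

lemma test_partial:
  assumes "\<phi> \<in> test_functions" "set is \<subseteq> Basis"
  shows "partial_derivs is \<phi> \<in> test_functions"
  unfolding test_functions_def
proof (intro CollectI conjI allI impI)
  obtain R where R: "\<And>x. norm x > R \<Longrightarrow> \<phi> x = 0" using test_support[OF assms(1)] by metis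
  show "compact (closure {x. partial_derivs is \<phi> x \<noteq> 0})"
    unfolding compact_closure using partial_derivs_zero_outside[of R \<phi>, OF R] by (intro boundedI[of _ R]) force
  fix js x assume "set js \<subseteq> (Basis :: 'a set)"
  then show "partial_derivs js (partial_derivs is \<phi>) differentiable at x"
    using assms test_partial_differentiable[of \<phi> "js @ is"] by (simp add: partial_derivs_append)
qed

lemma has_derivative_translate:
  fixes f :: "'a::real_normed_vector \<Rightarrow> 'b::real_normed_vector"
  assumes "(f has_derivative f') (at (x + c))"
  shows "((\<lambda>x. f (x + c)) has_derivative f') (at x)"
proof -
  have "((\<lambda>x. x + c) has_derivative (\<lambda>v. v)) (at x)"
    by (auto intro!: derivative_eq_intros)
  from has_derivative_compose[OF this, where g=f and g'=f'] assms show ?thesis by simp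
qed

lemma partial_derivs_translate:
  assumes "\<phi> \<in> test_functions" "set is \<subseteq> Basis"
  shows "partial_derivs is (\<lambda>x. \<phi> (x + c)) = (\<lambda>x. partial_derivs is \<phi> (x + c))"
  using assms(2)
proof (induction "is")
  case (Cons i "is")
  have "frechet_derivative (\<lambda>x. partial_derivs is \<phi> (x + c)) (at x)
        = frechet_derivative (partial_derivs is \<phi>) (at (x + c))" for x
  proof -
    have "(partial_derivs is \<phi> has_derivative frechet_derivative (partial_derivs is \<phi>) (at (x + c))) (at (x + c))"
      using test_partial_differentiable[OF assms(1), of "is"] Cons.prems frechet_derivative_works by fastforce
    from has_derivative_translate[OF this] show ?thesis by (rule frechet_derivative_at[symmetric])
  qed
  then show ?case using Cons by simp
qed simp

lemma test_translate:
  assumes "\<phi> \<in> test_functions"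
  shows "(\<lambda>x. \<phi> (x + c)) \<in> test_functions"
  unfolding test_functions_def
proof (intro CollectI conjI allI impI)
  obtain R where R: "\<And>x. norm x > R \<Longrightarrow> \<phi> x = 0" using test_support[OF assms(1)] by metis
  have "norm x \<le> R + norm c" if "\<phi> (x + c) \<noteq> 0" for x
    using R[of "x + c"] that norm_triangle_ineq4[of "x + c" c] by force
  then show "compact (closure {x. \<phi> (x + c) \<noteq> 0})"
    unfolding compact_closure by (intro boundedI[of _ "R + norm c"]) auto
  fix "is" x assume *: "set is \<subseteq> (Basis :: 'a set)"
  have "(\<lambda>x. partial_derivs is \<phi> (x + c)) differentiable at x"
    using test_partial_differentiable[OF assms *, of "x + c"] has_derivative_translate
    unfolding differentiable_def by blast
  then show "partial_derivs is (\<lambda>x. \<phi> (x + c)) differentiable at x"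
    using partial_derivs_translate[OF assms *] by simp
qed

lemma partial_derivs_lin:
  assumes "\<phi> \<in> test_functions" "\<psi> \<in> test_functions" "set is \<subseteq> Basis"
  shows "partial_derivs is (\<lambda>x. a * \<phi> x + b * \<psi> x)
         = (\<lambda>x. a * partial_derivs is \<phi> x + b * partial_derivs is \<psi> x)"
  using assms(3)
proof (induction "is")
  case (Cons i "is")
  have "frechet_derivative (\<lambda>x. a * partial_derivs is \<phi> x + b * partial_derivs is \<psi> x) (at x)
        = (\<lambda>v. a * frechet_derivative (partial_derivs is \<phi>) (at x) v
             + b * frechet_derivative (partial_derivs is \<psi>) (at x) v)" for x
  proof (rule frechet_derivative_at[symmetric])
    have "(partial_derivs is \<phi> has_derivative frechet_derivative (partial_derivs is \<phi>) (at x)) (at x)"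
      "(partial_derivs is \<psi> has_derivative frechet_derivative (partial_derivs is \<psi>) (at x)) (at x)"
      using assms test_partial_differentiable[of _ "is" x] Cons.prems frechet_derivative_works by fastforce+
    then show "((\<lambda>x. a * partial_derivs is \<phi> x + b * partial_derivs is \<psi> x) has_derivative
        (\<lambda>v. a * frechet_derivative (partial_derivs is \<phi>) (at x) v
             + b * frechet_derivative (partial_derivs is \<psi>) (at x) v)) (at x)"
      by (intro has_derivative_add has_derivative_mult_right)
  qed
  then show ?case using Cons by simp
qed simp

lemma test_lin:
  assumes "\<phi> \<in> test_functions" "\<psi> \<in> test_functions"
  shows "(\<lambda>x. a * \<phi> x + b * \<psi> x) \<in> test_functions"
  unfolding test_functions_def
proof (intro CollectI conjI allI impI)
  obtain R S where R: "\<And>x. norm x > R \<Longrightarrow> \<phi> x = 0" "\<And>x. norm x > S \<Longrightarrow> \<psi> x = 0"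
    using test_support[OF assms(1)] test_support[OF assms(2)] by metis
  have "norm x \<le> max R S" if "a * \<phi> x + b * \<psi> x \<noteq> 0" for x
    using R(1)[of x] R(2)[of x] that by fastforce
  then show "compact (closure {x. a * \<phi> x + b * \<psi> x \<noteq> 0})"
    unfolding compact_closure by (intro boundedI[of _ "max R S"]) auto
  fix "is" x assume *: "set is \<subseteq> (Basis :: 'a set)"
  show "partial_derivs is (\<lambda>x. a * \<phi> x + b * \<psi> x) differentiable at x"
    unfolding partial_derivs_lin[OF assms *]
    by (intro derivative_intros test_partial_differentiable assms *)
qed

lemma test_zero: "(\<lambda>_. 0) \<in> test_functions"
  by (rule smooth_alg_test[of _ 0]) (auto intro: smooth_alg.intros)

lemma test_sum: "(\<And>i. i \<in> A \<Longrightarrow> f i \<in> test_functions) \<Longrightarrow> (\<lambda>x. \<Sum>i\<in>A. f i x) \<in> test_functions"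
proof (induction A rule: infinite_finite_induct)
  case (insert i A)
  then show ?case using test_lin[of "f i" "\<lambda>x. \<Sum>i\<in>A. f i x" 1 1] by simp
qed (auto simp: test_zero)

lemma test_continuous: "\<phi> \<in> test_functions \<Longrightarrow> continuous_on A \<phi>"
  by (meson differentiable_imp_continuous_within test_differentiable continuous_at_imp_continuous_on)

lemma test_measurable: "\<phi> \<in> test_functions \<Longrightarrow> \<phi> \<in> borel_measurable borel"
  by (rule borel_measurable_continuous_onI[OF test_continuous])

lemma test_bounded:
  assumes "\<phi> \<in> test_functions"
  obtains B where "B > 0" "\<And>x. cmod (\<phi> x) \<le> B"
proof -
  obtain R where R: "R > 0" "\<And>x. norm x > R \<Longrightarrow> \<phi> x = 0" using test_support[OF assms] by metis
  have "bounded (\<phi> ` cball 0 R)"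
    by (intro compact_imp_bounded compact_continuous_image test_continuous assms) auto
  then obtain B where B: "B > 0" "\<And>x. norm x \<le> R \<Longrightarrow> cmod (\<phi> x) \<le> B"
    unfolding bounded_pos by auto
  show thesis
  proof (rule that[of B])
    show "cmod (\<phi> x) \<le> B" for x using B R(2)[of x] by (cases "norm x \<le> R") auto
  qed (rule B)
qed

lemma integrable_bounded_support:
  fixes f :: "'a::euclidean_space \<Rightarrow> 'b::{banach,second_countable_topology}"
  assumes "f \<in> borel_measurable borel" "\<And>x. norm (f x) \<le> B" "\<And>x. norm x > R \<Longrightarrow> f x = 0"
  shows "integrable lborel f"
proof (rule Bochner_Integration.integrable_bound[where f="\<lambda>x. B * indicator (cball 0 R) x"])
  show "integrable lborel (\<lambda>x. B * indicator (cball (0::'a) R) x)"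
    using emeasure_lborel_cball_finite[of "0::'a" R] by (intro integrable_mult_right integrable_real_indicator) auto
  show "AE x in lborel. norm (f x) \<le> norm (B * indicator (cball 0 R) x)"
    using assms(2,3) by (intro AE_I2) (auto simp: indicator_def intro: order_trans[OF assms(2) abs_ge_self])
qed (use assms in auto)

lemma test_L2: assumes "\<phi> \<in> test_functions" shows "\<phi> \<in> L2"
proof (rule L2I)
  obtain B where B: "B > 0" "\<And>x. cmod (\<phi> x) \<le> B" using test_bounded[OF assms] by metis
  obtain R where R: "\<And>x. norm x > R \<Longrightarrow> \<phi> x = 0" using test_support[OF assms] by metis
  show "integrable lborel (\<lambda>x. (cmod (\<phi> x))\<^sup>2)"
  proof (rule integrable_bounded_support[where B="B\<^sup>2" and R=R])
    show "(\<lambda>x. (cmod (\<phi> x))\<^sup>2) \<in> borel_measurable borel" using test_measurable[OF assms] by measurable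
  qed (use B R in \<open>auto intro!: power_mono\<close>)
qed (rule test_measurable[OF assms])

text \<open>
  The derivative along an arbitrary vector, so that translations need not be split into coordinate
  steps.
\<close>

definition dir_deriv :: "'a::euclidean_space \<Rightarrow> ('a \<Rightarrow> complex) \<Rightarrow> 'a \<Rightarrow> complex" where
  "dir_deriv z \<phi> x = frechet_derivative \<phi> (at x) z"

lemma dir_deriv_expand:
  assumes "\<phi> \<in> test_functions"
  shows "dir_deriv z \<phi> = (\<lambda>x. \<Sum>i\<in>Basis. complex_of_real (z \<bullet> i) * partial_derivs [i] \<phi> x)"
proof
  fix x
  interpret bounded_linear "frechet_derivative \<phi> (at x)"
    using test_has_derivative[OF assms] by (rule has_derivative_bounded_linear)
  have "dir_deriv z \<phi> x = frechet_derivative \<phi> (at x) (\<Sum>i\<in>Basis. (z \<bullet> i) *\<^sub>R i)"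
    by (simp add: dir_deriv_def euclidean_representation)
  also have "\<dots> = (\<Sum>i\<in>Basis. complex_of_real (z \<bullet> i) * partial_derivs [i] \<phi> x)"
    by (simp add: sum scaleR scaleR_conv_of_real)
  finally show "dir_deriv z \<phi> x = (\<Sum>i\<in>Basis. complex_of_real (z \<bullet> i) * partial_derivs [i] \<phi> x)" .
qed

lemma dir_deriv_basis: "dir_deriv i \<phi> = partial_derivs [i] \<phi>" by (simp add: dir_deriv_def fun_eq_iff)

lemma test_dir_deriv:
  assumes "\<phi> \<in> test_functions" shows "dir_deriv z \<phi> \<in> test_functions"
  unfolding dir_deriv_expand[OF assms]
proof (rule test_sum)
  fix i :: 'a assume "i \<in> Basis"
  then show "(\<lambda>x. complex_of_real (z \<bullet> i) * partial_derivs [i] \<phi> x) \<in> test_functions"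
    using test_lin[OF test_partial[OF assms, of "[i]"] test_zero, of "complex_of_real (z \<bullet> i)" 0] by simp
qed

lemma dir_deriv_translate:
  assumes "\<phi> \<in> test_functions" shows "dir_deriv z (\<lambda>x. \<phi> (x + c)) = (\<lambda>x. dir_deriv z \<phi> (x + c))"
  unfolding dir_deriv_expand[OF assms] dir_deriv_expand[OF test_translate[OF assms]]
  by (intro ext sum.cong) (simp_all only: partial_derivs_translate[OF assms] set_simps empty_subsetI insert_subset)

lemma test_lipschitz:
  assumes "\<phi> \<in> test_functions"
  obtains B where "B > 0" "\<And>x w. cmod (\<phi> (x + w) - \<phi> x) \<le> B * norm w"
proof -
  have "\<exists>B>0. \<forall>x. cmod (partial_derivs [i] \<phi> x) \<le> B" if "i \<in> Basis" for i
    using test_bounded[OF test_partial[OF assms, of "[i]"]] that by (metis empty_subsetI insert_subset list.set(1,2))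
  then obtain B where B: "\<And>i x. i \<in> Basis \<Longrightarrow> B i > 0 \<and> cmod (partial_derivs [i] \<phi> x) \<le> B i" by metis
  show thesis
  proof (rule that[of "sum B Basis"])
    show "sum B Basis > 0" using B by (intro sum_pos) auto
    fix x w
    have "onorm (frechet_derivative \<phi> (at y)) \<le> sum B Basis" for y
    proof (rule onorm_le)
      fix v
      have "cmod (dir_deriv v \<phi> y) \<le> (\<Sum>i\<in>Basis. cmod (complex_of_real (v \<bullet> i) * partial_derivs [i] \<phi> y))"
        unfolding dir_deriv_expand[OF assms] by (rule norm_sum)
      also have "\<dots> \<le> (\<Sum>i\<in>Basis. norm v * B i)"
        unfolding norm_mult norm_of_real by (intro sum_mono mult_mono Basis_le_norm) (use B in auto)
      finally show "cmod (frechet_derivative \<phi> (at y) v) \<le> sum B Basis * norm v"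
        by (simp add: dir_deriv_def sum_distrib_left mult.commute)
    qed
    then show "cmod (\<phi> (x + w) - \<phi> x) \<le> sum B Basis * norm w"
      using differentiable_bound[of UNIV \<phi> "\<lambda>y. frechet_derivative \<phi> (at y)" "sum B Basis" "x + w" x]
        test_has_derivative[OF assms] by simp
  qed
qed

lemma dir_deriv_tendsto:
  assumes "\<phi> \<in> test_functions" "s \<longlonglongrightarrow> 0" "\<And>n. s n \<noteq> (0::real)"
  shows "(\<lambda>n. (\<phi> (x + s n *\<^sub>R z) - \<phi> x) / complex_of_real (s n)) \<longlonglongrightarrow> dir_deriv z \<phi> x"
proof -
  have "((\<lambda>t. \<phi> (x + t *\<^sub>R z)) has_vector_derivative dir_deriv z \<phi> x) (at 0)"
  proof -
    have "((\<lambda>t. \<phi> (x + t *\<^sub>R z)) has_derivative (\<lambda>t. frechet_derivative \<phi> (at (x + 0 *\<^sub>R z)) (t *\<^sub>R z))) (at 0)"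
      by (rule has_derivative_compose[of "\<lambda>t. x + t *\<^sub>R z" "\<lambda>t. t *\<^sub>R z"], auto intro!: derivative_eq_intros)
        (use test_has_derivative[OF assms(1)] in simp)
    moreover have "frechet_derivative \<phi> (at x) (t *\<^sub>R z) = t *\<^sub>R dir_deriv z \<phi> x" for t
      using has_derivative_bounded_linear[OF test_has_derivative[OF assms(1), of x]]
      by (simp add: dir_deriv_def linear_simps)
    ultimately show ?thesis by (simp add: has_vector_derivative_def)
  qed
  then have "((\<lambda>h. norm (\<phi> (x + h *\<^sub>R z) - \<phi> x - h *\<^sub>R dir_deriv z \<phi> x) / norm h) \<longlongrightarrow> 0) (at 0)"
    by (simp add: has_vector_derivative_def has_derivative_at)
  moreover have "filterlim s (at 0) sequentially"
    using assms by (simp add: filterlim_at)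
  ultimately have "(\<lambda>n. norm (\<phi> (x + s n *\<^sub>R z) - \<phi> x - s n *\<^sub>R dir_deriv z \<phi> x) / norm (s n)) \<longlonglongrightarrow> 0"
    by (rule filterlim_compose)
  moreover have "norm (\<phi> (x + s n *\<^sub>R z) - \<phi> x - s n *\<^sub>R dir_deriv z \<phi> x) / norm (s n)
      = norm ((\<phi> (x + s n *\<^sub>R z) - \<phi> x) / complex_of_real (s n) - dir_deriv z \<phi> x)" for n
  proof -
    have "(\<phi> (x + s n *\<^sub>R z) - \<phi> x) / complex_of_real (s n) - dir_deriv z \<phi> x
        = (\<phi> (x + s n *\<^sub>R z) - \<phi> x - s n *\<^sub>R dir_deriv z \<phi> x) / complex_of_real (s n)"
      using assms(3)[of n] by (simp add: scaleR_conv_of_real diff_divide_distrib)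
    then show ?thesis by (simp add: norm_divide)
  qed
  ultimately have "(\<lambda>n. norm ((\<phi> (x + s n *\<^sub>R z) - \<phi> x) / complex_of_real (s n) - dir_deriv z \<phi> x)) \<longlonglongrightarrow> 0"
    by simp
  then show ?thesis by (simp only: tendsto_norm_zero_iff LIM_zero_iff)
qed

text \<open>
  Dominated convergence: the quotients converge pointwise, are bounded by a Lipschitz constant and vanish outside a
  fixed ball.
\<close>

lemma test_difference_quotient_L2:
  assumes \<phi>: "\<phi> \<in> test_functions" and s: "s \<longlonglongrightarrow> 0" "\<And>n. s n \<noteq> (0::real)"
  shows "(\<lambda>n. l2sq (\<lambda>x. (\<phi> (x + s n *\<^sub>R z) - \<phi> x) / complex_of_real (s n) - dir_deriv z \<phi> x)) \<longlonglongrightarrow> 0"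
proof -
  obtain B where B: "B > 0" "\<And>x w. cmod (\<phi> (x + w) - \<phi> x) \<le> B * norm w" using test_lipschitz[OF \<phi>] by metis
  obtain R where R: "\<And>x. norm x > R \<Longrightarrow> \<phi> x = 0" using test_support[OF \<phi>] by metis
  obtain S where S: "\<And>n. \<bar>s n\<bar> \<le> S"
    using convergent_imp_Bseq[OF convergentI[OF s(1)]] unfolding Bseq_def by auto
  obtain C where C: "C > 0" "\<And>x. cmod (dir_deriv z \<phi> x) \<le> C" using test_bounded[OF test_dir_deriv[OF \<phi>]] by metis
  note [measurable] = test_measurable[OF \<phi>] test_measurable[OF test_dir_deriv[OF \<phi>, of z]]
  define T where "T = R + S * norm z"
  have S0: "S \<ge> 0" using S[of 0] by linarith
  have out: "\<phi> (x + s n *\<^sub>R z) = 0" "\<phi> x = 0" "dir_deriv z \<phi> x = 0" if "norm x > T" for x n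
  proof -
    have "\<bar>s n\<bar> * norm z \<le> S * norm z" using S by (intro mult_right_mono) auto
    then have "norm (x + s n *\<^sub>R z) > R" using norm_triangle_ineq4[of "x + s n *\<^sub>R z" "s n *\<^sub>R z"] that
      by (simp add: T_def)
    then show "\<phi> (x + s n *\<^sub>R z) = 0" by (rule R)
    have "norm x > R" using that S0 by (simp add: T_def) (smt (verit) mult_nonneg_nonneg norm_ge_zero)
    then show "\<phi> x = 0" "dir_deriv z \<phi> x = 0"
      using R partial_derivs_zero_outside[of R \<phi> x, OF R]
      by (auto simp: dir_deriv_expand[OF \<phi>] simp del: partial_derivs.simps)
  qed
  define q where "q n x = (\<phi> (x + s n *\<^sub>R z) - \<phi> x) / complex_of_real (s n) - dir_deriv z \<phi> x" for n x
  have qb: "cmod (q n x) \<le> B * norm z + C" for n x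
  proof -
    have "cmod ((\<phi> (x + s n *\<^sub>R z) - \<phi> x) / complex_of_real (s n)) \<le> B * norm z"
      using B(2)[of x "s n *\<^sub>R z"] s(2)[of n] by (simp add: norm_divide divide_simps mult_ac)
    then show ?thesis unfolding q_def using C(2)[of x] norm_triangle_ineq4 by (meson add_mono order_trans)
  qed
  have "(\<lambda>n. LINT x|lborel. (cmod (q n x))\<^sup>2) \<longlonglongrightarrow> (LINT (x::'a)|lborel. 0)"
  proof (rule integral_dominated_convergence)
    show "integrable lborel (\<lambda>x. (B * norm z + C)\<^sup>2 * indicator (cball (0::'a) T) x)"
      using emeasure_lborel_cball_finite[of "0::'a" T] by (intro integrable_mult_right integrable_real_indicator) auto
    show "AE x in lborel. (\<lambda>n. (cmod (q n x))\<^sup>2) \<longlonglongrightarrow> 0"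
    proof (rule AE_I2)
      fix x
      have "(\<lambda>n. q n x) \<longlonglongrightarrow> dir_deriv z \<phi> x - dir_deriv z \<phi> x"
        unfolding q_def by (intro tendsto_intros dir_deriv_tendsto assms)
      then have "(\<lambda>n. (cmod (q n x))\<^sup>2) \<longlonglongrightarrow> (cmod (dir_deriv z \<phi> x - dir_deriv z \<phi> x))\<^sup>2" by (intro tendsto_intros)
      then show "(\<lambda>n. (cmod (q n x))\<^sup>2) \<longlonglongrightarrow> 0" by simp
    qed
    show "AE x in lborel. norm ((cmod (q n x))\<^sup>2) \<le> (B * norm z + C)\<^sup>2 * indicator (cball 0 T) x" for n
      
    proof (rule AE_I2)
      fix x
      show "norm ((cmod (q n x))\<^sup>2) \<le> (B * norm z + C)\<^sup>2 * indicator (cball 0 T) x"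
      proof (cases "norm x > T")
        case True
        then show ?thesis using out[OF True] by (simp add: q_def)
      next
        case False
        then show ?thesis using qb[of n x] by (simp add: power_mono)
      qed
    qed
    show "(\<lambda>x. (cmod (q n x))\<^sup>2) \<in> borel_measurable lborel" for n unfolding q_def by measurable
  qed auto
  then show ?thesis by (simp add: l2sq_def q_def)
qed

section \<open>The fundamental lemma and density of test functions\<close>

lemma locally_integrable_measurable:
  assumes "locally_integrable (f :: 'a::euclidean_space \<Rightarrow> complex)"
  shows "f \<in> borel_measurable borel"
proof (rule borel_measurable_LIMSEQ_metric)
  show "(\<lambda>x. indicator (cball (0::'a) (real n)) x *\<^sub>R f x) \<in> borel_measurable borel" for n
  proof -
    have "integrable lborel (\<lambda>x. indicator (cball (0::'a) (real n)) x *\<^sub>R f x)"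
      using assms by (simp add: locally_integrable_def set_integrable_def)
    then show ?thesis by (auto dest: borel_measurable_integrable)
  qed
  fix x :: 'a
  obtain N :: nat where N: "norm x \<le> real N" using real_arch_simple by blast
  have "\<forall>\<^sub>F n in sequentially. indicator (cball (0::'a) (real n)) x *\<^sub>R f x = f x"
    using eventually_ge_at_top[of N] by eventually_elim (use N in \<open>auto simp: indicator_def\<close>)
  then show "(\<lambda>n. indicator (cball (0::'a) (real n)) x *\<^sub>R f x) \<longlonglongrightarrow> f x"
    by (rule tendsto_eventually)
qed

lemma indicator_L2:
  fixes A :: "'a::euclidean_space set"
  assumes [measurable]: "A \<in> sets borel" and "emeasure lborel A < \<infinity>"
  shows "(\<lambda>x. complex_of_real (indicator A x)) \<in> L2" "l2sq (\<lambda>x. complex_of_real (indicator A x)) = measure lborel A"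
proof -
  have *: "(cmod (complex_of_real (indicator A x)))\<^sup>2 = indicator A x" for x
    by (auto simp: indicator_def)
  show "(\<lambda>x. complex_of_real (indicator A x)) \<in> L2"
  proof (rule L2I)
    show "integrable lborel (\<lambda>x. (cmod (complex_of_real (indicator A x)))\<^sup>2)"
      unfolding * using assms by (intro integrable_real_indicator) auto
  qed measurable
  show "l2sq (\<lambda>x. complex_of_real (indicator A x)) = measure lborel A"
    unfolding l2sq_def * by simp
qed

lemma L2_set_integrable:
  assumes "f \<in> L2" "A \<in> sets borel" "emeasure lborel A < \<infinity>"
  shows "integrable lborel (\<lambda>x. indicator A x *\<^sub>R f x)"
  using L2_integrable_mult[OF indicator_L2(1)[OF assms(2,3)] assms(1)] by (simp add: scaleR_conv_of_real)

lemma L2_locally_integrable: "f \<in> L2 \<Longrightarrow> locally_integrable f"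
  unfolding locally_integrable_def set_integrable_def
  by (intro allI impI L2_set_integrable borel_closed compact_imp_closed emeasure_bounded_finite compact_imp_bounded)

lemma locally_integrable_bounded_mult:
  assumes f: "locally_integrable f" and h[measurable]: "h \<in> borel_measurable borel"
    and B: "\<And>x. cmod (h x) \<le> B" and R: "\<And>x. norm x > R \<Longrightarrow> h x = 0"
  shows "integrable lborel (\<lambda>x. f x * h x)"
proof (rule Bochner_Integration.integrable_bound)
  show "integrable lborel (\<lambda>x. B *\<^sub>R (indicator (cball 0 R) x *\<^sub>R f x))"
    using f by (intro integrable_scaleR_right) (auto simp: locally_integrable_def set_integrable_def)
  show "(\<lambda>x. f x * h x) \<in> borel_measurable lborel"
    using locally_integrable_measurable[OF f] by measurable
  show "AE x in lborel. norm (f x * h x) \<le> norm (B *\<^sub>R (indicator (cball 0 R) x *\<^sub>R f x))"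
  proof (rule AE_I2)
    fix x
    show "norm (f x * h x) \<le> norm (B *\<^sub>R (indicator (cball 0 R) x *\<^sub>R f x))"
    proof (cases "norm x > R")
      case False
      have "norm (f x * h x) \<le> norm (f x) * B" unfolding norm_mult by (intro mult_left_mono B) auto
      also have "\<dots> \<le> norm (f x) * \<bar>B\<bar>" by (intro mult_left_mono) auto
      finally show ?thesis using False by (simp add: mult.commute)
    qed (simp add: R)
  qed
qed

lemma test_mult_integrable:
  assumes "locally_integrable f" "\<phi> \<in> test_functions"
  shows "integrable lborel (\<lambda>x. f x * \<phi> x)"
  using test_bounded[OF assms(2)] test_support[OF assms(2)] test_measurable[OF assms(2)]
    locally_integrable_bounded_mult[OF assms(1), of \<phi>] by metis

text \<open>
  Bump functions increase to indicators of boxes, so \<open>f\<close> has integral zero over every box. Boxes are an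
  intersection-stable generator of the Borel sets, hence all integrals of \<open>f\<close> over Borel subsets of a box vanish.
\<close>

theorem fundamental_lemma:
  fixes f :: "'a::euclidean_space \<Rightarrow> complex"
  assumes f: "locally_integrable f"
    and zero: "\<And>\<phi>. \<phi> \<in> test_functions \<Longrightarrow> (LINT x|lborel. f x * \<phi> x) = 0"
  shows "AE x in lborel. f x = 0"
proof -
  note [measurable] = locally_integrable_measurable[OF f]
  have box0: "(LINT x|lborel. indicator (box a b) x *\<^sub>R f x) = 0" for a b
  proof -
    have "(\<lambda>n. LINT x|lborel. f x * complex_of_real (bump (real (Suc n)) a b x))
            \<longlonglongrightarrow> (LINT x|lborel. f x * complex_of_real (indicator (box a b) x))"
    proof (rule integral_dominated_convergence)
      show "integrable lborel (\<lambda>x. cmod (indicator (cbox a b) x *\<^sub>R f x))"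
        using f by (intro integrable_norm) (auto simp: locally_integrable_def set_integrable_def)
      show "AE x in lborel. (\<lambda>n. f x * complex_of_real (bump (real (Suc n)) a b x))
              \<longlonglongrightarrow> f x * complex_of_real (indicator (box a b) x)"
        by (intro AE_I2 tendsto_intros bump_tendsto)
      show "AE x in lborel. norm (f x * complex_of_real (bump (real (Suc n)) a b x))
              \<le> cmod (indicator (cbox a b) x *\<^sub>R f x)" for n
      proof (rule AE_I2)
        fix x
        have "norm (f x * complex_of_real (bump (real (Suc n)) a b x)) \<le> cmod (f x) * 1"
          unfolding norm_mult using bump_range[of "real (Suc n)" a b x] by (intro mult_left_mono) auto
        moreover have "norm (f x * complex_of_real (bump (real (Suc n)) a b x)) = 0" if "x \<notin> cbox a b"
          using that box_subset_cbox[of a b] by (subst bump_eq_0) auto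
        ultimately show "norm (f x * complex_of_real (bump (real (Suc n)) a b x))
              \<le> cmod (indicator (cbox a b) x *\<^sub>R f x)" by (auto simp: indicator_def)
      qed
      show "(\<lambda>x. f x * complex_of_real (bump (real (Suc n)) a b x)) \<in> borel_measurable lborel" for n
        using test_measurable[OF bump_test[of "real (Suc n)" a b]] by measurable
    qed measurable
    moreover have "(LINT x|lborel. f x * complex_of_real (bump (real (Suc n)) a b x)) = 0" for n
      by (intro zero bump_test) simp
    ultimately have "(\<lambda>n::nat. 0) \<longlonglongrightarrow> (LINT x|lborel. f x * complex_of_real (indicator (box a b) x))"
      by (simp only:)
    then have "(LINT x|lborel. f x * complex_of_real (indicator (box a b) x)) = 0"
      by (rule LIMSEQ_unique[OF _ tendsto_const])
    then show ?thesis by (simp add: scaleR_conv_of_real mult.commute)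
  qed
  have "AE x in lborel. indicator (box a b) x *\<^sub>R f x = 0" for a b
  proof -
    define g where "g x = indicator (box a b) x *\<^sub>R f x" for x
    have "integrable lborel (\<lambda>x. indicator (box a b) x *\<^sub>R (indicator (cbox a b) x *\<^sub>R f x))"
    proof (rule integrable_mult_indicator)
      show "integrable lborel (\<lambda>x. indicator (cbox a b) x *\<^sub>R f x)"
        using f by (auto simp: locally_integrable_def set_integrable_def)
    qed simp
    moreover have "indicator (box a b) x *\<^sub>R (indicator (cbox a b) x *\<^sub>R f x) = g x" for x
      using box_subset_cbox[of a b] by (auto simp: g_def indicator_def)
    ultimately have g: "integrable lborel g" by simp
    have gset: "set_integrable lborel A g" if "A \<in> sets borel" for A
      using integrable_mult_indicator[OF _ g, of A] that by (simp add: set_integrable_def)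
    have all: "(LINT x:A|lborel. g x) = 0" if "A \<in> sets borel" for A
    proof -
      have "Int_stable (range (\<lambda>(c, d). box c d :: 'a set))"
        by (auto simp: Int_stable_def box_Int_box)
      moreover have "range (\<lambda>(c, d). box c d :: 'a set) \<subseteq> Pow UNIV" by simp
      moreover have "A \<in> sigma_sets UNIV (range (\<lambda>(c, d). box c d))"
        using that by (simp add: borel_eq_box)
      ultimately show ?thesis
      proof (induction rule: sigma_sets_induct_disjoint)
        case (basic A)
        then obtain c d where A: "A = box c d" by auto
        obtain c' d' where "box c d \<inter> box a b = box c' d'" using box_Int_box by blast
        then have "indicator A x *\<^sub>R g x = indicator (box c' d') x *\<^sub>R f x" for x
          unfolding A g_def by (auto simp: indicator_def)
        then show ?case by (simp add: set_lebesgue_integral_def box0)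
      next
        case (compl A)
        then have A: "A \<in> sets borel" by (simp add: borel_eq_box)
        have "(LINT x:(UNIV - A)|lborel. g x) = (LINT x|lborel. g x - indicator A x *\<^sub>R g x)"
          unfolding set_lebesgue_integral_def by (intro Bochner_Integration.integral_cong) (auto simp: indicator_def)
        also have "\<dots> = (LINT x|lborel. g x) - (LINT x:A|lborel. g x)"
          using gset[OF A] g by (simp add: set_lebesgue_integral_def set_integrable_def)
        also have "\<dots> = 0" using compl box0[of a b] by (simp add: g_def)
        finally show ?case .
      next
        case (union A)
        then have A: "A i \<in> sets borel" for i by (auto simp: borel_eq_box)
        have "(LINT x:(\<Union>i. A i)|lborel. g x) = (\<Sum>i. (LINT x:A i|lborel. g x))"
          using A union(1) by (intro lebesgue_integral_countable_add gset) (auto simp: disjoint_family_on_def)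
        then show ?case using union by simp
      qed (auto simp: set_lebesgue_integral_def)
    qed
    have "AE x in lborel. g x = 0" by (rule sigma_finite_measure.density_zero[OF sigma_finite_lborel g]) (use all in auto)
    then show ?thesis by (simp add: g_def)
  qed
  then have "AE x in lborel. \<forall>n::nat. indicator (box (- real n *\<^sub>R One) (real n *\<^sub>R One)) x *\<^sub>R f x = 0"
    unfolding AE_all_countable by blast
  then show ?thesis
  proof eventually_elim
    case (elim x)
    obtain n :: nat where n: "norm x < real n" using reals_Archimedean2 by blast
    have "- real n < x \<bullet> i \<and> x \<bullet> i < real n" if "i \<in> Basis" for i
      using Basis_le_norm[OF that, of x] n by linarith
    then have "x \<in> box (- real n *\<^sub>R One) (real n *\<^sub>R One)"
      unfolding mem_box by (simp add: inner_sum_left_Basis)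
    with elim[THEN spec, of n] show ?case
      by (simp only: indicator_simps scaleR_one if_True)
  qed
qed

lemma has_weak_derivative_unique:
  assumes "has_weak_derivative is u v" "has_weak_derivative is u w"
  shows "AE x in lborel. v x = w x"
proof -
  have loc: "locally_integrable v" "locally_integrable w"
    using assms by (auto simp: has_weak_derivative_def)
  have "AE x in lborel. v x - w x = 0"
  proof (rule fundamental_lemma)
    show "locally_integrable (\<lambda>x. v x - w x)"
      using loc by (auto simp: locally_integrable_def)
    fix \<phi> :: "'a \<Rightarrow> complex" assume \<phi>: "\<phi> \<in> test_functions"
    have "(LINT x|lborel. (v x - w x) * \<phi> x) = (LINT x|lborel. v x * \<phi> x) - (LINT x|lborel. w x * \<phi> x)"
      using test_mult_integrable[OF loc(1) \<phi>] test_mult_integrable[OF loc(2) \<phi>] by (simp add: algebra_simps)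
    also have "(-1) ^ length is * \<dots> = 0"
      using assms \<phi> by (simp add: has_weak_derivative_def right_diff_distrib)
    finally show "(LINT x|lborel. (v x - w x) * \<phi> x) = 0"
      using assms \<phi> by (simp add: has_weak_derivative_def)
  qed
  then show ?thesis by simp
qed

lemma l2sq_add:
  assumes "f \<in> L2" "g \<in> L2"
  shows "l2sq (\<lambda>x. f x + g x) = l2sq f + l2sq g + 2 * Re (LINT x|lborel. f x * cnj (g x))"
proof -
  have *: "(cmod (f x + g x))\<^sup>2 = (cmod (f x))\<^sup>2 + (cmod (g x))\<^sup>2 + 2 * Re (f x * cnj (g x))" for x
    unfolding cmod_power2 by (simp add: power2_eq_square algebra_simps)
  note int = L2_integrable_mult[OF assms(1) L2_cnj[OF assms(2)]]
  define h where "h x = Re (f x * cnj (g x))" for x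
  have h: "integrable lborel h" unfolding h_def using int by (rule integrable_Re)
  have "l2sq (\<lambda>x. f x + g x) = l2sq f + l2sq g + 2 * (LINT x|lborel. h x)"
    unfolding l2sq_def * h_def[symmetric] using assms h by (simp add: L2_integrable_sq)
  also have "(LINT x|lborel. h x) = Re (LINT x|lborel. f x * cnj (g x))"
    unfolding h_def using int by (rule integral_Re)
  finally show ?thesis .
qed

lemma l2norm_triangle:
  assumes "f \<in> L2" "g \<in> L2"
  shows "sqrt (l2sq (\<lambda>x. f x + g x)) \<le> sqrt (l2sq f) + sqrt (l2sq g)"
proof (rule real_le_lsqrt)
  have "Re (LINT x|lborel. f x * cnj (g x)) \<le> sqrt (l2sq f) * sqrt (l2sq g)"
    using order_trans[OF complex_Re_le_cmod L2_cauchy_schwarz[OF assms(1) L2_cnj[OF assms(2)]]]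
    by (simp add: l2sq_cnj)
  then show "l2sq (\<lambda>x. f x + g x) \<le> (sqrt (l2sq f) + sqrt (l2sq g))\<^sup>2"
    unfolding l2sq_add[OF assms] by (simp add: power2_sum)
qed auto

lemma l2sq_tendsto:
  assumes "\<And>n. f n \<in> L2" "g \<in> L2" and lim: "(\<lambda>n. l2sq (\<lambda>x. f n x - g x)) \<longlonglongrightarrow> 0"
  shows "(\<lambda>n. l2sq (f n)) \<longlonglongrightarrow> l2sq g"
proof -
  have "(\<lambda>n. sqrt (l2sq (f n)) - sqrt (l2sq g)) \<longlonglongrightarrow> 0"
  proof (rule Lim_null_comparison)
    show "(\<lambda>n. sqrt (l2sq (\<lambda>x. f n x - g x))) \<longlonglongrightarrow> 0"
      using tendsto_real_sqrt[OF lim] by simp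
    show "\<forall>\<^sub>F n in sequentially. norm (sqrt (l2sq (f n)) - sqrt (l2sq g)) \<le> sqrt (l2sq (\<lambda>x. f n x - g x))"
    proof (rule always_eventually, rule allI)
      fix n
      have "sqrt (l2sq (f n)) \<le> sqrt (l2sq (\<lambda>x. f n x - g x)) + sqrt (l2sq g)"
        using l2norm_triangle[OF L2_diff[OF assms(1)[of n] assms(2)] assms(2)] by simp
      moreover have "sqrt (l2sq g) \<le> sqrt (l2sq (\<lambda>x. f n x - g x)) + sqrt (l2sq (f n))"
        using l2norm_triangle[OF L2_diff[OF assms(2) assms(1)[of n]] assms(1)[of n]]
        by (simp add: l2sq_minus_commute)
      ultimately show "norm (sqrt (l2sq (f n)) - sqrt (l2sq g)) \<le> sqrt (l2sq (\<lambda>x. f n x - g x))" by simp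
    qed
  qed
  then have "(\<lambda>n. sqrt (l2sq (f n))) \<longlonglongrightarrow> sqrt (l2sq g)" by (simp add: LIM_zero_iff)
  from tendsto_power[OF this, of 2] show ?thesis by simp
qed

lemma LINT_cnj: "(LINT x|M. cnj (f x)) = cnj (LINT x|M. f x)"
  by (rule integral_bounded_linear'[OF bounded_linear_cnj bounded_linear_cnj]) simp

text \<open>
  Near-minimizers of the distance from \<open>f\<close> converge to a remainder \<open>w\<close>. Minimality along every line in the space of
  test functions makes \<open>w\<close> orthogonal to it, and the fundamental lemma, applied to the conjugate of \<open>w\<close>, gives
  \<open>w = 0\<close>.
\<close>

theorem test_functions_dense:
  fixes f :: "'a::euclidean_space \<Rightarrow> complex"
  assumes f: "f \<in> L2"
  obtains \<phi> where "\<And>n. \<phi> n \<in> test_functions" "(\<lambda>n. l2sq (\<lambda>x. f x - \<phi> n x)) \<longlonglongrightarrow> 0"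
proof -
  define S where "S = {(\<lambda>x. f x - \<phi> x) |\<phi>. \<phi> \<in> test_functions}"
  have SL2: "g \<in> L2" if "g \<in> S" for g using that by (auto simp: S_def intro: L2_diff f test_L2)
  obtain g where g: "\<And>n::nat. g n \<in> S"
    "\<And>e. e > 0 \<Longrightarrow> \<exists>M. \<forall>m\<ge>M. \<forall>n\<ge>M. l2sq (\<lambda>x. g m x - g n x) < e"
    "\<And>n h. h \<in> S \<Longrightarrow> l2sq (g n) \<le> l2sq h + inverse (real (Suc n))"
  proof (rule midpoint_closed_near_minimizers_Cauchy[of "\<lambda>_. S" l2sq "l2sq f"])
    show "(\<lambda>x. (a x + b x) / 2) \<in> S" if "a \<in> S" "b \<in> S" for a b
    proof -
      from that obtain \<phi> \<psi> where "\<phi> \<in> test_functions" "\<psi> \<in> test_functions"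
        "a = (\<lambda>x. f x - \<phi> x)" "b = (\<lambda>x. f x - \<psi> x)" by (auto simp: S_def)
      then show ?thesis unfolding S_def
        by (intro CollectI exI[of _ "\<lambda>x. 1/2 * \<phi> x + 1/2 * \<psi> x"] conjI test_lin) (auto simp: field_simps)
    qed
    show "l2sq (\<lambda>x. a x - b x) = 2 * l2sq a + 2 * l2sq b - 4 * l2sq (\<lambda>x. (a x + b x) / 2)"
      if "a \<in> S" "b \<in> S" for a b
      using l2sq_parallelogram[OF SL2[OF that(1)] SL2[OF that(2)]]
        l2sq_cmult[of "1/2" "\<lambda>x. a x + b x"] by (simp add: power2_eq_square)
    show "\<exists>h\<in>S. l2sq h \<le> l2sq f" for n :: nat
    proof (intro bexI[of _ f])
      show "f \<in> S" unfolding S_def by (intro CollectI exI[of _ "\<lambda>_. 0"]) (simp add: test_zero)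
    qed simp
  qed auto
  obtain w where w: "w \<in> L2" "(\<lambda>n. l2sq (\<lambda>x. g n x - w x)) \<longlonglongrightarrow> 0"
    by (rule L2_complete[of g, OF SL2[OF g(1)] g(2)], assumption) (rule that)
  have "AE x in lborel. cnj (w x) = 0"
  proof (rule fundamental_lemma)
    show "locally_integrable (\<lambda>x. cnj (w x))" by (intro L2_locally_integrable L2_cnj w)
    fix \<psi> :: "'a \<Rightarrow> complex" assume \<psi>: "\<psi> \<in> test_functions"
    define I where "I = (LINT x|lborel. w x * cnj (\<psi> x))"
    \<comment> \<open>Near-minimality of \<open>g n\<close> along the line \<open>g n + a \<psi>\<close>, in the limit.\<close>
    have lin: "0 \<le> (cmod a)\<^sup>2 * l2sq \<psi> + 2 * Re (cnj a * I)" for a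
    proof -
      have 1: "0 \<le> (cmod a)\<^sup>2 * l2sq \<psi> + 2 * Re (cnj a * (LINT x|lborel. g n x * cnj (\<psi> x)))
              + inverse (real (Suc n))" for n
      proof -
        obtain \<phi> where \<phi>: "\<phi> \<in> test_functions" "g n = (\<lambda>x. f x - \<phi> x)" using g(1)[of n] by (auto simp: S_def)
        have "(\<lambda>x. g n x + a * \<psi> x) \<in> S" unfolding S_def
          by (intro CollectI exI[of _ "\<lambda>x. 1 * \<phi> x + (-a) * \<psi> x"] conjI test_lin \<phi> \<psi>) (auto simp: \<phi>(2))
        from g(3)[OF this, of n] have "l2sq (g n) \<le> l2sq (\<lambda>x. g n x + a * \<psi> x) + inverse (real (Suc n))" .
        moreover have "(LINT x|lborel. g n x * cnj (a * \<psi> x)) = cnj a * (LINT x|lborel. g n x * cnj (\<psi> x))"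
          by (subst integral_mult_right_zero[symmetric]) (simp add: mult_ac)
        ultimately show ?thesis
          using l2sq_add[OF SL2[OF g(1)[of n]] L2_cmult[OF test_L2[OF \<psi>], of a]] by (simp add: l2sq_cmult)
      qed
      have "(\<lambda>n. (cmod a)\<^sup>2 * l2sq \<psi> + 2 * Re (cnj a * (LINT x|lborel. g n x * cnj (\<psi> x)))
              + inverse (real (Suc n))) \<longlonglongrightarrow> (cmod a)\<^sup>2 * l2sq \<psi> + 2 * Re (cnj a * I) + 0"
        unfolding I_def
        by (intro tendsto_intros LIMSEQ_inverse_real_of_nat L2_pairing_tendsto SL2 g w L2_cnj[OF test_L2[OF \<psi>]])
      then have "0 \<le> (cmod a)\<^sup>2 * l2sq \<psi> + 2 * Re (cnj a * I) + 0"
        by (rule LIMSEQ_le_const) (use 1 in auto)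
      then show ?thesis by simp
    qed
    have "I = 0"
    proof (rule ccontr)
      assume "I \<noteq> 0"
      then have I2: "(cmod I)\<^sup>2 > 0" by simp
      \<comment> \<open>A step short enough for the linear term to dominate the quadratic one.\<close>
      define s where "s = 1 / (1 + l2sq \<psi>)"
      have s: "s > 0" "s * l2sq \<psi> \<le> 1" by (auto simp: s_def add_pos_nonneg field_simps)
      have "0 \<le> s\<^sup>2 * (cmod I)\<^sup>2 * l2sq \<psi> - 2 * s * (cmod I)\<^sup>2"
        using lin[of "- complex_of_real s * I"] s
        by (simp add: norm_mult power_mult_distrib mult.assoc complex_mult_cnj cmod_power2 mult.commute[of _ I])
          (simp add: algebra_simps power2_eq_square)
      also have "\<dots> = s * (cmod I)\<^sup>2 * (s * l2sq \<psi> - 2)" by (simp add: power2_eq_square algebra_simps)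
      also have "\<dots> < 0" using s I2 by (intro mult_pos_neg) auto
      finally show False by simp
    qed
    have "(LINT x|lborel. cnj (w x) * \<psi> x) = (LINT x|lborel. cnj (w x * cnj (\<psi> x)))" by simp
    also have "\<dots> = cnj I" unfolding I_def by (rule LINT_cnj)
    finally show "(LINT x|lborel. cnj (w x) * \<psi> x) = 0" using \<open>I = 0\<close> by simp
  qed
  then have "l2sq w = 0" using l2sq_cong_AE[OF L2_measurable[OF w(1)] _, of "\<lambda>_. 0"]
    by (simp add: l2sq_def)
  then have lim: "(\<lambda>n. l2sq (g n)) \<longlonglongrightarrow> 0"
    using l2sq_tendsto[of g w] SL2 g(1) w by simp
  have "\<forall>n. \<exists>\<phi>. \<phi> \<in> test_functions \<and> g n = (\<lambda>x. f x - \<phi> x)" using g(1) by (auto simp: S_def)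
  then obtain \<phi> where "\<And>n. \<phi> n \<in> test_functions" "\<And>n. g n = (\<lambda>x. f x - \<phi> n x)" by metis
  then show thesis using that[of \<phi>] lim by simp
qed

text \<open>
  Test \<open>f\<close> against approximations of the conjugate of \<open>f\<close>.
\<close>

lemma l2sq_le_dual:
  assumes f: "f \<in> L2" and M: "M \<ge> 0"
    and le: "\<And>\<phi>. \<phi> \<in> test_functions \<Longrightarrow> cmod (LINT x|lborel. f x * \<phi> x) \<le> M * sqrt (l2sq \<phi>)"
  shows "l2sq f \<le> M\<^sup>2"
proof -
  obtain \<phi> where \<phi>: "\<And>n. \<phi> n \<in> test_functions" "(\<lambda>n. l2sq (\<lambda>x. cnj (f x) - \<phi> n x)) \<longlonglongrightarrow> 0"
    using test_functions_dense[OF L2_cnj[OF f]] by metis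
  have lim: "(\<lambda>n. l2sq (\<lambda>x. \<phi> n x - cnj (f x))) \<longlonglongrightarrow> 0" 
    using \<phi>(2) by (simp only: l2sq_minus_commute[of "\<lambda>x. cnj (f x)"])
  have eq: "(LINT x|lborel. cnj (f x) * f x) = complex_of_real (l2sq f)"
    unfolding l2sq_def by (subst integral_complex_of_real[symmetric])
      (simp add: mult.commute complex_norm_square[symmetric] flip: of_real_power)
  have "(\<lambda>n. cmod (LINT x|lborel. \<phi> n x * f x)) \<longlonglongrightarrow> cmod (LINT x|lborel. cnj (f x) * f x)"
    by (intro tendsto_norm L2_pairing_tendsto lim test_L2 \<phi> L2_cnj f)
  moreover have "(\<lambda>n. M * sqrt (l2sq (\<phi> n))) \<longlonglongrightarrow> M * sqrt (l2sq (\<lambda>x. cnj (f x)))"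
    by (intro tendsto_intros l2sq_tendsto lim test_L2 \<phi> L2_cnj f)
  ultimately have "cmod (LINT x|lborel. cnj (f x) * f x) \<le> M * sqrt (l2sq (\<lambda>x. cnj (f x)))"
    by (rule LIMSEQ_le) (use le[OF \<phi>(1)] in \<open>auto simp: mult.commute\<close>)
  then have *: "l2sq f \<le> M * sqrt (l2sq f)" by (simp add: eq l2sq_cnj)
  have "sqrt (l2sq f) \<le> M"
  proof (cases "l2sq f = 0")
    case False
    then have "0 < sqrt (l2sq f)" using l2sq_nonneg[of f] by (simp add: order_less_le)
    moreover have "sqrt (l2sq f) * sqrt (l2sq f) \<le> M * sqrt (l2sq f)" using * by simp
    ultimately show ?thesis by (simp only: mult_le_cancel_right_pos)
  qed (use M in simp)
  then have "(sqrt (l2sq f))\<^sup>2 \<le> M\<^sup>2" by (intro power_mono) auto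
  then show ?thesis by simp
qed

section \<open>Weak directional derivatives and translations\<close>

text \<open>
  In contrast to \<open>has_weak_derivative\<close> the direction is an arbitrary vector, the order is one, and both functions
  are square integrable. Higher derivatives are obtained by iteration.
\<close>

definition weak_deriv :: "'a::euclidean_space \<Rightarrow> ('a \<Rightarrow> complex) \<Rightarrow> ('a \<Rightarrow> complex) \<Rightarrow> bool" where
  "weak_deriv z u v \<longleftrightarrow> u \<in> L2 \<and> v \<in> L2 \<and>
     (\<forall>\<phi>\<in>test_functions. (LINT x|lborel. u x * dir_deriv z \<phi> x) = - (LINT x|lborel. v x * \<phi> x))"

lemma weak_deriv_L2: "weak_deriv z u v \<Longrightarrow> u \<in> L2" "weak_deriv z u v \<Longrightarrow> v \<in> L2"
  by (auto simp: weak_deriv_def)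

lemma weak_deriv_lin:
  assumes "weak_deriv z u v" "weak_deriv z u' v'"
  shows "weak_deriv z (\<lambda>x. a * u x + b * u' x) (\<lambda>x. a * v x + b * v' x)"
  unfolding weak_deriv_def
proof (intro conjI ballI)
  note L = weak_deriv_L2[OF assms(1)] weak_deriv_L2[OF assms(2)]
  show "(\<lambda>x. a * u x + b * u' x) \<in> L2" "(\<lambda>x. a * v x + b * v' x) \<in> L2"
    by (intro L2_add L2_cmult L)+
  fix \<phi> :: "'a \<Rightarrow> complex" assume \<phi>: "\<phi> \<in> test_functions"
  have lin: "(LINT x|lborel. (a * f x + b * g x) * \<psi> x)
      = a * (LINT x|lborel. f x * \<psi> x) + b * (LINT x|lborel. g x * \<psi> x)"
    if "f \<in> L2" "g \<in> L2" "\<psi> \<in> L2" for f g \<psi> :: "'a \<Rightarrow> complex"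
    using L2_integrable_mult[OF that(1,3)] L2_integrable_mult[OF that(2,3)]
    by (simp add: distrib_right mult.assoc)
  show "(LINT x|lborel. (a * u x + b * u' x) * dir_deriv z \<phi> x) = - (LINT x|lborel. (a * v x + b * v' x) * \<phi> x)"
    using assms \<phi> by (simp add: lin L test_L2 test_dir_deriv weak_deriv_def)
qed

lemma weak_deriv_zero: "weak_deriv z (\<lambda>x. 0) (\<lambda>x. 0)" by (simp add: weak_deriv_def L2_zero)

lemma weak_deriv_diff: "weak_deriv z u v \<Longrightarrow> weak_deriv z u' v' \<Longrightarrow> weak_deriv z (\<lambda>x. u x - u' x) (\<lambda>x. v x - v' x)"
  using weak_deriv_lin[of z u v u' v' 1 "-1"] by simp

lemma weak_deriv_add: "weak_deriv z u v \<Longrightarrow> weak_deriv z u' v' \<Longrightarrow> weak_deriv z (\<lambda>x. u x + u' x) (\<lambda>x. v x + v' x)"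
  using weak_deriv_lin[of z u v u' v' 1 1] by simp

lemma weak_deriv_cmult: "weak_deriv z u v \<Longrightarrow> weak_deriv z (\<lambda>x. a * u x) (\<lambda>x. a * v x)"
  using weak_deriv_lin[OF _ weak_deriv_zero, of z u v a 0] by simp

lemma weak_deriv_sum: "(\<And>i. i \<in> A \<Longrightarrow> weak_deriv z (f i) (g i)) \<Longrightarrow> weak_deriv z (\<lambda>x. \<Sum>i\<in>A. f i x) (\<lambda>x. \<Sum>i\<in>A. g i x)"
  by (induction A rule: infinite_finite_induct) (auto simp: weak_deriv_zero weak_deriv_add)

lemma integral_shift_mult:
  fixes u \<phi> :: "'a::euclidean_space \<Rightarrow> complex"
  assumes "u \<in> borel_measurable borel" "\<phi> \<in> borel_measurable borel"
  shows "(LINT x|lborel. u (x + c) * \<phi> x) = (LINT x|lborel. u x * \<phi> (x - c))"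
  using integral_translate[of "\<lambda>x. u x * \<phi> (x - c)" c] assms by simp

lemma weak_deriv_translate:
  assumes "weak_deriv z u v"
  shows "weak_deriv z (\<lambda>x. u (x + c)) (\<lambda>x. v (x + c))"
  unfolding weak_deriv_def
proof (intro conjI ballI)
  note L = weak_deriv_L2[OF assms]
  show "(\<lambda>x. u (x + c)) \<in> L2" "(\<lambda>x. v (x + c)) \<in> L2" by (intro L2_translate L)+
  fix \<phi> :: "'a \<Rightarrow> complex" assume \<phi>: "\<phi> \<in> test_functions"
  have "dir_deriv z (\<lambda>x. \<phi> (x + - c)) = (\<lambda>x. dir_deriv z \<phi> (x + - c))" by (rule dir_deriv_translate[OF \<phi>])
  moreover have "(\<lambda>x. \<phi> (x + - c)) \<in> test_functions" by (rule test_translate[OF \<phi>])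
  ultimately have "(LINT x|lborel. u x * dir_deriv z \<phi> (x + - c)) = - (LINT x|lborel. v x * \<phi> (x + - c))"
    using assms unfolding weak_deriv_def by metis
  then show "(LINT x|lborel. u (x + c) * dir_deriv z \<phi> x) = - (LINT x|lborel. v (x + c) * \<phi> x)"
    using L \<phi> by (simp add: integral_shift_mult L2_measurable test_measurable test_dir_deriv)
qed

lemma weak_deriv_direction:
  assumes "u \<in> L2" "\<And>i. i \<in> Basis \<Longrightarrow> weak_deriv i u (g i)"
  shows "weak_deriv z u (\<lambda>x. \<Sum>i\<in>Basis. complex_of_real (z \<bullet> i) * g i x)"
  unfolding weak_deriv_def
proof (intro conjI ballI)
  have g: "g i \<in> L2" if "i \<in> Basis" for i using weak_deriv_L2 assms(2)[OF that] by blast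
  show "u \<in> L2" by fact
  show "(\<lambda>x. \<Sum>i\<in>Basis. complex_of_real (z \<bullet> i) * g i x) \<in> L2" by (intro L2_sum L2_cmult g)
  fix \<phi> :: "'a \<Rightarrow> complex" assume \<phi>: "\<phi> \<in> test_functions"
  have "(LINT x|lborel. u x * dir_deriv z \<phi> x)
      = (LINT x|lborel. (\<Sum>i\<in>Basis. complex_of_real (z \<bullet> i) * (u x * dir_deriv i \<phi> x)))"
    unfolding dir_deriv_expand[OF \<phi>, of z] by (simp add: dir_deriv_basis sum_distrib_left mult_ac del: partial_derivs.simps)
  also have "\<dots> = (\<Sum>i\<in>Basis. complex_of_real (z \<bullet> i) * (LINT x|lborel. u x * dir_deriv i \<phi> x))"
    using L2_integrable_mult[OF assms(1) test_L2[OF test_dir_deriv[OF \<phi>]]]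
    by (subst Bochner_Integration.integral_sum) auto
  also have "\<dots> = (\<Sum>i\<in>Basis. complex_of_real (z \<bullet> i) * - (LINT x|lborel. g i x * \<phi> x))"
    using assms \<phi> by (intro sum.cong) (auto simp: weak_deriv_def)
  also have "\<dots> = - (LINT x|lborel. (\<Sum>i\<in>Basis. complex_of_real (z \<bullet> i) * (g i x * \<phi> x)))"
    using L2_integrable_mult[OF g test_L2[OF \<phi>]]
    by (subst Bochner_Integration.integral_sum) (auto simp: sum_negf)
  finally show "(LINT x|lborel. u x * dir_deriv z \<phi> x)
      = - (LINT x|lborel. (\<Sum>i\<in>Basis. complex_of_real (z \<bullet> i) * g i x) * \<phi> x)"
    by (simp only: sum_distrib_right mult.assoc)
qed

lemma weak_deriv_scaleR:
  assumes "weak_deriv z u v" shows "weak_deriv (s *\<^sub>R z) u (\<lambda>x. complex_of_real s * v x)"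
  unfolding weak_deriv_def
proof (intro conjI ballI)
  show "u \<in> L2" "(\<lambda>x. complex_of_real s * v x) \<in> L2" using weak_deriv_L2[OF assms] by (auto intro: L2_cmult)
  fix \<phi> :: "'a \<Rightarrow> complex" assume \<phi>: "\<phi> \<in> test_functions"
  have "dir_deriv (s *\<^sub>R z) \<phi> x = complex_of_real s * dir_deriv z \<phi> x" for x
    unfolding dir_deriv_expand[OF \<phi>] by (simp add: sum_distrib_left mult_ac)
  then have "(LINT x|lborel. u x * dir_deriv (s *\<^sub>R z) \<phi> x) = complex_of_real s * (LINT x|lborel. u x * dir_deriv z \<phi> x)"
    by (simp add: mult.left_commute)
  also have "\<dots> = - (complex_of_real s * (LINT x|lborel. v x * \<phi> x))" using assms \<phi> by (simp add: weak_deriv_def)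
  finally show "(LINT x|lborel. u x * dir_deriv (s *\<^sub>R z) \<phi> x) = - (LINT x|lborel. complex_of_real s * v x * \<phi> x)"
    by (simp add: mult.assoc)
qed

lemma L2_cdiv: "f \<in> L2 \<Longrightarrow> (\<lambda>x. f x / a) \<in> L2"
  using L2_cmult[of f "1 / a"] by simp

lemma difference_adjoint:
  assumes u: "u \<in> L2" and w: "w \<in> L2"
  shows "(LINT x|lborel. (u (x + z) - u x) / a * w x) = (LINT x|lborel. (w (x - z) - w x) / a * u x)"
proof -
  have int: "integrable lborel (\<lambda>x. u (x + z) * w x)" "integrable lborel (\<lambda>x. u x * w x)"
     "integrable lborel (\<lambda>x. u x * w (x - z))"
    using L2_integrable_mult[OF L2_translate[OF u] w] L2_integrable_mult[OF u w]
     L2_integrable_mult[OF u L2_translate[OF w, of "- z"]] by auto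
  have "(LINT x|lborel. (u (x + z) - u x) / a * w x) = (LINT x|lborel. (u (x + z) * w x - u x * w x) / a)"
    by (simp add: algebra_simps)
  also have "\<dots> = ((LINT x|lborel. u (x + z) * w x) - (LINT x|lborel. u x * w x)) / a"
    using int by simp
  also have "(LINT x|lborel. u (x + z) * w x) = (LINT x|lborel. u x * w (x - z))"
    by (intro integral_shift_mult L2_measurable u w)
  also have "((LINT x|lborel. u x * w (x - z)) - (LINT x|lborel. u x * w x)) / a
      = (LINT x|lborel. (u x * w (x - z) - u x * w x) / a)"
    using int by simp
  also have "\<dots> = (LINT x|lborel. (w (x - z) - w x) / a * u x)"
    by (simp add: algebra_simps)
  finally show ?thesis .
qed

text \<open>
  The difference quotient is moved to the smooth factor, where it converges strongly.
\<close>

lemma weak_deriv_difference_quotient_test: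
  assumes weak_deriv: "weak_deriv z u v" and \<phi>: "\<phi> \<in> test_functions" and s: "s \<longlonglongrightarrow> 0" "\<And>n. s n \<noteq> (0::real)"
  shows "(\<lambda>n. LINT x|lborel. (u (x + s n *\<^sub>R z) - u x) / complex_of_real (s n) * \<phi> x)
           \<longlonglongrightarrow> (LINT x|lborel. v x * \<phi> x)"
proof -
  note L = weak_deriv_L2[OF weak_deriv]
  define q where "q n x = (\<phi> (x + (- s n) *\<^sub>R z) - \<phi> x) / complex_of_real (- s n)" for n x
  have q: "q n \<in> L2" for n unfolding q_def by (intro L2_cdiv L2_diff L2_translate test_L2 \<phi>)
  have ms: "(\<lambda>n. - s n) \<longlonglongrightarrow> 0" using tendsto_minus[OF s(1)] by simp
  have "(\<lambda>n. l2sq (\<lambda>x. q n x - dir_deriv z \<phi> x)) \<longlonglongrightarrow> 0"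
    unfolding q_def by (rule test_difference_quotient_L2[OF \<phi> ms]) (use s in auto)
  then have "(\<lambda>n. LINT x|lborel. q n x * u x) \<longlonglongrightarrow> (LINT x|lborel. dir_deriv z \<phi> x * u x)"
    by (intro L2_pairing_tendsto q test_L2 test_dir_deriv \<phi> L)
  then have "(\<lambda>n. - (LINT x|lborel. q n x * u x)) \<longlonglongrightarrow> - (LINT x|lborel. dir_deriv z \<phi> x * u x)"
    by (rule tendsto_minus)
  moreover have "- (LINT x|lborel. dir_deriv z \<phi> x * u x) = (LINT x|lborel. v x * \<phi> x)"
    using weak_deriv \<phi> by (simp add: weak_deriv_def mult.commute)
  moreover have "- (LINT x|lborel. q n x * u x)
      = (LINT x|lborel. (u (x + s n *\<^sub>R z) - u x) / complex_of_real (s n) * \<phi> x)" for n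
  proof -
    have "- (LINT x|lborel. q n x * u x)
        = (LINT x|lborel. (\<phi> (x - s n *\<^sub>R z) - \<phi> x) / complex_of_real (s n) * u x)"
      unfolding q_def by (subst Bochner_Integration.integral_minus[symmetric]) simp
    also have "\<dots> = (LINT x|lborel. (u (x + s n *\<^sub>R z) - u x) / complex_of_real (s n) * \<phi> x)"
      by (rule difference_adjoint[symmetric, OF L(1) test_L2[OF \<phi>]])
    finally show ?thesis .
  qed
  ultimately show ?thesis by simp
qed

lemma has_vector_derivative_of_quotient:
  fixes F :: "real \<Rightarrow> complex"
  assumes "((\<lambda>s. (F (t + s) - F t) / complex_of_real s) \<longlongrightarrow> D) (at 0)"
  shows "(F has_vector_derivative D) (at t)"
proof -
  have "((\<lambda>s. norm ((F (t + s) - F t) / complex_of_real s - D)) \<longlongrightarrow> 0) (at 0)"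
    by (intro tendsto_norm_zero LIM_zero assms)
  moreover have "\<forall>\<^sub>F s in at 0. norm ((F (t + s) - F t) / complex_of_real s - D)
      = norm (F (t + s) - F t - s *\<^sub>R D) / norm s"
    using eventually_neq_at_within[of "0 :: real" 0 UNIV]
  proof eventually_elim
    case (elim s)
    then have "(F (t + s) - F t) / complex_of_real s - D = (F (t + s) - F t - s *\<^sub>R D) / complex_of_real s"
      by (simp add: scaleR_conv_of_real diff_divide_distrib)
    then show ?case by (simp add: norm_divide)
  qed
  ultimately have "((\<lambda>s. norm (F (t + s) - F t - s *\<^sub>R D) / norm s) \<longlongrightarrow> 0) (at 0)"
    by (rule Lim_transform_eventually)
  then show ?thesis
    unfolding has_vector_derivative_def has_derivative_at
    by (intro conjI bounded_linear_scaleR_left)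
qed

text \<open>
  Tested against \<open>\<phi>\<close>, the translate of \<open>u\<close> by \<open>t z\<close> is differentiable in \<open>t\<close>, and its derivative is the pairing of
  \<open>\<phi>\<close> with a translate of \<open>v\<close>, which is at most the product of the norms. The mean value inequality on \<open>[0,1]\<close> and
  duality give the claim.
\<close>

theorem translation_estimate:
  assumes weak_deriv: "weak_deriv z u v"
  shows "l2sq (\<lambda>x. u (x + z) - u x) \<le> l2sq v"
proof -
  note L = weak_deriv_L2[OF weak_deriv]
  have "l2sq (\<lambda>x. u (x + z) - u x) \<le> (sqrt (l2sq v))\<^sup>2"
  proof (rule l2sq_le_dual)
    show "(\<lambda>x. u (x + z) - u x) \<in> L2" by (intro L2_diff L2_translate L)
    fix \<phi> :: "'a \<Rightarrow> complex" assume \<phi>: "\<phi> \<in> test_functions"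
    note L\<phi> = test_L2[OF \<phi>]
    define F where "F t = (LINT x|lborel. u (x + t *\<^sub>R z) * \<phi> x)" for t
    define F' where "F' t = (LINT x|lborel. v (x + t *\<^sub>R z) * \<phi> x)" for t
    have int: "integrable lborel (\<lambda>x. u (x + t *\<^sub>R z) * \<phi> x)" for t
      by (intro L2_integrable_mult L2_translate L L\<phi>)
    have "((\<lambda>s. (F (t + s) - F t) / complex_of_real s) \<longlongrightarrow> F' t) (at 0)" for t
      unfolding tendsto_at_iff_sequentially
    proof (intro allI impI)
      fix s :: "nat \<Rightarrow> real" assume s: "\<forall>i. s i \<in> UNIV - {0}" "s \<longlonglongrightarrow> 0"
      have "(F (t + s n) - F t) / complex_of_real (s n)
         = (LINT x|lborel. (u (x + s n *\<^sub>R z + t *\<^sub>R z) - u (x + t *\<^sub>R z)) / complex_of_real (s n) * \<phi> x)" for n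
      proof -
        have "(F (t + s n) - F t) / complex_of_real (s n)
         = (LINT x|lborel. (u (x + (t + s n) *\<^sub>R z) * \<phi> x - u (x + t *\<^sub>R z) * \<phi> x) / complex_of_real (s n))"
          unfolding F_def using int[of "t + s n"] int[of t] by simp
        also have "\<dots> = (LINT x|lborel. (u (x + s n *\<^sub>R z + t *\<^sub>R z) - u (x + t *\<^sub>R z)) / complex_of_real (s n) * \<phi> x)"
          by (simp add: algebra_simps)
        finally show ?thesis .
      qed
      then show "((\<lambda>s. (F (t + s) - F t) / complex_of_real s) \<circ> s) \<longlonglongrightarrow> F' t"
        using weak_deriv_difference_quotient_test[OF weak_deriv_translate[OF weak_deriv, of "t *\<^sub>R z"] \<phi> s(2)] s(1)
        by (simp add: F'_def o_def)
    qed
    then have deriv: "(F has_vector_derivative F' t) (at t)" for t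
      by (rule has_vector_derivative_of_quotient)
    have "cmod (F' t) \<le> sqrt (l2sq v) * sqrt (l2sq \<phi>)" for t
      unfolding F'_def using L2_cauchy_schwarz[OF L2_translate[OF L(2)] L\<phi>, of "t *\<^sub>R z"] 
      by (simp add: l2sq_translate L)
    then have bound: "onorm (\<lambda>h. h *\<^sub>R F' t) \<le> sqrt (l2sq v) * sqrt (l2sq \<phi>)" for t
      by (intro onorm_le) (simp add: mult.commute mult_left_mono)
    have "cmod (F 1 - F 0) \<le> sqrt (l2sq v) * sqrt (l2sq \<phi>) * norm (1 - 0 :: real)"
      using deriv bound unfolding has_vector_derivative_def
      by (intro differentiable_bound[of UNIV F "\<lambda>t h. h *\<^sub>R F' t"]) auto
    moreover have "F 1 - F 0 = (LINT x|lborel. (u (x + z) - u x) * \<phi> x)"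
      unfolding F_def using int[of 1] int[of 0] by (simp add: left_diff_distrib)
    ultimately show "cmod (LINT x|lborel. (u (x + z) - u x) * \<phi> x) \<le> sqrt (l2sq v) * sqrt (l2sq \<phi>)"
      by simp
  qed simp
  then show ?thesis by simp
qed

text \<open>
  Weak convergence of difference quotients: they are bounded by \<open>translation_estimate\<close> and converge against the dense
  set of test functions.
\<close>

lemma weak_deriv_difference_quotient:
  assumes weak_deriv: "weak_deriv z u v" and g: "g \<in> L2" and s: "s \<longlonglongrightarrow> 0" "\<And>n. s n \<noteq> (0::real)"
  shows "(\<lambda>n. LINT x|lborel. (u (x + s n *\<^sub>R z) - u x) / complex_of_real (s n) * g x)
           \<longlonglongrightarrow> (LINT x|lborel. v x * g x)"
proof (rule LIMSEQ_I)
  note L = weak_deriv_L2[OF weak_deriv]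
  define q where "q n x = (u (x + s n *\<^sub>R z) - u x) / complex_of_real (s n)" for n x
  have qL2: "q n \<in> L2" for n unfolding q_def by (intro L2_cdiv L2_diff L2_translate L)
  have q_le: "l2sq (q n) \<le> l2sq v" for n
  proof -
    have "l2sq (q n) = (cmod (1 / complex_of_real (s n)))\<^sup>2 * l2sq (\<lambda>x. u (x + s n *\<^sub>R z) - u x)"
      unfolding q_def using l2sq_cmult[of "1 / complex_of_real (s n)" "\<lambda>x. u (x + s n *\<^sub>R z) - u x"] by simp
    also have "\<dots> \<le> (cmod (1 / complex_of_real (s n)))\<^sup>2 * l2sq (\<lambda>x. complex_of_real (s n) * v x)"
      by (intro mult_left_mono translation_estimate weak_deriv_scaleR weak_deriv) auto
    also have "\<dots> = l2sq v" using s(2)[of n] by (simp add: l2sq_cmult norm_divide power_divide)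
    finally show ?thesis .
  qed
  fix e :: real assume e: "e > 0"
  obtain \<phi> where \<phi>: "\<And>n. \<phi> n \<in> test_functions" "(\<lambda>n. l2sq (\<lambda>x. g x - \<phi> n x)) \<longlonglongrightarrow> 0"
    using test_functions_dense[OF g] by metis
  have "(\<lambda>n. sqrt (l2sq v) * sqrt (l2sq (\<lambda>x. g x - \<phi> n x))) \<longlonglongrightarrow> sqrt (l2sq v) * sqrt 0"
    by (intro tendsto_intros \<phi>)
  then have "\<forall>\<^sub>F n in sequentially. sqrt (l2sq v) * sqrt (l2sq (\<lambda>x. g x - \<phi> n x)) < e / 3"
    by (rule order_tendstoD(2)) (use e in simp)
  then obtain k where k: "sqrt (l2sq v) * sqrt (l2sq (\<lambda>x. g x - \<phi> k x)) < e / 3"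
    using eventually_happens'[OF sequentially_bot] by blast
  define \<psi> where "\<psi> = \<phi> k"
  have \<psi>: "\<psi> \<in> test_functions" "\<psi> \<in> L2" by (auto simp: \<psi>_def \<phi> test_L2)
  have small: "cmod (LINT x|lborel. h x * (g x - \<psi> x)) < e / 3" if "h \<in> L2" "l2sq h \<le> l2sq v" for h
  proof -
    have "cmod (LINT x|lborel. h x * (g x - \<psi> x)) \<le> sqrt (l2sq h) * sqrt (l2sq (\<lambda>x. g x - \<psi> x))"
      by (rule L2_cauchy_schwarz[OF that(1) L2_diff[OF g \<psi>(2)]])
    also have "\<dots> \<le> sqrt (l2sq v) * sqrt (l2sq (\<lambda>x. g x - \<psi> x))"
      using that by (intro mult_right_mono) auto
    finally show ?thesis using k by (simp add: \<psi>_def)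
  qed
  have "\<exists>N. \<forall>n\<ge>N. norm ((LINT x|lborel. q n x * \<psi> x) - (LINT x|lborel. v x * \<psi> x)) < e / 3"
    unfolding q_def using weak_deriv_difference_quotient_test[OF weak_deriv \<psi>(1) s] e by (intro LIMSEQ_D) auto
  then obtain N where N: "\<And>n. n \<ge> N \<Longrightarrow> norm ((LINT x|lborel. q n x * \<psi> x) - (LINT x|lborel. v x * \<psi> x)) < e / 3"
    by blast
  have split: "(LINT x|lborel. h x * g x) = (LINT x|lborel. h x * (g x - \<psi> x)) + (LINT x|lborel. h x * \<psi> x)"
    if "h \<in> L2" for h
    using L2_integrable_mult[OF that g] L2_integrable_mult[OF that \<psi>(2)] by (simp add: right_diff_distrib)
  have "norm ((LINT x|lborel. q n x * g x) - (LINT x|lborel. v x * g x)) < e" if "n \<ge> N" for n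
    unfolding split[OF qL2] split[OF L(2)]
    using small[OF qL2[of n] q_le] small[OF L(2)] N[OF that]
      norm_triangle_ineq4[of "LINT x|lborel. q n x * (g x - \<psi> x)" "LINT x|lborel. v x * (g x - \<psi> x)"]
      norm_triangle_ineq[of "(LINT x|lborel. q n x * (g x - \<psi> x)) - (LINT x|lborel. v x * (g x - \<psi> x))"
         "(LINT x|lborel. q n x * \<psi> x) - (LINT x|lborel. v x * \<psi> x)"]
    by (simp add: algebra_simps)
  then show "\<exists>N. \<forall>n\<ge>N. norm ((LINT x|lborel. (u (x + s n *\<^sub>R z) - u x) / complex_of_real (s n) * g x)
      - (LINT x|lborel. v x * g x)) < e"
    unfolding q_def by blast
qed

lemma weak_deriv_test:
  assumes \<phi>: "\<phi> \<in> test_functions"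
  shows "weak_deriv z \<phi> (dir_deriv z \<phi>)"
  unfolding weak_deriv_def
proof (intro conjI ballI)
  show "\<phi> \<in> L2" "dir_deriv z \<phi> \<in> L2" by (intro test_L2 test_dir_deriv \<phi>)+
  fix \<psi> :: "'a \<Rightarrow> complex" assume \<psi>: "\<psi> \<in> test_functions"
  define s where "s n = inverse (real (Suc n))" for n
  have s: "s \<longlonglongrightarrow> 0" "\<And>n. s n \<noteq> 0" unfolding s_def using LIMSEQ_inverse_real_of_nat by auto
  have ms: "(\<lambda>n. - s n) \<longlonglongrightarrow> 0" "\<And>n. - s n \<noteq> 0" using tendsto_minus[OF s(1)] s(2) by auto
  define q where "q n x = (\<phi> (x + s n *\<^sub>R z) - \<phi> x) / complex_of_real (s n)" for n x
  define k where "k n x = (\<psi> (x + (- s n) *\<^sub>R z) - \<psi> x) / complex_of_real (- s n)" for n x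
  have L: "q n \<in> L2" "k n \<in> L2" for n
    unfolding q_def k_def by (intro L2_cdiv L2_diff L2_translate test_L2 \<phi> \<psi>)+
  have 1: "(\<lambda>n. LINT x|lborel. q n x * \<psi> x) \<longlonglongrightarrow> (LINT x|lborel. dir_deriv z \<phi> x * \<psi> x)"
    using test_difference_quotient_L2[OF \<phi> s] 
    by (intro L2_pairing_tendsto L test_L2 test_dir_deriv \<phi> \<psi>) (simp add: q_def)
  have 2: "(\<lambda>n. - (LINT x|lborel. k n x * \<phi> x)) \<longlonglongrightarrow> - (LINT x|lborel. dir_deriv z \<psi> x * \<phi> x)"
    using test_difference_quotient_L2[OF \<psi> ms]
    by (intro tendsto_minus L2_pairing_tendsto L test_L2 test_dir_deriv \<phi> \<psi>) (simp add: k_def)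
  have "- (LINT x|lborel. k n x * \<phi> x) = (LINT x|lborel. q n x * \<psi> x)" for n
  proof -
    have "- (LINT x|lborel. k n x * \<phi> x)
        = (LINT x|lborel. (\<psi> (x - s n *\<^sub>R z) - \<psi> x) / complex_of_real (s n) * \<phi> x)"
      unfolding k_def by (subst Bochner_Integration.integral_minus[symmetric]) simp
    also have "\<dots> = (LINT x|lborel. q n x * \<psi> x)"
      unfolding q_def by (rule difference_adjoint[symmetric, OF test_L2[OF \<phi>] test_L2[OF \<psi>]])
    finally show ?thesis .
  qed
  with 2 have "(\<lambda>n. LINT x|lborel. q n x * \<psi> x) \<longlonglongrightarrow> - (LINT x|lborel. dir_deriv z \<psi> x * \<phi> x)"
    by (simp only:)
  from LIMSEQ_unique[OF 1 this]
  show "(LINT x|lborel. \<phi> x * dir_deriv z \<psi> x) = - (LINT x|lborel. dir_deriv z \<phi> x * \<psi> x)"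
    by (simp add: mult.commute)
qed

text \<open>
  Neither factor is smooth. A difference quotient can be moved from one factor to the other exactly, and both sides
  converge weakly.
\<close>

theorem integration_by_parts:
  assumes u: "weak_deriv z u u'" and w: "weak_deriv z w w'"
  shows "(LINT x|lborel. u' x * cnj (w x)) = - (LINT x|lborel. u x * cnj (w' x))"
proof -
  note L = weak_deriv_L2[OF u] weak_deriv_L2[OF w]
  define s where "s n = inverse (real (Suc n))" for n
  have s: "s \<longlonglongrightarrow> 0" "\<And>n. s n \<noteq> 0" unfolding s_def using LIMSEQ_inverse_real_of_nat by auto
  have ms: "(\<lambda>n. - s n) \<longlonglongrightarrow> 0" "\<And>n. - s n \<noteq> 0" using tendsto_minus[OF s(1)] s(2) by auto
  have 1: "(\<lambda>n. LINT x|lborel. (u (x + s n *\<^sub>R z) - u x) / complex_of_real (s n) * cnj (w x))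
           \<longlonglongrightarrow> (LINT x|lborel. u' x * cnj (w x))"
    by (intro weak_deriv_difference_quotient u L2_cnj L s)
  have "(\<lambda>n. LINT x|lborel. (w (x + (- s n) *\<^sub>R z) - w x) / complex_of_real (- s n) * cnj (u x))
           \<longlonglongrightarrow> (LINT x|lborel. w' x * cnj (u x))"
    by (rule weak_deriv_difference_quotient[OF w L2_cnj[OF L(1)] ms])
  then have "(\<lambda>n. - cnj (LINT x|lborel. (w (x + (- s n) *\<^sub>R z) - w x) / complex_of_real (- s n) * cnj (u x)))
           \<longlonglongrightarrow> - cnj (LINT x|lborel. w' x * cnj (u x))"
    by (intro tendsto_intros)
  moreover have "- cnj (LINT x|lborel. (w (x + (- s n) *\<^sub>R z) - w x) / complex_of_real (- s n) * cnj (u x))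
     = (LINT x|lborel. (u (x + s n *\<^sub>R z) - u x) / complex_of_real (s n) * cnj (w x))" for n
  proof -
    have "- cnj (LINT x|lborel. (w (x + (- s n) *\<^sub>R z) - w x) / complex_of_real (- s n) * cnj (u x))
       = (LINT x|lborel. (cnj (w (x - s n *\<^sub>R z)) - cnj (w x)) / complex_of_real (s n) * u x)"
      by (subst LINT_cnj[symmetric], subst Bochner_Integration.integral_minus[symmetric]) simp
    also have "\<dots> = (LINT x|lborel. (u (x + s n *\<^sub>R z) - u x) / complex_of_real (s n) * cnj (w x))"
      by (rule difference_adjoint[symmetric, OF L(1) L2_cnj[OF L(3)]])
    finally show ?thesis .
  qed
  ultimately have 2: "(\<lambda>n. LINT x|lborel. (u (x + s n *\<^sub>R z) - u x) / complex_of_real (s n) * cnj (w x))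
      \<longlonglongrightarrow> - cnj (LINT x|lborel. w' x * cnj (u x))" by (simp only:)
  have "(LINT x|lborel. u' x * cnj (w x)) = - cnj (LINT x|lborel. w' x * cnj (u x))"
    by (rule LIMSEQ_unique[OF 1 2])
  also have "cnj (LINT x|lborel. w' x * cnj (u x)) = (LINT x|lborel. u x * cnj (w' x))"
    by (subst LINT_cnj[symmetric]) (simp add: mult.commute)
  finally show ?thesis .
qed

section \<open>The Hessian and the Laplacian\<close>

text \<open>
  A choice of representatives for the first and second weak derivatives. It makes the derivatives of sums, multiples
  and translates explicit, which the Hilbert choice in \<open>weak_derivative\<close> does not.
\<close>

definition sobolev_data ::
    "('a::euclidean_space \<Rightarrow> complex) \<Rightarrow> ('a \<Rightarrow> 'a \<Rightarrow> complex) \<Rightarrow> ('a \<Rightarrow> 'a \<Rightarrow> 'a \<Rightarrow> complex) \<Rightarrow> bool" where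
  "sobolev_data u g h \<longleftrightarrow> u \<in> L2 \<and> (\<forall>i\<in>Basis. weak_deriv i u (g i)) \<and> (\<forall>i\<in>Basis. \<forall>j\<in>Basis. weak_deriv j (g i) (h i j))"

definition laplacian :: "('a::euclidean_space \<Rightarrow> 'a \<Rightarrow> 'a \<Rightarrow> complex) \<Rightarrow> 'a \<Rightarrow> complex" where
  "laplacian h x = (\<Sum>i\<in>Basis. h i i x)"

lemma sobolev_dataD:
  assumes "sobolev_data u g h"
  shows "u \<in> L2" "i \<in> Basis \<Longrightarrow> weak_deriv i u (g i)" "i \<in> Basis \<Longrightarrow> g i \<in> L2"
    "i \<in> Basis \<Longrightarrow> j \<in> Basis \<Longrightarrow> weak_deriv j (g i) (h i j)"
    "i \<in> Basis \<Longrightarrow> j \<in> Basis \<Longrightarrow> h i j \<in> L2"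
    "laplacian h \<in> L2"
proof -
  show *: "u \<in> L2" "i \<in> Basis \<Longrightarrow> weak_deriv i u (g i)" "i \<in> Basis \<Longrightarrow> j \<in> Basis \<Longrightarrow> weak_deriv j (g i) (h i j)" for i j
    using assms by (auto simp: sobolev_data_def)
  show "i \<in> Basis \<Longrightarrow> g i \<in> L2" using *(2)[of i] weak_deriv_L2 by blast
  show **: "i \<in> Basis \<Longrightarrow> j \<in> Basis \<Longrightarrow> h i j \<in> L2" for i j using *(3) weak_deriv_L2 by blast
  show "laplacian h \<in> L2" unfolding laplacian_def[abs_def] by (intro L2_sum **)
qed

lemma weak_deriv_iff_has_weak_derivative:
  assumes "u \<in> L2" "v \<in> L2"
  shows "weak_deriv i u v \<longleftrightarrow> has_weak_derivative [i] u v"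
  unfolding weak_deriv_def has_weak_derivative_def dir_deriv_basis
  using assms L2_locally_integrable[OF assms(1)] L2_locally_integrable[OF assms(2)]
  by (simp del: partial_derivs.simps)

lemma derivative_indices_cases:
  assumes "is \<in> derivative_indices 2"
  obtains "is = []" | i where "is = [i]" "i \<in> Basis" | i j where "is = [i, j]" "i \<in> Basis" "j \<in> Basis"
proof -
  have *: "set is \<subseteq> Basis" "length is \<le> 2" using assms by (auto simp: derivative_indices_def)
  consider "length is = 0" | "length is = 1" | "length is = 2" using *(2) by linarith
  then show thesis
  proof cases
    case 2
    then obtain i where "is = [i]" by (auto simp: length_Suc_conv)
    then show thesis using that(2) * by auto
  next
    case 3
    then obtain i j where "is = [i, j]" by (auto simp: numeral_2_eq_2 length_Suc_conv)
    then show thesis using that(3) * by auto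
  qed (use that in auto)
qed

lemma sobolev_data_has_weak_derivative:
  assumes "sobolev_data u g h"
  shows "has_weak_derivative [] u u"
    and "i \<in> Basis \<Longrightarrow> has_weak_derivative [i] u (g i)"
    and "i \<in> Basis \<Longrightarrow> j \<in> Basis \<Longrightarrow> has_weak_derivative [i, j] u (h i j)"
proof -
  note D = sobolev_dataD[OF assms]
  show "has_weak_derivative [] u u"
    using L2_locally_integrable[OF D(1)] by (simp add: has_weak_derivative_def)
  show "i \<in> Basis \<Longrightarrow> has_weak_derivative [i] u (g i)"
    using weak_deriv_iff_has_weak_derivative D(1-3) by blast
  assume ij: "i \<in> Basis" "j \<in> Basis"
  have "(LINT x|lborel. u x * partial_derivs [i, j] \<phi> x) = (LINT x|lborel. h i j x * \<phi> x)"
    if \<phi>: "\<phi> \<in> test_functions" for \<phi>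
  proof -
    have "(LINT x|lborel. u x * partial_derivs [i, j] \<phi> x) = (LINT x|lborel. u x * dir_deriv i (dir_deriv j \<phi>) x)"
      by (simp add: dir_deriv_def[abs_def])
    also have "\<dots> = - (LINT x|lborel. g i x * dir_deriv j \<phi> x)"
      using D(2)[OF ij(1)] test_dir_deriv[OF \<phi>] by (simp add: weak_deriv_def)
    also have "\<dots> = (LINT x|lborel. h i j x * \<phi> x)"
      using D(4)[OF ij] \<phi> by (simp add: weak_deriv_def)
    finally show ?thesis .
  qed
  then show "has_weak_derivative [i, j] u (h i j)"
    unfolding has_weak_derivative_def
    using L2_locally_integrable[OF D(1)] L2_locally_integrable[OF D(5)[OF ij]] by (simp del: partial_derivs.simps)
qed

lemma H2_iff_sobolev_data: "u \<in> H2 \<longleftrightarrow> (\<exists>g h. sobolev_data u g h)"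
proof
  assume u: "u \<in> H2"
  then have uL: "u \<in> L2" by (simp add: H2_def)
  have ex: "\<exists>v\<in>L2. has_weak_derivative is u v" if "set is \<subseteq> Basis" "length is \<le> 2" for "is"
    using u that by (simp add: H2_def derivative_indices_def)
  have "\<forall>i\<in>Basis. \<exists>v. v \<in> L2 \<and> has_weak_derivative [i] u v"
    using ex[of "[i]" for i] by (simp add: Bex_def)
  then obtain g where g: "\<And>i. i \<in> Basis \<Longrightarrow> g i \<in> L2 \<and> has_weak_derivative [i] u (g i)" by metis
  have "\<forall>i\<in>Basis. \<forall>j\<in>Basis. \<exists>v. v \<in> L2 \<and> has_weak_derivative [i, j] u v"
    using ex[of "[i, j]" for i j] by (simp add: Bex_def)
  then obtain h where h: "\<And>i j. i \<in> Basis \<Longrightarrow> j \<in> Basis \<Longrightarrow> h i j \<in> L2 \<and> has_weak_derivative [i, j] u (h i j)"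
    by metis
  have "weak_deriv j (g i) (h i j)" if ij: "i \<in> Basis" "j \<in> Basis" for i j
    unfolding weak_deriv_def
  proof (intro conjI ballI)
    fix \<phi> :: "'a \<Rightarrow> complex" assume \<phi>: "\<phi> \<in> test_functions"
    have "(LINT x|lborel. u x * partial_derivs [i] (dir_deriv j \<phi>) x) = - (LINT x|lborel. g i x * dir_deriv j \<phi> x)"
      using g[OF ij(1)] test_dir_deriv[OF \<phi>, of j] by (simp add: has_weak_derivative_def del: partial_derivs.simps)
    moreover have "partial_derivs [i] (dir_deriv j \<phi>) = partial_derivs [i, j] \<phi>" by (simp add: dir_deriv_def[abs_def])
    moreover have "(LINT x|lborel. u x * partial_derivs [i, j] \<phi> x) = (LINT x|lborel. h i j x * \<phi> x)"
      using h[OF ij] \<phi> by (simp add: has_weak_derivative_def del: partial_derivs.simps)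
    ultimately show "(LINT x|lborel. g i x * dir_deriv j \<phi> x) = - (LINT x|lborel. h i j x * \<phi> x)"
      by (simp only: minus_minus)
  qed (use g h ij in auto)
  then show "\<exists>g h. sobolev_data u g h"
    unfolding sobolev_data_def using uL g weak_deriv_iff_has_weak_derivative[OF uL] by blast
next
  assume "\<exists>g h. sobolev_data u g h"
  then obtain g h where D: "sobolev_data u g h" by blast
  show "u \<in> H2"
    unfolding H2_def
  proof (intro CollectI conjI ballI)
    show "u \<in> L2" by (rule sobolev_dataD[OF D])
    fix "is" :: "'a list" assume "is \<in> derivative_indices 2"
    then show "\<exists>v\<in>L2. has_weak_derivative is u v"
      by (cases rule: derivative_indices_cases)
        (use sobolev_dataD[OF D] sobolev_data_has_weak_derivative[OF D] in blast)+
  qed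
qed

lemma weak_derivative_AE:
  assumes "has_weak_derivative is u v"
  shows "AE x in lborel. weak_derivative is u x = v x" "weak_derivative is u \<in> borel_measurable borel"
proof -
  have *: "has_weak_derivative is u (weak_derivative is u)"
    unfolding weak_derivative_def by (rule someI[where P="has_weak_derivative is u", OF assms])
  show "AE x in lborel. weak_derivative is u x = v x"
    by (rule has_weak_derivative_unique[OF * assms])
  show "weak_derivative is u \<in> borel_measurable borel"
    using * by (intro locally_integrable_measurable) (simp add: has_weak_derivative_def)
qed

lemma weak_derivative_l2sq:
  assumes "has_weak_derivative is u v" "v \<in> L2"
  shows "(LINT x|lborel. (cmod (weak_derivative is u x))\<^sup>2) = l2sq v" "weak_derivative is u \<in> L2"
proof -
  note W = weak_derivative_AE[OF assms(1)]
  show "(LINT x|lborel. (cmod (weak_derivative is u x))\<^sup>2) = l2sq v"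
    unfolding l2sq_def[symmetric] by (rule l2sq_cong_AE[OF W(2) L2_measurable[OF assms(2)] W(1)])
  show "weak_derivative is u \<in> L2"
    by (rule L2_cong_AE[OF assms(2) W(2)]) (use W(1) in \<open>auto elim: eventually_mono\<close>)
qed

lemma T_fun_data:
  assumes "sobolev_data u g h"
  shows "T_fun c u = l2sq (laplacian h) - 2 * (\<Sum>i\<in>Basis. l2sq (g i)) + (1 + c) * l2sq u"
proof -
  note D = sobolev_dataD[OF assms] and W = sobolev_data_has_weak_derivative[OF assms]
  have "AE x in lborel. \<forall>i\<in>Basis. weak_derivative [i, i] u x = h i i x"
    using weak_derivative_AE(1)[OF W(3)] by (subst AE_finite_all) auto
  then have "AE x in lborel. weak_laplacian u x = laplacian h x"
    by eventually_elim (simp add: weak_laplacian_def laplacian_def)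
  moreover have "weak_laplacian u \<in> borel_measurable borel"
    unfolding weak_laplacian_def[abs_def] using weak_derivative_AE(2)[OF W(3)] by (intro borel_measurable_sum) auto
  ultimately have 1: "(LINT x|lborel. (cmod (weak_laplacian u x))\<^sup>2) = l2sq (laplacian h)"
    unfolding l2sq_def[symmetric] using L2_measurable[OF D(6)] by (intro l2sq_cong_AE)
  have 2: "(LINT x|lborel. weak_gradient_sq u x) = (\<Sum>i\<in>Basis. l2sq (g i))"
    unfolding weak_gradient_sq_def using weak_derivative_l2sq[OF W(2) D(3)]
    by (subst Bochner_Integration.integral_sum) (auto intro!: sum.cong L2_integrable_sq)
  show ?thesis unfolding T_fun_def 1 2 by (simp add: l2sq_def)
qed

lemma H2_norm_data:
  fixes u :: "'a::euclidean_space \<Rightarrow> complex"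
  assumes "sobolev_data u g h"
  shows "(H2_norm u)\<^sup>2 = l2sq u + (\<Sum>i\<in>Basis. l2sq (g i)) + (\<Sum>i\<in>Basis. \<Sum>j\<in>Basis. l2sq (h i j))"
proof -
  note D = sobolev_dataD[OF assms] and W = sobolev_data_has_weak_derivative[OF assms]
  define f where "f is = (LINT x|lborel. (cmod (weak_derivative is u x))\<^sup>2)" for "is"
  let ?B = "Basis :: 'a set"
  have split: "derivative_indices 2 = {[]} \<union> ((\<lambda>i. [i]) ` ?B \<union> (\<lambda>(i, j). [i, j]) ` (?B \<times> ?B))"
  proof (intro set_eqI iffI)
    fix "is" :: "'a list" assume "is \<in> derivative_indices 2"
    then show "is \<in> {[]} \<union> ((\<lambda>i. [i]) ` ?B \<union> (\<lambda>(i, j). [i, j]) ` (?B \<times> ?B))"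
      by (cases rule: derivative_indices_cases) auto
  qed (auto simp: derivative_indices_def)
  have "(\<Sum>is\<in>derivative_indices 2. f is)
      = f [] + ((\<Sum>is\<in>(\<lambda>i. [i]) ` ?B. f is) + (\<Sum>is\<in>(\<lambda>(i, j). [i, j]) ` (?B \<times> ?B). f is))"
    unfolding split by (subst sum.union_disjoint, simp, simp, force, subst sum.union_disjoint) auto
  also have "(\<Sum>is\<in>(\<lambda>i. [i]) ` ?B. f is) = (\<Sum>i\<in>?B. f [i])"
    by (subst sum.reindex) (auto intro: inj_onI)
  also have "(\<Sum>is\<in>(\<lambda>(i, j). [i, j]) ` (?B \<times> ?B). f is) = (\<Sum>p\<in>?B \<times> ?B. f [fst p, snd p])"
    by (subst sum.reindex) (auto intro: inj_onI simp: case_prod_unfold)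
  also have "\<dots> = (\<Sum>i\<in>?B. \<Sum>j\<in>?B. f [i, j])" by (simp add: sum.cartesian_product case_prod_unfold)
  also have "f [] = l2sq u" unfolding f_def by (rule weak_derivative_l2sq[OF W(1) D(1)])
  also have "(\<Sum>i\<in>?B. f [i]) = (\<Sum>i\<in>?B. l2sq (g i))"
    unfolding f_def by (intro sum.cong refl weak_derivative_l2sq W D)
  also have "(\<Sum>i\<in>?B. \<Sum>j\<in>?B. f [i, j]) = (\<Sum>i\<in>?B. \<Sum>j\<in>?B. l2sq (h i j))"
    unfolding f_def by (intro sum.cong refl weak_derivative_l2sq W D)
  finally have eq: "(\<Sum>is\<in>derivative_indices 2. f is)
      = l2sq u + (\<Sum>i\<in>?B. l2sq (g i)) + (\<Sum>i\<in>?B. \<Sum>j\<in>?B. l2sq (h i j))" by simp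
  have "(H2_norm u)\<^sup>2 = (\<Sum>is\<in>derivative_indices 2. f is)"
    unfolding H2_norm_def f_def by (intro real_sqrt_pow2 sum_nonneg) simp
  then show ?thesis using eq by simp
qed

lemma sobolev_data_lin:
  assumes "sobolev_data u g h" "sobolev_data u' g' h'"
  shows "sobolev_data (\<lambda>x. a * u x + b * u' x) (\<lambda>i x. a * g i x + b * g' i x) (\<lambda>i j x. a * h i j x + b * h' i j x)"
  using assms unfolding sobolev_data_def by (auto intro!: weak_deriv_lin L2_add L2_cmult)

lemma sobolev_data_translate:
  assumes "sobolev_data u g h"
  shows "sobolev_data (\<lambda>x. u (x + z)) (\<lambda>i x. g i (x + z)) (\<lambda>i j x. h i j (x + z))"
  using assms unfolding sobolev_data_def by (auto intro!: weak_deriv_translate L2_translate)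

lemma test_H2:
  assumes "\<phi> \<in> test_functions" shows "\<phi> \<in> H2"
  unfolding H2_iff_sobolev_data sobolev_data_def
  by (intro exI[of _ "\<lambda>i. dir_deriv i \<phi>"] exI[of _ "\<lambda>i j. dir_deriv j (dir_deriv i \<phi>)"] conjI ballI weak_deriv_test test_dir_deriv test_L2 assms)

lemma H2_lin: "u \<in> H2 \<Longrightarrow> v \<in> H2 \<Longrightarrow> (\<lambda>x. a * u x + b * v x) \<in> H2"
  unfolding H2_iff_sobolev_data using sobolev_data_lin by blast

lemma H2_add: "u \<in> H2 \<Longrightarrow> v \<in> H2 \<Longrightarrow> (\<lambda>x. u x + v x) \<in> H2"
  using H2_lin[of u v 1 1] by simp

lemma H2_diff: "u \<in> H2 \<Longrightarrow> v \<in> H2 \<Longrightarrow> (\<lambda>x. u x - v x) \<in> H2"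
  using H2_lin[of u v 1 "-1"] by simp

lemma H2_cmult: "u \<in> H2 \<Longrightarrow> (\<lambda>x. a * u x) \<in> H2"
  using H2_lin[of u u a 0] by simp

lemma H2_midpoint: "u \<in> H2 \<Longrightarrow> v \<in> H2 \<Longrightarrow> (\<lambda>x. (u x + v x) / 2) \<in> H2"
  using H2_lin[of u v "1/2" "1/2"] by (simp add: add_divide_distrib)

lemma H2_translate: "u \<in> H2 \<Longrightarrow> (\<lambda>x. u (x + z)) \<in> H2"
  unfolding H2_iff_sobolev_data using sobolev_data_translate by blast

lemma H2_L2: "u \<in> H2 \<Longrightarrow> u \<in> L2" by (simp add: H2_def)

lemma H2_measurable: "u \<in> H2 \<Longrightarrow> u \<in> borel_measurable borel" by (intro L2_measurable H2_L2)

lemma l2sq_eq_pairing: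
  assumes "f \<in> L2" shows "complex_of_real (l2sq f) = (LINT x|lborel. f x * cnj (f x))"
  unfolding l2sq_def by (subst integral_complex_of_real[symmetric])
    (simp add: complex_norm_square[symmetric] flip: of_real_power)

lemma gradient_identity:
  assumes "sobolev_data u g h"
  shows "(\<Sum>i\<in>Basis. l2sq (g i)) = - Re (LINT x|lborel. u x * cnj (laplacian h x))"
proof -
  note D = sobolev_dataD[OF assms]
  have "complex_of_real (l2sq (g i)) = - (LINT x|lborel. u x * cnj (h i i x))" if "i \<in> Basis" for i
    unfolding l2sq_eq_pairing[OF D(3)[OF that]]
    by (rule integration_by_parts[OF D(2)[OF that] D(4)[OF that that]])
  then have "complex_of_real (\<Sum>i\<in>Basis. l2sq (g i)) = - (\<Sum>i\<in>Basis. LINT x|lborel. u x * cnj (h i i x))"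
    by (simp add: sum_negf)
  also have "(\<Sum>i\<in>Basis. LINT x|lborel. u x * cnj (h i i x)) = (LINT x|lborel. u x * cnj (laplacian h x))"
    unfolding laplacian_def cnj_sum sum_distrib_left
    by (rule Bochner_Integration.integral_sum[symmetric]) (intro L2_integrable_mult L2_cnj D)
  finally show ?thesis by (metis Re_complex_of_real uminus_complex.sel(1))
qed

text \<open>
  The middle term of the functional is \<open>2 Re \<integral>u \<Delta>u\<close> after integration by parts, which completes the square. This
  replaces the Fourier weight \<open>(\<bar>\<xi>\<bar>\<^sup>2 - 1)\<^sup>2 + c\<close>.
\<close>

lemma T_fun_square:
  assumes "sobolev_data u g h"
  shows "T_fun c u = l2sq (\<lambda>x. laplacian h x + u x) + c * l2sq u"
proof -
  note D = sobolev_dataD[OF assms]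
  have "(LINT x|lborel. laplacian h x * cnj (u x)) = cnj (LINT x|lborel. u x * cnj (laplacian h x))"
    by (subst LINT_cnj[symmetric]) (simp add: mult.commute)
  then have "Re (LINT x|lborel. laplacian h x * cnj (u x)) = Re (LINT x|lborel. u x * cnj (laplacian h x))" by simp
  then show ?thesis
    unfolding T_fun_data[OF assms] gradient_identity[OF assms] l2sq_add[OF D(6) D(1)] by (simp add: algebra_simps)
qed

lemma coordinate_difference_le:
  assumes "weak_deriv i u v" "s \<noteq> 0"
  shows "l2sq (\<lambda>x. u (x + s *\<^sub>R i) - u x) \<le> s\<^sup>2 * l2sq v"
  using translation_estimate[OF weak_deriv_scaleR[OF assms(1), of s]] by (simp add: l2sq_cmult)

text \<open>
  Formally \<open>\<integral>\<bar>\<partial>\<^sub>i\<partial>\<^sub>ju\<bar>\<^sup>2\<close>, summed over \<open>j\<close>, equals \<open>\<integral>\<partial>\<^sub>i\<partial>\<^sub>iu \<Delta>u\<close>, but this needs third derivatives. With the outer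
  derivative replaced by a difference along \<open>i\<close> the computation only uses second derivatives: the sum over \<open>j\<close> becomes
  minus the pairing of a second difference of \<open>u\<close> with the Laplacian. Two translation estimates bound the second
  difference by \<open>\<partial>\<^sub>i\<partial>\<^sub>iu\<close>. As the step tends to zero the difference quotients converge weakly, and duality carries the
  bound over to the derivative.
\<close>

lemma hessian_le_mixed:
  fixes u :: "'a::euclidean_space \<Rightarrow> complex"
  assumes "sobolev_data u g h" and i: "i \<in> Basis" and j: "j \<in> Basis"
  shows "l2sq (h j i) \<le> sqrt (l2sq (h i i)) * sqrt (l2sq (laplacian h))"
proof -
  note D = sobolev_dataD[OF assms(1)]
  define M where "M = sqrt (l2sq (h i i)) * sqrt (l2sq (laplacian h))"
  have M0: "M \<ge> 0" by (simp add: M_def)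
  have diff: "l2sq (\<lambda>x. g j (x + s *\<^sub>R i) - g j x) \<le> s\<^sup>2 * M" if s: "s \<noteq> 0" for s
  proof -
    define z where "z = s *\<^sub>R i"
    define \<delta> where "\<delta> f x = f (x + z) - f x" for f :: "'a \<Rightarrow> complex" and x
    have \<delta>_deriv: "weak_deriv k (\<delta> a) (\<delta> b)" if "weak_deriv k a b" for k a b
      unfolding \<delta>_def[abs_def] by (intro weak_deriv_diff weak_deriv_translate that)
    have \<delta>L2: "\<delta> f \<in> L2" if "f \<in> L2" for f unfolding \<delta>_def[abs_def] by (intro L2_diff L2_translate that)
    have 1: "complex_of_real (l2sq (\<delta> (g k))) = - (LINT x|lborel. \<delta> u x * cnj (\<delta> (h k k) x))" if k: "k \<in> Basis" for k
      unfolding l2sq_eq_pairing[OF \<delta>L2[OF D(3)[OF k]]]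
      by (rule integration_by_parts[OF \<delta>_deriv[OF D(2)[OF k]] \<delta>_deriv[OF D(4)[OF k k]]])
    have "complex_of_real (\<Sum>k\<in>Basis. l2sq (\<delta> (g k))) = - (\<Sum>k\<in>Basis. (LINT x|lborel. \<delta> u x * cnj (\<delta> (h k k) x)))"
      using 1 by (simp add: sum_negf)
    also have "(\<Sum>k\<in>Basis. (LINT x|lborel. \<delta> u x * cnj (\<delta> (h k k) x)))
        = (LINT x|lborel. (\<Sum>k\<in>Basis. \<delta> u x * cnj (\<delta> (h k k) x)))"
      by (rule Bochner_Integration.integral_sum[symmetric]) (intro L2_integrable_mult L2_cnj \<delta>L2 D)
    also have "\<dots> = (LINT x|lborel. \<delta> u x * cnj (laplacian h (x + z)) - \<delta> u x * cnj (laplacian h x))"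
      by (simp add: \<delta>_def laplacian_def sum_distrib_left[symmetric] sum_subtractf right_diff_distrib)
    also have "\<dots> = (LINT x|lborel. \<delta> u x * cnj (laplacian h (x + z))) - (LINT x|lborel. \<delta> u x * cnj (laplacian h x))"
      by (intro Bochner_Integration.integral_diff L2_integrable_mult L2_cnj L2_translate \<delta>L2 D)
    also have "(LINT x|lborel. \<delta> u x * cnj (laplacian h (x + z))) = (LINT x|lborel. \<delta> u (x - z) * cnj (laplacian h x))"
      using integral_shift_mult[of "\<lambda>x. cnj (laplacian h x)" "\<delta> u" z] L2_measurable[OF L2_cnj[OF D(6)]] L2_measurable[OF \<delta>L2[OF D(1)]]
      by (simp add: mult.commute)
    also have "(LINT x|lborel. \<delta> u (x - z) * cnj (laplacian h x)) - (LINT x|lborel. \<delta> u x * cnj (laplacian h x))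
        = (LINT x|lborel. (\<delta> u (x - z) - \<delta> u x) * cnj (laplacian h x))"
      using L2_integrable_mult[OF L2_translate[OF \<delta>L2[OF D(1)], of "- z"] L2_cnj[OF D(6)]]
        L2_integrable_mult[OF \<delta>L2[OF D(1)] L2_cnj[OF D(6)]]
      by (simp add: left_diff_distrib)
    finally have eq: "complex_of_real (\<Sum>k\<in>Basis. l2sq (\<delta> (g k)))
        = - (LINT x|lborel. (\<delta> u (x - z) - \<delta> u x) * cnj (laplacian h x))" .
    have "l2sq (\<delta> (g j)) \<le> (\<Sum>k\<in>Basis. l2sq (\<delta> (g k)))" by (rule member_le_sum) (use j in auto)
    also have "\<dots> = cmod (LINT x|lborel. (\<delta> u (x - z) - \<delta> u x) * cnj (laplacian h x))"
    proof -
      have "0 \<le> (\<Sum>k\<in>Basis. l2sq (\<delta> (g k)))" by (intro sum_nonneg) auto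
      then show ?thesis using arg_cong[OF eq, of cmod] by (simp only: norm_minus_cancel norm_of_real abs_of_nonneg)
    qed
    also have "\<dots> \<le> sqrt (l2sq (\<lambda>x. \<delta> u (x - z) - \<delta> u x)) * sqrt (l2sq (\<lambda>x. cnj (laplacian h x)))"
      using L2_translate[OF \<delta>L2[OF D(1)], of "- z"]
      by (intro L2_cauchy_schwarz L2_diff \<delta>L2 L2_cnj D) simp
    also have "l2sq (\<lambda>x. \<delta> u (x - z) - \<delta> u x) \<le> (s\<^sup>2)\<^sup>2 * l2sq (h i i)"
    proof -
      have "l2sq (\<lambda>x. \<delta> u (x + (- s) *\<^sub>R i) - \<delta> u x) \<le> (- s)\<^sup>2 * l2sq (\<delta> (g i))"
        using s by (intro coordinate_difference_le \<delta>_deriv D i) auto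
      also have "\<dots> \<le> (- s)\<^sup>2 * (s\<^sup>2 * l2sq (h i i))"
        using coordinate_difference_le[OF D(4)[OF i i] s] by (intro mult_left_mono) (auto simp: \<delta>_def[abs_def] z_def)
      finally show ?thesis by (simp add: z_def power2_eq_square mult.assoc)
    qed
    also have "sqrt ((s\<^sup>2)\<^sup>2 * l2sq (h i i)) * sqrt (l2sq (\<lambda>x. cnj (laplacian h x))) = s\<^sup>2 * M"
      by (simp only: real_sqrt_mult l2sq_cnj M_def real_sqrt_abs abs_power2 mult.assoc)
    finally show ?thesis by (simp add: \<delta>_def[abs_def] z_def mult_right_mono)
  qed
  have "l2sq (h j i) \<le> (sqrt M)\<^sup>2"
  proof (rule l2sq_le_dual)
    show "h j i \<in> L2" by (rule D(5)[OF j i])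
    fix \<phi> :: "'a \<Rightarrow> complex" assume \<phi>: "\<phi> \<in> test_functions"
    define s where "s n = inverse (real (Suc n))" for n
    have s: "s \<longlonglongrightarrow> 0" "\<And>n. s n \<noteq> 0" unfolding s_def using LIMSEQ_inverse_real_of_nat by auto
    have "(\<lambda>n. cmod (LINT x|lborel. (g j (x + s n *\<^sub>R i) - g j x) / complex_of_real (s n) * \<phi> x))
        \<longlonglongrightarrow> cmod (LINT x|lborel. h j i x * \<phi> x)"
      by (intro tendsto_norm weak_deriv_difference_quotient D j i test_L2 \<phi> s)
    moreover have "cmod (LINT x|lborel. (g j (x + s n *\<^sub>R i) - g j x) / complex_of_real (s n) * \<phi> x)
        \<le> sqrt M * sqrt (l2sq \<phi>)" for n
    proof -
      have q: "(\<lambda>x. (g j (x + s n *\<^sub>R i) - g j x) / complex_of_real (s n)) \<in> L2"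
        by (intro L2_cdiv L2_diff L2_translate D j)
      have "l2sq (\<lambda>x. (g j (x + s n *\<^sub>R i) - g j x) / complex_of_real (s n))
          = (cmod (1 / complex_of_real (s n)))\<^sup>2 * l2sq (\<lambda>x. g j (x + s n *\<^sub>R i) - g j x)"
        using l2sq_cmult[of "1 / complex_of_real (s n)" "\<lambda>x. g j (x + s n *\<^sub>R i) - g j x"] by simp
      also have "\<dots> \<le> (cmod (1 / complex_of_real (s n)))\<^sup>2 * ((s n)\<^sup>2 * M)"
        by (intro mult_left_mono diff s) auto
      also have "\<dots> = M" using s(2)[of n] by (simp add: norm_divide power_divide)
      finally have "sqrt (l2sq (\<lambda>x. (g j (x + s n *\<^sub>R i) - g j x) / complex_of_real (s n))) \<le> sqrt M" by simp
      then show ?thesis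
        using L2_cauchy_schwarz[OF q test_L2[OF \<phi>]] by (meson mult_right_mono order_trans real_sqrt_ge_zero l2sq_nonneg)
    qed
    ultimately show "cmod (LINT x|lborel. h j i x * \<phi> x) \<le> sqrt M * sqrt (l2sq \<phi>)"
      by (intro LIMSEQ_le_const2) auto
  qed (use M0 in auto)
  then show ?thesis using M0 by (simp add: M_def)
qed

text \<open>
  The case of equal indices in \<open>hessian_le_mixed\<close> absorbs its own square root.
\<close>

theorem hessian_le_laplacian:
  assumes "sobolev_data u g h" and i: "i \<in> Basis" and j: "j \<in> Basis"
  shows "l2sq (h i j) \<le> l2sq (laplacian h)"
proof -
  have diag: "sqrt (l2sq (h j j)) \<le> sqrt (l2sq (laplacian h))"
  proof (cases "l2sq (h j j) = 0")
    case False
    then have pos: "0 < sqrt (l2sq (h j j))" using l2sq_nonneg[of "h j j"] by (simp add: order_less_le)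
    have "sqrt (l2sq (h j j)) * sqrt (l2sq (h j j)) \<le> sqrt (l2sq (laplacian h)) * sqrt (l2sq (h j j))"
      using hessian_le_mixed[OF assms(1) j j] by (simp add: mult.commute)
    then show ?thesis using pos by (simp only: mult_le_cancel_right_pos)
  qed simp
  have "l2sq (h i j) \<le> sqrt (l2sq (h j j)) * sqrt (l2sq (laplacian h))" by (rule hessian_le_mixed[OF assms(1) j i])
  also have "\<dots> \<le> sqrt (l2sq (laplacian h)) * sqrt (l2sq (laplacian h))" using diag by (intro mult_right_mono) auto
  finally show ?thesis by simp
qed

section \<open>The energy norm on the Sobolev space\<close>

lemma T_fun_lin_eq:
  assumes "sobolev_data u g h" "sobolev_data u' g' h'"
  shows "T_fun c (\<lambda>x. a * u x + b * u' x)
    = l2sq (\<lambda>x. a * (laplacian h x + u x) + b * (laplacian h' x + u' x)) + c * l2sq (\<lambda>x. a * u x + b * u' x)"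
  unfolding T_fun_square[OF sobolev_data_lin[OF assms]]
  by (simp add: laplacian_def sum.distrib sum_distrib_left algebra_simps)

lemma T_fun_cmult: "u \<in> H2 \<Longrightarrow> T_fun c (\<lambda>x. a * u x) = (cmod a)\<^sup>2 * T_fun c u"
proof -
  assume "u \<in> H2"
  then obtain g h where D: "sobolev_data u g h" by (auto simp: H2_iff_sobolev_data)
  have "T_fun c (\<lambda>x. a * u x) = (cmod a)\<^sup>2 * l2sq (\<lambda>x. laplacian h x + u x) + c * ((cmod a)\<^sup>2 * l2sq u)"
    using T_fun_lin_eq[OF D D, of c a 0] by (simp add: l2sq_cmult)
  then show ?thesis by (simp add: T_fun_square[OF D] algebra_simps)
qed

lemma T_fun_parallelogram:
  assumes "u \<in> H2" "v \<in> H2"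
  shows "T_fun c (\<lambda>x. u x - v x) = 2 * T_fun c u + 2 * T_fun c v - T_fun c (\<lambda>x. u x + v x)"
proof -
  obtain g h g' h' where D: "sobolev_data u g h" "sobolev_data v g' h'"
    using assms by (auto simp: H2_iff_sobolev_data)
  note L = sobolev_dataD(1,6)[OF D(1)] sobolev_dataD(1,6)[OF D(2)]
  show ?thesis
    using T_fun_lin_eq[OF D, of c 1 1] T_fun_lin_eq[OF D, of c 1 "-1"] T_fun_square[OF D(1), of c] T_fun_square[OF D(2), of c]
      l2sq_parallelogram[OF L2_add[OF L(2,1)] L2_add[OF L(4,3)]] l2sq_parallelogram[OF L(1,3)]
    by (simp add: algebra_simps)
qed

lemma T_fun_translate: "u \<in> H2 \<Longrightarrow> T_fun c (\<lambda>x. u (x + z)) = T_fun c u"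
proof -
  assume "u \<in> H2"
  then obtain g h where D: "sobolev_data u g h" by (auto simp: H2_iff_sobolev_data)
  note L = sobolev_dataD(1,6)[OF D]
  have "laplacian (\<lambda>i j x. h i j (x + z)) = (\<lambda>x. laplacian h (x + z))" by (simp add: laplacian_def fun_eq_iff)
  then show ?thesis
    using T_fun_square[OF sobolev_data_translate[OF D], of c z] T_fun_square[OF D, of c]
      l2sq_translate[OF L2_add[OF L(2,1)], of z] l2sq_translate[OF L(1), of z] by simp
qed

context
  fixes c :: real
  assumes c: "c > 0"
begin

lemma T_fun_nonneg: "u \<in> H2 \<Longrightarrow> 0 \<le> T_fun c u"
  using c T_fun_square by (fastforce simp: H2_iff_sobolev_data)

lemma l2sq_le_T_fun: "u \<in> H2 \<Longrightarrow> l2sq u \<le> T_fun c u / c"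
proof -
  assume "u \<in> H2"
  then obtain g h where D: "sobolev_data u g h" by (auto simp: H2_iff_sobolev_data)
  show ?thesis using T_fun_square[OF D, of c] c by (simp add: field_simps)
qed

lemma laplacian_le_T_fun:
  assumes D: "sobolev_data u g h"
  shows "l2sq (laplacian h) \<le> (2 + 2 / c) * T_fun c u"
proof -
  note L = sobolev_dataD(1,6)[OF D]
  have "u \<in> H2" using D by (auto simp: H2_iff_sobolev_data)
  then have "l2sq u \<le> T_fun c u / c" by (rule l2sq_le_T_fun)
  moreover have "l2sq (laplacian h) \<le> 2 * l2sq (\<lambda>x. laplacian h x + u x) + 2 * l2sq u"
    using l2sq_diff_le[OF L2_add[OF L(2,1)] L(1)] by simp
  moreover have "l2sq (\<lambda>x. laplacian h x + u x) \<le> T_fun c u"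
    using T_fun_square[OF D, of c] c by simp
  ultimately have "l2sq (laplacian h) \<le> 2 * T_fun c u + 2 * (T_fun c u / c)" by linarith
  also have "\<dots> = (2 + 2 / c) * T_fun c u" by (simp add: algebra_simps)
  finally show ?thesis .
qed

lemma hessian_le_T_fun:
  "sobolev_data u g h \<Longrightarrow> i \<in> Basis \<Longrightarrow> j \<in> Basis \<Longrightarrow> l2sq (h i j) \<le> (2 + 2 / c) * T_fun c u"
  by (rule order_trans[OF hessian_le_laplacian laplacian_le_T_fun])

lemma gradient_le_T_fun:
  assumes D: "sobolev_data u g h"
  shows "(\<Sum>i\<in>Basis. l2sq (g i)) \<le> (2 + 3 / c) * T_fun c u"
proof -
  note L = sobolev_dataD(1,6)[OF D]
  have u: "u \<in> H2" using D by (auto simp: H2_iff_sobolev_data)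
  have "(\<Sum>i\<in>Basis. l2sq (g i)) \<le> cmod (LINT x|lborel. u x * cnj (laplacian h x))"
    unfolding gradient_identity[OF D] by (metis abs_Re_le_cmod abs_le_D2)
  also have "\<dots> \<le> sqrt (l2sq u) * sqrt (l2sq (laplacian h))"
    using L2_cauchy_schwarz[OF L(1) L2_cnj[OF L(2)]] by (simp add: l2sq_cnj)
  also have "\<dots> \<le> l2sq u + l2sq (laplacian h)"
  proof -
    have "0 \<le> (sqrt (l2sq u) - sqrt (l2sq (laplacian h)))\<^sup>2 + l2sq u + l2sq (laplacian h)" by simp
    then show ?thesis by (simp add: power2_diff)
  qed
  also have "\<dots> \<le> T_fun c u / c + (2 + 2 / c) * T_fun c u"
    by (intro add_mono l2sq_le_T_fun laplacian_le_T_fun[OF D] u)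
  also have "\<dots> = (2 + 3 / c) * T_fun c u" by (simp add: algebra_simps divide_simps)
  finally show ?thesis .
qed

text \<open>
  Together with completeness this makes the functional a Hilbert norm on \<open>H\<^sup>2\<close>, and smallness of the functional becomes
  convergence in \<open>H\<^sup>2\<close>.
\<close>

theorem H2_norm_le_T_fun:
  obtains C where "C > 0" "\<And>u :: 'a::euclidean_space \<Rightarrow> complex. u \<in> H2 \<Longrightarrow> (H2_norm u)\<^sup>2 \<le> C * T_fun c u"
proof
  define N where "N = real DIM('a)"
  define C where "C = 1 / c + (2 + 3 / c) + N * (N * (2 + 2 / c))"
  show "C > 0" unfolding C_def N_def using c by (intro add_pos_pos mult_pos_pos divide_pos_pos) auto
  fix u :: "'a \<Rightarrow> complex" assume u: "u \<in> H2"
  then obtain g h where D: "sobolev_data u g h" by (auto simp: H2_iff_sobolev_data)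
  have "(H2_norm u)\<^sup>2 \<le> T_fun c u / c + (2 + 3 / c) * T_fun c u
      + (\<Sum>i\<in>(Basis::'a set). \<Sum>j\<in>(Basis::'a set). (2 + 2 / c) * T_fun c u)"
    unfolding H2_norm_data[OF D]
    by (intro add_mono sum_mono l2sq_le_T_fun gradient_le_T_fun[OF D] hessian_le_T_fun[OF D] u)
  also have "\<dots> = C * T_fun c u" by (simp add: C_def N_def algebra_simps)
  finally show "(H2_norm u)\<^sup>2 \<le> C * T_fun c u" .
qed

lemma weak_deriv_limit:
  assumes "\<And>n. weak_deriv z (u n) (v n)" "u' \<in> L2" "v' \<in> L2"
    and "(\<lambda>n. l2sq (\<lambda>x. u n x - u' x)) \<longlonglongrightarrow> 0" "(\<lambda>n. l2sq (\<lambda>x. v n x - v' x)) \<longlonglongrightarrow> 0"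
  shows "weak_deriv z u' v'"
  unfolding weak_deriv_def
proof (intro conjI ballI assms)
  fix \<phi> :: "'a \<Rightarrow> complex" assume \<phi>: "\<phi> \<in> test_functions"
  have "(\<lambda>n. LINT x|lborel. u n x * dir_deriv z \<phi> x) \<longlonglongrightarrow> (LINT x|lborel. u' x * dir_deriv z \<phi> x)"
    by (intro L2_pairing_tendsto weak_deriv_L2(1)[OF assms(1)] assms test_L2 test_dir_deriv \<phi>)
  moreover have "(\<lambda>n. - (LINT x|lborel. v n x * \<phi> x)) \<longlonglongrightarrow> - (LINT x|lborel. v' x * \<phi> x)"
    by (intro tendsto_minus L2_pairing_tendsto weak_deriv_L2(2)[OF assms(1)] assms test_L2 \<phi>)
  moreover have "(LINT x|lborel. u n x * dir_deriv z \<phi> x) = - (LINT x|lborel. v n x * \<phi> x)" for n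
    using assms(1)[of n] \<phi> by (simp add: weak_deriv_def)
  ultimately show "(LINT x|lborel. u' x * dir_deriv z \<phi> x) = - (LINT x|lborel. v' x * \<phi> x)"
    by (simp add: LIMSEQ_unique)
qed

text \<open>
  Each derivative is Cauchy in \<open>L\<^sup>2\<close>, and the limits are again weak derivatives because the defining identity is
  continuous in \<open>L\<^sup>2\<close>.
\<close>

theorem H2_complete:
  fixes u :: "nat \<Rightarrow> 'a::euclidean_space \<Rightarrow> complex"
  assumes u: "\<And>n. u n \<in> H2"
    and Cauchy: "\<And>e. e > 0 \<Longrightarrow> \<exists>M. \<forall>m\<ge>M. \<forall>n\<ge>M. T_fun c (\<lambda>x. u m x - u n x) < e"
  obtains v where "v \<in> H2" "(\<lambda>n. T_fun c (\<lambda>x. u n x - v x)) \<longlonglongrightarrow> 0"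
proof -
  have "\<forall>n. \<exists>gh. sobolev_data (u n) (fst gh) (snd gh)" using u by (simp add: H2_iff_sobolev_data)
  then obtain gh where "\<And>n. sobolev_data (u n) (fst (gh n)) (snd (gh n))" by metis
  then obtain g h where D: "\<And>n. sobolev_data (u n) (g n) (h n)"
    using that[of "\<lambda>n. fst (gh n)" "\<lambda>n. snd (gh n)"] by blast
  have Dd: "sobolev_data (\<lambda>x. u m x - u n x) (\<lambda>i x. g m i x - g n i x) (\<lambda>i j x. h m i j x - h n i j x)" for m n
    using sobolev_data_lin[OF D[of m] D[of n], of 1 "-1"] by simp
  define lm where "lm f = (SOME w. w \<in> L2 \<and> (\<lambda>n. l2sq (\<lambda>x. f n x - w x)) \<longlonglongrightarrow> 0)"
    for f :: "nat \<Rightarrow> 'a \<Rightarrow> complex"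
  have lim: "lm f \<in> L2 \<and> (\<lambda>n. l2sq (\<lambda>x. f n x - lm f x)) \<longlonglongrightarrow> 0"
    if f: "\<And>n. f n \<in> L2" and K: "K > 0"
      and le: "\<And>m n. l2sq (\<lambda>x. f m x - f n x) \<le> K * T_fun c (\<lambda>x. u m x - u n x)"
    for f :: "nat \<Rightarrow> 'a \<Rightarrow> complex" and K
  proof -
    have "\<exists>M. \<forall>m\<ge>M. \<forall>n\<ge>M. l2sq (\<lambda>x. f m x - f n x) < e" if e: "e > 0" for e
    proof -
      have "e / K > 0" using e K by simp
      from Cauchy[OF this] obtain M where
        M: "\<And>m n. m \<ge> M \<Longrightarrow> n \<ge> M \<Longrightarrow> T_fun c (\<lambda>x. u m x - u n x) < e / K" by blast
      have "l2sq (\<lambda>x. f m x - f n x) < e" if "m \<ge> M" "n \<ge> M" for m n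
      proof -
        have "K * T_fun c (\<lambda>x. u m x - u n x) < e" using M[OF that] K by (simp add: pos_less_divide_eq mult.commute)
        then show ?thesis using le[of m n] by linarith
      qed
      then show ?thesis by blast
    qed
    from L2_complete[of f, OF f this] have "\<exists>w. w \<in> L2 \<and> (\<lambda>n. l2sq (\<lambda>x. f n x - w x)) \<longlonglongrightarrow> 0" by blast
    then show ?thesis unfolding lm_def by (rule someI_ex)
  qed
  define u' where "u' = lm u"
  define g' where "g' i = lm (\<lambda>n. g n i)" for i
  define h' where "h' i j = lm (\<lambda>n. h n i j)" for i j
  have pos: "1 / c > 0" "2 + 3 / c > 0" "2 + 2 / c > 0" using c by (auto intro: add_pos_pos)
  have u': "u' \<in> L2" "(\<lambda>n. l2sq (\<lambda>x. u n x - u' x)) \<longlonglongrightarrow> 0"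
    unfolding u'_def using lim[of u "1 / c", OF H2_L2[OF u] pos(1)] l2sq_le_T_fun[OF H2_diff[OF u u]] by auto
  have g': "g' i \<in> L2 \<and> (\<lambda>n. l2sq (\<lambda>x. g n i x - g' i x)) \<longlonglongrightarrow> 0" if i: "i \<in> Basis" for i
    unfolding g'_def
  proof (rule lim[OF _ pos(2)])
    fix m n
    have "l2sq (\<lambda>x. g m i x - g n i x) \<le> (\<Sum>i\<in>Basis. l2sq (\<lambda>x. g m i x - g n i x))"
      using i by (intro member_le_sum) auto
    then show "l2sq (\<lambda>x. g m i x - g n i x) \<le> (2 + 3 / c) * T_fun c (\<lambda>x. u m x - u n x)"
      using gradient_le_T_fun[OF Dd] by (rule order_trans)
    show "g n i \<in> L2" by (rule sobolev_dataD(3)[OF D i])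
  qed
  have h': "h' i j \<in> L2 \<and> (\<lambda>n. l2sq (\<lambda>x. h n i j x - h' i j x)) \<longlonglongrightarrow> 0"
    if ij: "i \<in> Basis" "j \<in> Basis" for i j
    unfolding h'_def
    by (rule lim[OF sobolev_dataD(5)[OF D ij] pos(3) hessian_le_T_fun[OF Dd ij]])
  have D': "sobolev_data u' g' h'"
    unfolding sobolev_data_def
  proof (intro conjI ballI)
    show "u' \<in> L2" by (rule u')
    fix i :: 'a assume i: "i \<in> Basis"
    show "weak_deriv i u' (g' i)"
      by (rule weak_deriv_limit[OF sobolev_dataD(2)[OF D i]]) (use u' g'[OF i] in auto)
    fix j :: 'a assume j: "j \<in> Basis"
    show "weak_deriv j (g' i) (h' i j)"
      by (rule weak_deriv_limit[OF sobolev_dataD(4)[OF D i j]]) (use g'[OF i] h'[OF i j] in auto)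
  qed
  show thesis
  proof
    show "u' \<in> H2" using D' by (auto simp: H2_iff_sobolev_data)
    have T_le: "T_fun c (\<lambda>x. u n x - u' x) \<le> 2 * (real DIM('a) * (\<Sum>i\<in>Basis. l2sq (\<lambda>x. h n i i x - h' i i x)))
        + (2 + c) * l2sq (\<lambda>x. u n x - u' x)" for n
    proof -
      have Dn: "sobolev_data (\<lambda>x. u n x - u' x) (\<lambda>i x. g n i x - g' i x) (\<lambda>i j x. h n i j x - h' i j x)"
        using sobolev_data_lin[OF D[of n] D', of 1 "-1"] by simp
      note L = sobolev_dataD(1,6)[OF Dn]
      have "l2sq (laplacian (\<lambda>i j x. h n i j x - h' i j x)) \<le> real DIM('a) * (\<Sum>i\<in>Basis. l2sq (\<lambda>x. h n i i x - h' i i x))"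
        unfolding laplacian_def[abs_def] by (intro l2sq_sum_le sobolev_dataD(5)[OF Dn])
      then show ?thesis
        using l2sq_add_le[OF L(2,1)] unfolding T_fun_square[OF Dn] by (simp add: algebra_simps)
    qed
    have "(\<lambda>n. 2 * (real DIM('a) * (\<Sum>i\<in>Basis. l2sq (\<lambda>x. h n i i x - h' i i x)))
        + (2 + c) * l2sq (\<lambda>x. u n x - u' x)) \<longlonglongrightarrow> 2 * (real DIM('a) * (\<Sum>i\<in>(Basis::'a set). 0)) + (2 + c) * 0"
      using h' u' by (intro tendsto_intros) auto
    then have bound: "(\<lambda>n. 2 * (real DIM('a) * (\<Sum>i\<in>Basis. l2sq (\<lambda>x. h n i i x - h' i i x)))
        + (2 + c) * l2sq (\<lambda>x. u n x - u' x)) \<longlonglongrightarrow> 0" by simp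
    show "(\<lambda>n. T_fun c (\<lambda>x. u n x - u' x)) \<longlonglongrightarrow> 0"
    proof (rule tendsto_sandwich[OF _ _ tendsto_const bound])
      show "\<forall>\<^sub>F n in sequentially. 0 \<le> T_fun c (\<lambda>x. u n x - u' x)"
        by (intro always_eventually allI T_fun_nonneg H2_diff u \<open>u' \<in> H2\<close>)
    qed (use T_le in auto)
  qed
qed

lemma first_difference_le:
  fixes u :: "'a::euclidean_space \<Rightarrow> complex"
  assumes "u \<in> H2"
  shows "l2sq (\<lambda>x. u (x + z) - u x) \<le> real DIM('a) * (norm z)\<^sup>2 * ((2 + 3 / c) * T_fun c u)"
proof -
  obtain g h where D: "sobolev_data u g h" using assms by (auto simp: H2_iff_sobolev_data)
  have "l2sq (\<lambda>x. u (x + z) - u x) \<le> l2sq (\<lambda>x. \<Sum>i\<in>Basis. complex_of_real (z \<bullet> i) * g i x)"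
    by (intro translation_estimate weak_deriv_direction sobolev_dataD[OF D])
  also have "\<dots> \<le> real DIM('a) * (\<Sum>i\<in>Basis. l2sq (\<lambda>x. complex_of_real (z \<bullet> i) * g i x))"
    by (intro l2sq_sum_le L2_cmult sobolev_dataD[OF D])
  also have "\<dots> \<le> real DIM('a) * (\<Sum>i\<in>Basis. (norm z)\<^sup>2 * l2sq (g i))"
    unfolding l2sq_cmult norm_of_real
    by (intro mult_left_mono sum_mono mult_right_mono power_mono Basis_le_norm) auto
  also have "\<dots> = real DIM('a) * (norm z)\<^sup>2 * (\<Sum>i\<in>Basis. l2sq (g i))"
    by (simp add: sum_distrib_left mult.assoc)
  also have "\<dots> \<le> real DIM('a) * (norm z)\<^sup>2 * ((2 + 3 / c) * T_fun c u)"
    by (intro mult_left_mono gradient_le_T_fun[OF D]) auto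
  finally show ?thesis .
qed

text \<open>
  A second difference is a first difference of a first difference, so \<open>translation_estimate\<close> applies twice.
\<close>

lemma second_difference_le:
  fixes u :: "'a::euclidean_space \<Rightarrow> complex"
  assumes "u \<in> H2"
  shows "l2sq (\<lambda>x. u (x + z) + u (x - z) - 2 * u x) \<le> real DIM('a) ^ 4 * norm z ^ 4 * ((2 + 2 / c) * T_fun c u)"
proof -
  obtain g h where D: "sobolev_data u g h" using assms by (auto simp: H2_iff_sobolev_data)
  note DD = sobolev_dataD[OF D]
  define G where "G x = (\<Sum>i\<in>Basis. complex_of_real (z \<bullet> i) * g i x)" for x
  define H where "H j x = (\<Sum>i\<in>Basis. complex_of_real (z \<bullet> i) * h i j x)" for j x
  define w where "w x = u (x + z) - u x" for x
  let ?N = "real DIM('a)" and ?S = "(2 + 2 / c) * T_fun c u"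
  have G: "weak_deriv z u G" unfolding G_def[abs_def] by (intro weak_deriv_direction DD)
  have H: "weak_deriv j G (H j)" if "j \<in> Basis" for j
    unfolding G_def[abs_def] H_def[abs_def] by (intro weak_deriv_sum weak_deriv_cmult DD that)
  have wG: "weak_deriv z w (\<lambda>x. G (x + z) - G x)" unfolding w_def[abs_def] by (intro weak_deriv_diff weak_deriv_translate G)
  have "l2sq (\<lambda>x. u (x + z) + u (x - z) - 2 * u x) = l2sq (\<lambda>x. w (x + z - z) - w (x - z))"
    by (simp add: w_def algebra_simps)
  also have "\<dots> = l2sq (\<lambda>x. w (x + z) - w x)"
    using l2sq_translate[OF L2_diff[OF L2_translate[OF weak_deriv_L2(1)[OF wG], of z] weak_deriv_L2(1)[OF wG]], of "- z"]
    by (simp add: algebra_simps)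
  also have "\<dots> \<le> l2sq (\<lambda>x. G (x + z) - G x)" by (rule translation_estimate[OF wG])
  also have "\<dots> \<le> l2sq (\<lambda>x. \<Sum>j\<in>Basis. complex_of_real (z \<bullet> j) * H j x)"
    by (intro translation_estimate weak_deriv_direction weak_deriv_L2(2)[OF G] H)
  also have "\<dots> \<le> ?N * (\<Sum>j\<in>Basis. l2sq (\<lambda>x. complex_of_real (z \<bullet> j) * H j x))"
    by (intro l2sq_sum_le L2_cmult weak_deriv_L2(2)[OF H])
  also have "\<dots> \<le> ?N * (\<Sum>j\<in>(Basis::'a set). (norm z)\<^sup>2 * (?N * (?N * (norm z)\<^sup>2 * ?S)))"
  proof (intro mult_left_mono sum_mono)
    fix j :: 'a assume j: "j \<in> Basis"
    have "l2sq (H j) \<le> ?N * (\<Sum>i\<in>Basis. l2sq (\<lambda>x. complex_of_real (z \<bullet> i) * h i j x))"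
      unfolding H_def[abs_def] by (intro l2sq_sum_le L2_cmult DD j)
    also have "\<dots> \<le> ?N * (\<Sum>i\<in>(Basis::'a set). (norm z)\<^sup>2 * ?S)"
      unfolding l2sq_cmult norm_of_real
      by (intro mult_left_mono sum_mono mult_mono power_mono Basis_le_norm hessian_le_T_fun[OF D] j) auto
    finally have "l2sq (H j) \<le> ?N * (?N * (norm z)\<^sup>2 * ?S)" by (simp add: mult.assoc)
    then show "l2sq (\<lambda>x. complex_of_real (z \<bullet> j) * H j x) \<le> (norm z)\<^sup>2 * (?N * (?N * (norm z)\<^sup>2 * ?S))"
      unfolding l2sq_cmult norm_of_real using j by (intro mult_mono power_mono Basis_le_norm) auto
  qed auto
  also have "\<dots> = ?N ^ 4 * norm z ^ 4 * ?S" by (simp add: power4_eq_xxxx power2_eq_square)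
  finally show ?thesis .
qed

end

section \<open>Ball averages\<close>

text \<open>
  Translation invariance makes the centre irrelevant; only the type of the space has to be recorded.
\<close>

definition ball_vol :: "'a::euclidean_space itself \<Rightarrow> real \<Rightarrow> real" where
  "ball_vol _ h = measure lborel (ball (0::'a) h)"

definition avg :: "real \<Rightarrow> ('a::euclidean_space \<Rightarrow> complex) \<Rightarrow> 'a \<Rightarrow> complex" where
  "avg h u x = (LINT z|lborel. indicator (ball 0 h) z *\<^sub>R u (x + z)) / complex_of_real (ball_vol TYPE('a) h)"

lemma ball_vol_eq: "h \<ge> 0 \<Longrightarrow> ball_vol TYPE('a::euclidean_space) h = unit_ball_vol (real DIM('a)) * h ^ DIM('a)"
  by (simp add: ball_vol_def content_ball)

lemma ball_vol_pos: "h > 0 \<Longrightarrow> ball_vol TYPE('a::euclidean_space) h > 0"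
  by (simp add: ball_vol_eq)

lemma emeasure_ball_vol: "emeasure lborel (ball (0::'a::euclidean_space) h) = ennreal (ball_vol TYPE('a) h)"
  unfolding ball_vol_def by (rule emeasure_eq_ennreal_measure) (use emeasure_lborel_ball_finite[of "0::'a" h] in auto)

lemma L2_shift: "u \<in> L2 \<Longrightarrow> (\<lambda>z. u (x + z)) \<in> L2"
  using L2_translate[of u x] by (simp add: add.commute)

lemma ball_set_integrable:
  "f \<in> L2 \<Longrightarrow> integrable lborel (\<lambda>z. indicator (ball (0::'a::euclidean_space) h) z *\<^sub>R f z)"
  using emeasure_lborel_ball_finite[of "0::'a" h] by (intro L2_set_integrable) auto

lemma ball_cauchy_schwarz:
  fixes f :: "'a::euclidean_space \<Rightarrow> complex"
  assumes f: "f \<in> L2"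
  shows "(cmod (LINT z|lborel. indicator (ball 0 h) z *\<^sub>R f z))\<^sup>2
      \<le> ball_vol TYPE('a) h * (LINT z|lborel. indicator (ball 0 h) z * (cmod (f z))\<^sup>2)"
proof -
  let ?B = "ball (0::'a) h"
  have ind: "(\<lambda>z. complex_of_real (indicator ?B z)) \<in> L2" "l2sq (\<lambda>z. complex_of_real (indicator ?B z)) = ball_vol TYPE('a) h"
    using indicator_L2[of ?B] emeasure_lborel_ball_finite[of "0::'a" h] by (auto simp: ball_vol_def)
  have g: "(\<lambda>z. indicator ?B z *\<^sub>R f z) \<in> L2"
  proof (rule L2I)
    have *: "(cmod (indicator ?B z *\<^sub>R f z))\<^sup>2 = indicator ?B z *\<^sub>R (cmod (f z))\<^sup>2" for z
      by (auto simp: indicator_def)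
    show "integrable lborel (\<lambda>z. (cmod (indicator ?B z *\<^sub>R f z))\<^sup>2)"
      unfolding * by (intro integrable_mult_indicator L2_integrable_sq f) auto
    show "(\<lambda>z. indicator ?B z *\<^sub>R f z) \<in> borel_measurable borel"
      by (intro borel_measurable_scaleR borel_measurable_indicator L2_measurable[OF f]) auto
  qed
  have "(LINT z|lborel. indicator ?B z *\<^sub>R f z)
      = (LINT z|lborel. complex_of_real (indicator ?B z) * (indicator ?B z *\<^sub>R f z))"
    by (intro Bochner_Integration.integral_cong) (auto simp: indicator_def)
  then have "cmod (LINT z|lborel. indicator ?B z *\<^sub>R f z)
      \<le> sqrt (ball_vol TYPE('a) h) * sqrt (l2sq (\<lambda>z. indicator ?B z *\<^sub>R f z))"
    using L2_cauchy_schwarz[OF ind(1) g] by (simp only: ind(2))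
  then have "(cmod (LINT z|lborel. indicator ?B z *\<^sub>R f z))\<^sup>2
      \<le> (sqrt (ball_vol TYPE('a) h) * sqrt (l2sq (\<lambda>z. indicator ?B z *\<^sub>R f z)))\<^sup>2"
    by (intro power_mono) auto
  also have "\<dots> = ball_vol TYPE('a) h * l2sq (\<lambda>z. indicator ?B z *\<^sub>R f z)"
    by (simp add: power_mult_distrib ball_vol_def)
  also have "l2sq (\<lambda>z. indicator ?B z *\<^sub>R f z) = (LINT z|lborel. indicator ?B z * (cmod (f z))\<^sup>2)"
    unfolding l2sq_def by (intro Bochner_Integration.integral_cong) (auto simp: indicator_def)
  finally show ?thesis .
qed

lemma ball_integral_sq_le:
  fixes f :: "'a::euclidean_space \<Rightarrow> complex"
  assumes f: "f \<in> L2"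
  shows "(cmod (LINT z|lborel. indicator (ball 0 h) z *\<^sub>R f z))\<^sup>2 \<le> ball_vol TYPE('a) h * l2sq f"
proof -
  have "(LINT z|lborel. indicator (ball (0::'a) h) z *\<^sub>R (cmod (f z))\<^sup>2) \<le> l2sq f"
    unfolding l2sq_def
    by (intro integral_mono integrable_mult_indicator L2_integrable_sq f) (auto simp: indicator_def)
  then have "ball_vol TYPE('a) h * (LINT z|lborel. indicator (ball (0::'a) h) z * (cmod (f z))\<^sup>2) \<le> ball_vol TYPE('a) h * l2sq f"
    by (intro mult_left_mono) (auto simp: ball_vol_def)
  then show ?thesis using ball_cauchy_schwarz[OF f, of h] by linarith
qed

lemma avg_sq_le:
  fixes u :: "'a::euclidean_space \<Rightarrow> complex"
  assumes "u \<in> L2" "h > 0"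
  shows "(cmod (avg h u x))\<^sup>2 \<le> l2sq u / ball_vol TYPE('a) h"
proof -
  have v: "ball_vol TYPE('a) h > 0" by (rule ball_vol_pos[OF assms(2)])
  have "(cmod (avg h u x))\<^sup>2 = (cmod (LINT z|lborel. indicator (ball 0 h) z *\<^sub>R u (x + z)))\<^sup>2 / (ball_vol TYPE('a) h)\<^sup>2"
    using v by (simp add: avg_def norm_divide power_divide)
  also have "\<dots> \<le> ball_vol TYPE('a) h * l2sq (\<lambda>z. u (x + z)) / (ball_vol TYPE('a) h)\<^sup>2"
    by (intro divide_right_mono ball_integral_sq_le L2_shift assms) auto
  also have "l2sq (\<lambda>z. u (x + z)) = l2sq u"
    using l2sq_translate[OF assms(1), of x] by (simp add: add.commute)
  finally show ?thesis using v by (simp add: power2_eq_square)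
qed

lemma avg_lin:
  assumes "u \<in> L2" "v \<in> L2"
  shows "avg h (\<lambda>x. a * u x + b * v x) x = a * avg h u x + b * avg h v x"
proof -
  have "(LINT z|lborel. indicator (ball 0 h) z *\<^sub>R (a * u (x + z) + b * v (x + z)))
     = (LINT z|lborel. a * (indicator (ball 0 h) z *\<^sub>R u (x + z)) + b * (indicator (ball 0 h) z *\<^sub>R v (x + z)))"
    by (simp add: scaleR_add_right mult_scaleR_right)
  also have "\<dots> = a * (LINT z|lborel. indicator (ball 0 h) z *\<^sub>R u (x + z)) + b * (LINT z|lborel. indicator (ball 0 h) z *\<^sub>R v (x + z))"
    using ball_set_integrable[OF L2_shift[OF assms(1)]] ball_set_integrable[OF L2_shift[OF assms(2)]]
    by (subst Bochner_Integration.integral_add) (auto simp del: mult_scaleR_right)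
  finally show ?thesis by (simp add: avg_def add_divide_distrib)
qed

lemma avg_diff: "u \<in> L2 \<Longrightarrow> v \<in> L2 \<Longrightarrow> avg h (\<lambda>x. u x - v x) x = avg h u x - avg h v x"
  using avg_lin[of u v h 1 "-1"] by simp

lemma avg_midpoint: "u \<in> L2 \<Longrightarrow> v \<in> L2 \<Longrightarrow> avg h (\<lambda>x. (u x + v x) / 2) x = (avg h u x + avg h v x) / 2"
  using avg_lin[of u v h "1/2" "1/2"] by (simp add: add_divide_distrib)

lemma avg_translate: "avg h (\<lambda>x. u (x + y)) x = avg h u (x + y)"
  by (simp add: avg_def add_ac)

lemma borel_measurable_pair:
  fixes f :: "'a::euclidean_space \<times> 'a \<Rightarrow> 'b::topological_space"
  assumes "f \<in> borel_measurable borel" "sets A = sets borel" "sets B = sets borel"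
  shows "f \<in> borel_measurable (A \<Otimes>\<^sub>M B)"
proof -
  have "sets (A \<Otimes>\<^sub>M B) = sets (borel :: ('a \<times> 'a) measure)"
    using sets_pair_measure_cong[OF assms(2,3)] arg_cong[OF borel_prod, of sets] by (rule trans)
  then show ?thesis using assms(1) measurable_cong_sets by blast
qed

lemma borel_measurable_continuous_compose:
  assumes "u \<in> borel_measurable borel" "continuous_on UNIV f"
  shows "(\<lambda>x. u (f x)) \<in> borel_measurable borel"
  by (rule measurable_compose[OF borel_measurable_continuous_onI[OF assms(2)] assms(1)])

lemma avg_measurable [measurable]:
  fixes u :: "'a::euclidean_space \<Rightarrow> complex"
  assumes u: "u \<in> borel_measurable borel"
  shows "avg h u \<in> borel_measurable borel"
proof -
  have "(\<lambda>p. indicator (ball (0::'a) h) (snd p) *\<^sub>R u (fst p + snd p)) \<in> borel_measurable borel"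
  proof (intro borel_measurable_scaleR)
    show "(\<lambda>p::'a \<times> 'a. indicator (ball (0::'a) h) (snd p) :: real) \<in> borel_measurable borel"
      by (rule borel_measurable_continuous_compose[OF borel_measurable_indicator]) (auto intro!: continuous_intros)
    show "(\<lambda>p::'a \<times> 'a. u (fst p + snd p)) \<in> borel_measurable borel"
      by (rule borel_measurable_continuous_compose[OF u]) (auto intro!: continuous_intros)
  qed
  from borel_measurable_pair[OF this, of borel lborel]
  have "(\<lambda>p. indicator (ball (0::'a) h) (snd p) *\<^sub>R u (fst p + snd p)) \<in> borel_measurable (borel \<Otimes>\<^sub>M lborel)"
    by simp
  then have "(\<lambda>x. LINT z|lborel. indicator (ball 0 h) z *\<^sub>R u (x + z)) \<in> borel_measurable borel"
    by (intro lborel.borel_measurable_lebesgue_integral) (simp add: case_prod_unfold)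
  then show ?thesis unfolding avg_def[abs_def] by (intro borel_measurable_divide) auto
qed

lemma lborel_distr_uminus_euclidean: "distr lborel borel uminus = (lborel :: 'a::euclidean_space measure)"
  using lborel_affine[of "-1" "0 :: 'a"] by (simp add: density_1)

lemma integral_reflect_lborel:
  fixes f :: "'a::euclidean_space \<Rightarrow> 'b::{banach,second_countable_topology}"
  assumes "f \<in> borel_measurable borel"
  shows "(LINT x|lborel. f (- x)) = (LINT x|lborel. f x)"
  by (subst (2) lborel_distr_uminus_euclidean[symmetric], subst integral_distr) (use assms in auto)

lemma L2_reflect: 
  assumes "f \<in> L2" shows "(\<lambda>x. f (- x)) \<in> L2"
proof (rule L2I)
  note [measurable] = L2_measurable[OF assms]
  show "(\<lambda>x. f (- x)) \<in> borel_measurable borel" by measurable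
  have "integrable (distr lborel borel uminus) (\<lambda>x. (cmod (f x))\<^sup>2)"
    unfolding lborel_distr_uminus_euclidean by (rule L2_integrable_sq[OF assms])
  then show "integrable lborel (\<lambda>x. (cmod (f (- x)))\<^sup>2)"
    by (subst (asm) integrable_distr_eq) auto
qed

text \<open>
  The ball is symmetric, so averaging \<open>u(x + z) - u(x)\<close> over it is the same as averaging half of the symmetric second
  difference. This is what makes the error quadratic in the radius.
\<close>

lemma avg_error_pointwise:
  fixes u :: "'a::euclidean_space \<Rightarrow> complex"
  assumes u: "u \<in> L2" and h: "h > 0"
  shows "ennreal ((cmod (u x - avg h u x))\<^sup>2)
    \<le> ennreal (1 / (4 * ball_vol TYPE('a) h)) *
       (\<integral>\<^sup>+z. ennreal (indicator (ball 0 h) z * (cmod (u (x + z) + u (x - z) - 2 * u x))\<^sup>2) \<partial>lborel)"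
proof -
  let ?B = "ball (0::'a) h" and ?V = "ball_vol TYPE('a) h"
  have v: "?V > 0" by (rule ball_vol_pos[OF h])
  have u1: "(\<lambda>z. u (x + z)) \<in> L2" by (rule L2_shift[OF u])
  have u2: "(\<lambda>z. u (x - z)) \<in> L2" using L2_reflect[OF u1] by simp
  have u3: "(\<lambda>z. complex_of_real (indicator ?B z) * (2 * u x)) \<in> L2"
    using L2_cmult[OF indicator_L2(1)[of ?B], of "2 * u x"] emeasure_lborel_ball_finite[of "0::'a" h]
    by (simp add: mult.commute)
  define q where "q z = u (x + z) + u (x - z) - complex_of_real (indicator ?B z) * (2 * u x)" for z
  note i1 = ball_set_integrable[OF u1, of h] and i2 = ball_set_integrable[OF u2, of h] and i3 = ball_set_integrable[OF u3, of h]
  have q: "q \<in> L2" unfolding q_def[abs_def] by (intro L2_add L2_diff u1 u2 u3)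
  have "(LINT z|lborel. indicator ?B z *\<^sub>R u (x - z)) = (LINT z|lborel. indicator ?B z *\<^sub>R u (x + z))"
    using integral_reflect_lborel[of "\<lambda>z. indicator ?B z *\<^sub>R u (x + z)"] L2_measurable[OF u1]
    by (simp add: indicator_def)
  moreover have "(LINT z|lborel. indicator ?B z *\<^sub>R (complex_of_real (indicator ?B z) * (2 * u x))) = 2 * u x * ?V"
  proof -
    have "(LINT z|lborel. indicator ?B z *\<^sub>R (complex_of_real (indicator ?B z) * (2 * u x)))
        = (LINT z|lborel. indicator ?B z *\<^sub>R (2 * u x))"
      by (intro Bochner_Integration.integral_cong) (auto simp: indicator_def)
    also have "\<dots> = ?V *\<^sub>R (2 * u x)"
    proof -
      have "integrable lborel (\<lambda>z. indicator ?B z :: real)"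
        using emeasure_lborel_ball_finite[of "0::'a" h] by (intro integrable_real_indicator) auto
      then have "(LINT z|lborel. indicator ?B z *\<^sub>R (2 * u x)) = (LINT z|lborel. indicator ?B z :: real) *\<^sub>R (2 * u x)"
        by (intro integral_scaleR_left) simp
      then show ?thesis by (simp add: ball_vol_def)
    qed
    finally show ?thesis by (simp add: scaleR_conv_of_real mult.commute)
  qed
  moreover have "(LINT z|lborel. indicator ?B z *\<^sub>R q z) = (LINT z|lborel. indicator ?B z *\<^sub>R u (x + z))
      + (LINT z|lborel. indicator ?B z *\<^sub>R u (x - z))
      - (LINT z|lborel. indicator ?B z *\<^sub>R (complex_of_real (indicator ?B z) * (2 * u x)))"
    unfolding q_def scaleR_add_right scaleR_diff_right
    by (simp only: Bochner_Integration.integral_add[OF i1 i2]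
        Bochner_Integration.integral_diff[OF Bochner_Integration.integrable_add[OF i1 i2] i3])
  ultimately have Q: "(LINT z|lborel. indicator ?B z *\<^sub>R q z) = 2 * (LINT z|lborel. indicator ?B z *\<^sub>R u (x + z)) - 2 * u x * ?V"
    by simp
  have eq: "u x - avg h u x = - (LINT z|lborel. indicator ?B z *\<^sub>R q z) / complex_of_real (2 * ?V)"
    unfolding Q avg_def using v by (simp add: field_simps)
  have int: "integrable lborel (\<lambda>z. indicator ?B z * (cmod (q z))\<^sup>2)"
    using integrable_mult_indicator[OF _ L2_integrable_sq[OF q], of ?B] by simp
  have "(cmod (u x - avg h u x))\<^sup>2 = (cmod (LINT z|lborel. indicator ?B z *\<^sub>R q z))\<^sup>2 / (2 * ?V)\<^sup>2"
    using v by (simp add: eq norm_divide power_divide norm_mult)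
  also have "\<dots> \<le> ?V * (LINT z|lborel. indicator ?B z * (cmod (q z))\<^sup>2) / (2 * ?V)\<^sup>2"
    by (intro divide_right_mono ball_cauchy_schwarz q) auto
  also have "\<dots> = 1 / (4 * ?V) * (LINT z|lborel. indicator ?B z * (cmod (q z))\<^sup>2)"
    using v by (simp add: power2_eq_square)
  finally have le: "(cmod (u x - avg h u x))\<^sup>2 \<le> 1 / (4 * ?V) * (LINT z|lborel. indicator ?B z * (cmod (q z))\<^sup>2)" .
  have "ennreal ((cmod (u x - avg h u x))\<^sup>2) \<le> ennreal (1 / (4 * ?V) * (LINT z|lborel. indicator ?B z * (cmod (q z))\<^sup>2))"
    by (rule ennreal_leI[OF le])
  also have "\<dots> = ennreal (1 / (4 * ?V)) * ennreal (LINT z|lborel. indicator ?B z * (cmod (q z))\<^sup>2)"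
    using v by (intro ennreal_mult') auto
  also have "ennreal (LINT z|lborel. indicator ?B z * (cmod (q z))\<^sup>2)
      = (\<integral>\<^sup>+z. ennreal (indicator ?B z * (cmod (q z))\<^sup>2) \<partial>lborel)"
    by (rule nn_integral_eq_integral[symmetric, OF int]) simp
  also have "\<dots> = (\<integral>\<^sup>+z. ennreal (indicator ?B z * (cmod (u (x + z) + u (x - z) - 2 * u x))\<^sup>2) \<partial>lborel)"
    by (intro nn_integral_cong arg_cong[where f=ennreal]) (auto simp: q_def indicator_def)
  finally show ?thesis .
qed

context
  fixes c :: real
  assumes c: "c > 0"
begin

text \<open>
  Integrate \<open>avg_error_pointwise\<close> in \<open>x\<close> and exchange the integrals.
\<close>

theorem avg_error_le:
  fixes u :: "'a::euclidean_space \<Rightarrow> complex"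
  assumes u: "u \<in> H2" and h: "h > 0"
  shows "(\<lambda>x. u x - avg h u x) \<in> L2"
    and "l2sq (\<lambda>x. u x - avg h u x) \<le> real DIM('a) ^ 4 * (2 + 2 / c) * h ^ 4 * T_fun c u"
proof -
  let ?B = "ball (0::'a) h" and ?V = "ball_vol TYPE('a) h"
  define A where "A = real DIM('a) ^ 4 * (2 + 2 / c) * h ^ 4 * T_fun c u"
  have A0: "A \<ge> 0" unfolding A_def using c h T_fun_nonneg[OF c u] by (intro mult_nonneg_nonneg add_nonneg_nonneg) auto
  have v: "?V > 0" by (rule ball_vol_pos[OF h])
  have uL: "u \<in> L2" by (rule H2_L2[OF u])
  note [measurable] = L2_measurable[OF uL]
  let ?q = "\<lambda>x z. (cmod (u (x + z) + u (x - z) - 2 * u x))\<^sup>2"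
  have cont: "continuous_on UNIV (\<lambda>p::'a \<times> 'a. fst p + snd p)" "continuous_on UNIV (\<lambda>p::'a \<times> 'a. fst p - snd p)"
    "continuous_on UNIV (fst :: 'a \<times> 'a \<Rightarrow> 'a)" "continuous_on UNIV (snd :: 'a \<times> 'a \<Rightarrow> 'a)"
    by (auto intro!: continuous_intros)
  have "(\<lambda>p. ennreal (indicator ?B (snd p) * ?q (fst p) (snd p))) \<in> borel_measurable borel"
  proof -
    have [measurable]: "(\<lambda>p::'a \<times> 'a. u (fst p + snd p)) \<in> borel_measurable borel"
      "(\<lambda>p::'a \<times> 'a. u (fst p - snd p)) \<in> borel_measurable borel"
      "(\<lambda>p::'a \<times> 'a. u (fst p)) \<in> borel_measurable borel"
      "(\<lambda>p::'a \<times> 'a. indicator ?B (snd p) :: real) \<in> borel_measurable borel"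
      by (rule borel_measurable_continuous_compose[OF L2_measurable[OF uL] cont(1)]
          borel_measurable_continuous_compose[OF L2_measurable[OF uL] cont(2)]
          borel_measurable_continuous_compose[OF L2_measurable[OF uL] cont(3)]
          borel_measurable_continuous_compose[OF borel_measurable_indicator cont(4)], simp?)+
    show ?thesis by measurable
  qed
  from borel_measurable_pair[OF this, of lborel lborel]
  have joint: "(\<lambda>(x, z). ennreal (indicator ?B z * ?q x z)) \<in> borel_measurable (lborel \<Otimes>\<^sub>M lborel)"
    by (simp add: case_prod_unfold)
  have inner: "(\<integral>\<^sup>+x. ennreal (indicator ?B z * ?q x z) \<partial>lborel) \<le> ennreal A * indicator ?B z" for z
  proof (cases "z \<in> ?B")
    case True
    have L: "(\<lambda>x. u (x + z) + u (x - z) - 2 * u x) \<in> L2"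
      using L2_translate[OF uL, of "- z"] by (intro L2_diff L2_add L2_translate L2_cmult uL) simp
    have "(\<integral>\<^sup>+x. ennreal (?q x z) \<partial>lborel) = ennreal (l2sq (\<lambda>x. u (x + z) + u (x - z) - 2 * u x))"
      unfolding l2sq_def by (rule nn_integral_eq_integral[OF L2_integrable_sq[OF L]]) simp
    also have "\<dots> \<le> ennreal A"
    proof (rule ennreal_leI)
      have "l2sq (\<lambda>x. u (x + z) + u (x - z) - 2 * u x) \<le> real DIM('a) ^ 4 * norm z ^ 4 * ((2 + 2 / c) * T_fun c u)"
        by (rule second_difference_le[OF c u])
      also have "\<dots> \<le> real DIM('a) ^ 4 * h ^ 4 * ((2 + 2 / c) * T_fun c u)"
        using True c T_fun_nonneg[OF c u] by (intro mult_right_mono mult_left_mono power_mono) auto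
      finally show "l2sq (\<lambda>x. u (x + z) + u (x - z) - 2 * u x) \<le> A" by (simp add: A_def mult_ac)
    qed
    finally show ?thesis using True by simp
  qed simp
  have "(\<integral>\<^sup>+x. ennreal ((cmod (u x - avg h u x))\<^sup>2) \<partial>lborel)
      \<le> (\<integral>\<^sup>+x. ennreal (1 / (4 * ?V)) * (\<integral>\<^sup>+z. ennreal (indicator ?B z * ?q x z) \<partial>lborel) \<partial>lborel)"
    by (intro nn_integral_mono avg_error_pointwise uL h)
  also have "\<dots> = ennreal (1 / (4 * ?V)) * (\<integral>\<^sup>+x. (\<integral>\<^sup>+z. ennreal (indicator ?B z * ?q x z) \<partial>lborel) \<partial>lborel)"
    using lborel.borel_measurable_nn_integral[OF joint] by (intro nn_integral_cmult)
  also have "(\<integral>\<^sup>+x. (\<integral>\<^sup>+z. ennreal (indicator ?B z * ?q x z) \<partial>lborel) \<partial>lborel)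
      = (\<integral>\<^sup>+z. (\<integral>\<^sup>+x. ennreal (indicator ?B z * ?q x z) \<partial>lborel) \<partial>lborel)"
    by (rule lborel_pair.Fubini'[OF joint, symmetric])
  also have "ennreal (1 / (4 * ?V)) * (\<integral>\<^sup>+z. (\<integral>\<^sup>+x. ennreal (indicator ?B z * ?q x z) \<partial>lborel) \<partial>lborel)
      \<le> ennreal (1 / (4 * ?V)) * (\<integral>\<^sup>+z. ennreal A * indicator ?B z \<partial>lborel)"
    by (intro mult_left_mono nn_integral_mono inner) auto
  also have "\<dots> = ennreal (1 / (4 * ?V)) * (ennreal A * ennreal ?V)"
    by (subst nn_integral_cmult_indicator) (auto simp: emeasure_ball_vol)
  also have "\<dots> = ennreal (1 / (4 * ?V) * (A * ?V))"
  proof -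
    have "ennreal A * ennreal ?V = ennreal (A * ?V)" using A0 v by (intro ennreal_mult[symmetric]) auto
    moreover have "ennreal (1 / (4 * ?V)) * ennreal (A * ?V) = ennreal (1 / (4 * ?V) * (A * ?V))"
      using A0 v by (intro ennreal_mult[symmetric]) auto
    ultimately show ?thesis by (simp only:)
  qed
  also have "1 / (4 * ?V) * (A * ?V) = A / 4" using v by simp
  finally have le: "(\<integral>\<^sup>+x. ennreal ((cmod (u x - avg h u x))\<^sup>2) \<partial>lborel) \<le> ennreal (A / 4)" .
  show L2: "(\<lambda>x. u x - avg h u x) \<in> L2"
  proof (rule L2I)
    show "integrable lborel (\<lambda>x. (cmod (u x - avg h u x))\<^sup>2)"
      using le by (intro integrableI_nonneg) (auto intro: le_less_trans)
  qed measurable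
  have "ennreal (l2sq (\<lambda>x. u x - avg h u x)) \<le> ennreal (A / 4)"
    using le unfolding l2sq_def by (subst nn_integral_eq_integral[symmetric, OF L2_integrable_sq[OF L2]]) auto
  then have "l2sq (\<lambda>x. u x - avg h u x) \<le> A / 4" using A0 by (subst (asm) ennreal_le_iff) auto
  also have "\<dots> \<le> A" using A0 by simp
  finally show "l2sq (\<lambda>x. u x - avg h u x) \<le> real DIM('a) ^ 4 * (2 + 2 / c) * h ^ 4 * T_fun c u" by (simp add: A_def)
qed

text \<open>
  The difference of two averages is one average of a translation difference.
\<close>

lemma avg_equicontinuous:
  fixes u :: "'a::euclidean_space \<Rightarrow> complex"
  assumes u: "u \<in> H2" and h: "h > 0"
  shows "(cmod (avg h u x - avg h u y))\<^sup>2
    \<le> real DIM('a) * (norm (x - y))\<^sup>2 * ((2 + 3 / c) * T_fun c u) / ball_vol TYPE('a) h"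
proof -
  have uL: "u \<in> L2" by (rule H2_L2[OF u])
  have "avg h u x - avg h u y = avg h (\<lambda>t. u (t + (x - y)) - u t) y"
    using avg_diff[OF L2_translate[OF uL] uL] avg_translate[of h u "x - y" y] by simp
  then have "(cmod (avg h u x - avg h u y))\<^sup>2 \<le> l2sq (\<lambda>t. u (t + (x - y)) - u t) / ball_vol TYPE('a) h"
    using avg_sq_le[OF L2_diff[OF L2_translate[OF uL] uL] h] by simp
  also have "\<dots> \<le> real DIM('a) * (norm (x - y))\<^sup>2 * ((2 + 3 / c) * T_fun c u) / ball_vol TYPE('a) h"
    by (intro divide_right_mono first_difference_le[OF c u]) (use ball_vol_pos[OF h, where ?'a='a] in simp)
  finally show ?thesis .
qed

end

text \<open>
  Replaces Hoelder's inequality by the pointwise bound \<open>s \<le> a + a powr (1 - p) * s powr p\<close>; choosing \<open>a\<close> according to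
  the radius recovers its strength.
\<close>

lemma avg_powr_le:
  fixes u :: "'a::euclidean_space \<Rightarrow> complex"
  assumes u: "u \<in> L2" and h: "h > 0" and p: "p \<ge> 1" and a: "a > 0"
    and int: "integrable lborel (\<lambda>x. cmod (u x) powr p)" and le: "(LINT x|lborel. cmod (u x) powr p) \<le> C"
  shows "cmod (avg h u x) \<le> a + a powr (1 - p) * C / ball_vol TYPE('a) h"
proof -
  let ?B = "ball (0::'a) h" and ?V = "ball_vol TYPE('a) h"
  have v: "?V > 0" by (rule ball_vol_pos[OF h])
  have pt: "s \<le> a + a powr (1 - p) * s powr p" if "s \<ge> 0" for s
  proof (cases "s \<le> a")
    case False
    then have s: "s > a" by simp
    have "s = s powr p * s powr (1 - p)" using s a by (simp flip: powr_add)
    also have "\<dots> \<le> s powr p * a powr (1 - p)"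
      using s a p by (intro mult_left_mono powr_mono2') auto
    finally show ?thesis using a by (simp add: mult.commute)
  qed (use that in \<open>simp add: add_increasing2\<close>)
  have int': "integrable lborel (\<lambda>z. cmod (u (x + z)) powr p)"
    using integrable_translate[OF int, of x] by (simp add: add.commute)
  have eq': "(LINT z|lborel. cmod (u (x + z)) powr p) = (LINT x|lborel. cmod (u x) powr p)"
    using integral_translate[of "\<lambda>x. cmod (u x) powr p" x] L2_measurable[OF u] by (simp add: add.commute)
  have "cmod (LINT z|lborel. indicator ?B z *\<^sub>R u (x + z)) \<le> (LINT z|lborel. cmod (indicator ?B z *\<^sub>R u (x + z)))"
    by (rule integral_norm_bound)
  also have "\<dots> \<le> (LINT z|lborel. a * indicator ?B z + a powr (1 - p) * (cmod (u (x + z)) powr p))"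
  proof (rule integral_mono)
    show "integrable lborel (\<lambda>z. cmod (indicator ?B z *\<^sub>R u (x + z)))"
      by (intro integrable_norm ball_set_integrable L2_shift u)
    show "integrable lborel (\<lambda>z. a * indicator ?B z + a powr (1 - p) * (cmod (u (x + z)) powr p))"
      using emeasure_lborel_ball_finite[of "0::'a" h]
      by (intro Bochner_Integration.integrable_add integrable_mult_right int' integrable_real_indicator) auto
    show "cmod (indicator ?B z *\<^sub>R u (x + z)) \<le> a * indicator ?B z + a powr (1 - p) * (cmod (u (x + z)) powr p)" for z
      using pt[of "cmod (u (x + z))"] by (auto simp: indicator_def)
  qed
  also have "\<dots> = a * ?V + a powr (1 - p) * (LINT x|lborel. cmod (u x) powr p)"
    using emeasure_lborel_ball_finite[of "0::'a" h] int'
    by (subst Bochner_Integration.integral_add)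
      (auto simp: eq' ball_vol_def intro!: integrable_mult_right integrable_real_indicator)
  also have "\<dots> \<le> a * ?V + a powr (1 - p) * C" by (intro add_left_mono mult_left_mono le) auto
  finally have "cmod (avg h u x) \<le> (a * ?V + a powr (1 - p) * C) / ?V"
    using v by (simp add: avg_def norm_divide divide_right_mono)
  also have "\<dots> = a + a powr (1 - p) * C / ?V" using v by (simp add: add_divide_distrib)
  finally show ?thesis .
qed

section \<open>The Sobolev inequality below the critical exponent\<close>

text \<open>
  A bound on the unit ball of the energy; homogeneity turns it into an inequality for all functions at the end.
\<close>

definition sobolev_bound :: "'a::euclidean_space itself \<Rightarrow> real \<Rightarrow> real \<Rightarrow> real \<Rightarrow> bool" where
  "sobolev_bound _ c p C \<longleftrightarrow> (\<forall>u::'a \<Rightarrow> complex. u \<in> H2 \<longrightarrow> T_fun c u \<le> 1 \<longrightarrow>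
     integrable lborel (\<lambda>x. cmod (u x) powr p) \<and> (LINT x|lborel. cmod (u x) powr p) \<le> C)"

lemma integrable_bound_from_nn:
  fixes f :: "'b \<Rightarrow> real"
  assumes "f \<in> borel_measurable M" "\<And>x. 0 \<le> f x" "0 \<le> C" "(\<integral>\<^sup>+x. ennreal (f x) \<partial>M) \<le> ennreal C"
  shows "integrable M f" "(LINT x|M. f x) \<le> C"
proof -
  show *: "integrable M f"
    by (rule integrableI_nonneg) (use assms in \<open>auto intro: le_less_trans\<close>)
  have "ennreal (LINT x|M. f x) \<le> ennreal C"
    using assms by (subst nn_integral_eq_integral[symmetric, OF *]) auto
  then show "(LINT x|M. f x) \<le> C" using assms(3) by (simp only: ennreal_le_iff)
qed

lemma sobolev_bound_2:
  assumes c: "c > 0" shows "sobolev_bound TYPE('a::euclidean_space) c 2 (1 / c)"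
  unfolding sobolev_bound_def
proof (intro allI impI)
  fix u :: "'a \<Rightarrow> complex" assume u: "u \<in> H2" "T_fun c u \<le> 1"
  have "(\<lambda>x. cmod (u x) powr 2) = (\<lambda>x. (cmod (u x))\<^sup>2)" by simp
  moreover have "l2sq u \<le> 1 / c"
    using l2sq_le_T_fun[OF c u(1)] u(2) c by (simp add: field_simps)
  ultimately show "integrable lborel (\<lambda>x. cmod (u x) powr 2) \<and> (LINT x|lborel. cmod (u x) powr 2) \<le> 1 / c"
    using L2_integrable_sq[OF H2_L2[OF u(1)]] by (simp add: l2sq_def)
qed

lemma dyadic_level:
  assumes "(1::real) < t"
  obtains j :: nat where "2 ^ j < t" "t \<le> 2 ^ Suc j"
proof -
  obtain n :: nat where n: "t < 2 ^ n" using real_arch_pow[of 2 t] by auto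
  define k where "k = (LEAST n. t \<le> 2 ^ n)"
  have k: "t \<le> 2 ^ k" unfolding k_def by (rule LeastI[of _ n]) (use n in simp)
  have "k \<noteq> 0" using k assms by (intro notI) simp
  then obtain j where j: "k = Suc j" by (cases k) auto
  have "\<not> t \<le> 2 ^ j" using not_less_Least[of j "\<lambda>n. t \<le> 2 ^ n"] j unfolding k_def by simp
  then show thesis using that[of j] k j by simp
qed

text \<open>
  A dyadic layer-cake bound; the levels below one are covered by the square.
\<close>

lemma powr_dyadic_le:
  fixes t q :: real
  assumes "t \<ge> 0" "q \<ge> 2"
  shows "ennreal (t powr q) \<le> ennreal (t\<^sup>2) + (\<Sum>j. ennreal ((2 ^ Suc j) powr q) * indicator {x. 2 ^ j < x} t)"
proof (cases "t \<le> 1")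
  case True
  have "t powr q \<le> t powr 2"
  proof (cases "t = 0")
    case False
    then show ?thesis using True assms by (intro powr_mono') auto
  qed simp
  also have "t powr 2 = t\<^sup>2" using assms by simp
  finally have "ennreal (t powr q) \<le> ennreal (t\<^sup>2)" by (rule ennreal_leI)
  then show ?thesis by (rule add_increasing2[rotated]) simp
next
  case False
  then obtain j where j: "2 ^ j < t" "t \<le> 2 ^ Suc j" using dyadic_level[of t] by auto
  have "ennreal (t powr q) \<le> ennreal ((2 ^ Suc j) powr q)"
    using j assms by (intro ennreal_leI powr_mono2) auto
  also have "\<dots> = ennreal ((2 ^ Suc j) powr q) * indicator {x. 2 ^ j < x} t" using j by simp
  also have "\<dots> \<le> (\<Sum>j. ennreal ((2 ^ Suc j) powr q) * indicator {x. 2 ^ j < x} t)"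
    by (rule ennreal_le_suminf)
  finally show ?thesis by (rule add_increasing[rotated]) simp
qed

text \<open>
  Chebyshev's inequality for \<open>w\<close>, which is at least half of the level wherever \<open>u\<close> exceeds it.
\<close>

lemma level_set_le:
  fixes u :: "'a::euclidean_space \<Rightarrow> complex"
  assumes u: "u \<in> borel_measurable borel" and w: "w \<in> L2" and m: "m > 0"
    and close: "\<And>x. m < cmod (u x) \<Longrightarrow> m / 2 \<le> cmod (w x)"
  shows "emeasure lborel {x. m < cmod (u x)} \<le> ennreal (4 / m\<^sup>2 * l2sq w)"
proof -
  note [measurable] = u L2_measurable[OF w]
  let ?E = "{x. m < cmod (u x)}"
  have E: "?E \<in> sets borel" by measurable
  have int: "integrable lborel (\<lambda>x. 4 / m\<^sup>2 * (cmod (w x))\<^sup>2)"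
    by (intro integrable_mult_right L2_integrable_sq w)
  have "emeasure lborel ?E = (\<integral>\<^sup>+x. indicator ?E x \<partial>lborel)" using E by simp
  also have "\<dots> \<le> (\<integral>\<^sup>+x. ennreal (4 / m\<^sup>2 * (cmod (w x))\<^sup>2) \<partial>lborel)"
  proof (rule nn_integral_mono)
    fix x
    show "indicator ?E x \<le> ennreal (4 / m\<^sup>2 * (cmod (w x))\<^sup>2)"
    proof (cases "x \<in> ?E")
      case True
      then have "(m / 2)\<^sup>2 \<le> (cmod (w x))\<^sup>2" using close[of x] m by (intro power_mono) auto
      then have "1 \<le> 4 / m\<^sup>2 * (cmod (w x))\<^sup>2" using m by (simp add: field_simps power2_eq_square)
      then have "ennreal 1 \<le> ennreal (4 / m\<^sup>2 * (cmod (w x))\<^sup>2)" by (rule ennreal_leI)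
      then show ?thesis using True by (simp only: indicator_simps if_True ennreal_1)
    qed simp
  qed
  also have "\<dots> = ennreal (LINT x|lborel. 4 / m\<^sup>2 * (cmod (w x))\<^sup>2)"
    by (rule nn_integral_eq_integral[OF int]) simp
  also have "(LINT x|lborel. 4 / m\<^sup>2 * (cmod (w x))\<^sup>2) = 4 / m\<^sup>2 * l2sq w"
    unfolding l2sq_def by (rule integral_mult_right_zero)
  finally show ?thesis .
qed

text \<open>
  On the set \<open>{\<bar>u\<bar> > 2\<^sup>j}\<close> choose the radius \<open>h\<close> with volume of the ball proportional to \<open>2 powr (- j p)\<close>. The bound in
  \<open>L\<^sup>p\<close> keeps the average of \<open>u\<close> below half of the level, so Chebyshev's inequality and \<open>avg_error_le\<close> bound the measure of
  the set by a multiple of \<open>h\<^sup>4\<close> times \<open>2 powr (- 2 j)\<close>, that is of \<open>2 powr (- j (2 + 4p/N))\<close>. Summing over levels controls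
  every exponent \<open>q < 2 + 4p/N\<close>.
\<close>

lemma sobolev_step:
  fixes c p q C :: real
  defines "N \<equiv> real DIM('a::euclidean_space)"
  assumes c: "c > 0" and S: "sobolev_bound TYPE('a) c p C" and C: "C \<ge> 0" and p: "p \<ge> 1"
    and q: "q \<ge> 2" "q < 2 + 4 * p / N"
  obtains C' where "C' \<ge> 0" "sobolev_bound TYPE('a) c q C'"
proof -
  define D where "D = N ^ 4 * (2 + 2 / c)"
  define \<kappa> where "\<kappa> = unit_ball_vol N"
  have N: "N > 0" by (simp add: N_def)
  have \<kappa>: "\<kappa> > 0" unfolding \<kappa>_def using N by simp
  have D: "D \<ge> 0" using c N by (simp add: D_def)
  \<comment> \<open>A quarter of the level: \<open>avg_powr_le\<close> with this \<open>a\<close> bounds the average by \<open>2 a\<close>, half of the level.\<close>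
  define a where "a j = (2::real) ^ j / 4" for j :: nat
  have a: "a j > 0" for j by (simp add: a_def)
  define V where "V j = (C + 1) * a j powr (- p)" for j
  have V: "V j > 0" for j using C a[of j] by (simp add: V_def)
  \<comment> \<open>The radius of the ball of volume \<open>V j\<close>.\<close>
  define h where "h j = (V j / \<kappa>) powr (1 / N)" for j
  have h: "h j > 0" for j using V[of j] \<kappa> by (simp add: h_def)
  have ball_vol_h: "ball_vol TYPE('a) (h j) = V j" for j
  proof -
    have "h j ^ DIM('a) = h j powr N" using h[of j] by (simp add: N_def powr_realpow)
    also have "\<dots> = V j / \<kappa>" using N V[of j] \<kappa> by (simp add: h_def powr_powr)
    finally show ?thesis using h[of j] \<kappa> by (simp add: ball_vol_eq N_def[symmetric] \<kappa>_def[symmetric])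
  qed
  define r where "r = 2 powr (q - 2 - 4 * p / N)"
  have r: "0 < r" "r < 1" using q(2) by (auto simp: r_def powr_less_one)
  define B where "B = 2 powr q * (4 * (D * ((C + 1) * 4 powr p / \<kappa>) powr (4 / N)))"
  have B: "B \<ge> 0" using D by (simp add: B_def)
  have term_eq: "(2 ^ Suc j) powr q * (4 / (2 ^ j)\<^sup>2 * (D * h j ^ 4)) = B * r ^ j" for j
  proof -
    define y where "y = (2::real) ^ j"
    have y: "y > 0" by (simp add: y_def)
    have h4: "h j ^ 4 = ((C + 1) * 4 powr p / \<kappa>) powr (4 / N) * y powr (- (4 * p / N))"
    proof -
      have "h j ^ 4 = h j powr 4" using h[of j] by simp
      also have "\<dots> = (V j / \<kappa>) powr (4 / N)" by (simp add: h_def powr_powr)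
      also have "V j / \<kappa> = ((C + 1) * 4 powr p / \<kappa>) * y powr (- p)"
        using y by (simp add: V_def a_def y_def[symmetric] powr_divide powr_minus field_simps)
      also have "(((C + 1) * 4 powr p / \<kappa>) * y powr (- p)) powr (4 / N)
          = ((C + 1) * 4 powr p / \<kappa>) powr (4 / N) * y powr (- (4 * p / N))"
        using C \<kappa> y by (subst powr_mult) (auto simp: powr_powr field_simps)
      finally show ?thesis .
    qed
    have r_pow: "r ^ j = y powr (q - 2 - 4 * p / N)"
    proof -
      have "r ^ j = r powr real j" using r by (simp add: powr_realpow)
      also have "\<dots> = (2 powr real j) powr (q - 2 - 4 * p / N)" by (simp add: r_def powr_powr mult.commute)
      finally show ?thesis by (simp add: y_def powr_realpow)
    qed
    have "(2 ^ Suc j) powr q = 2 powr q * y powr q" by (simp add: y_def powr_mult)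
    moreover have "y powr (q - 2 - 4 * p / N) = y powr q * y powr (- (4 * p / N)) / y\<^sup>2"
    proof -
      have "y powr (q - 2 - 4 * p / N) = y powr (q + - (4 * p / N) - 2)" by (simp add: algebra_simps)
      also have "\<dots> = y powr (q + - (4 * p / N)) / y powr 2" by (rule powr_diff)
      also have "\<dots> = y powr q * y powr (- (4 * p / N)) / y\<^sup>2" using y by (subst powr_add) simp
      finally show ?thesis .
    qed
    ultimately show ?thesis
      unfolding h4 r_pow B_def y_def[symmetric] by (simp add: mult_ac)
  qed
  define C' where "C' = 1 / c + B * (1 / (1 - r))"
  have C'0: "C' \<ge> 0" unfolding C'_def using c B r by (intro add_nonneg_nonneg mult_nonneg_nonneg) auto
  have "sobolev_bound TYPE('a) c q C'"
    unfolding sobolev_bound_def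
  proof (intro allI impI)
    fix u :: "'a \<Rightarrow> complex" assume u: "u \<in> H2" and T1: "T_fun c u \<le> 1"
    have uL: "u \<in> L2" by (rule H2_L2[OF u])
    note [measurable] = L2_measurable[OF uL]
    have Lp: "integrable lborel (\<lambda>x. cmod (u x) powr p)" "(LINT x|lborel. cmod (u x) powr p) \<le> C"
      using S u T1 by (auto simp: sobolev_bound_def)
    have E: "emeasure lborel {x. 2 ^ j < cmod (u x)} \<le> ennreal (4 / (2 ^ j)\<^sup>2 * (D * h j ^ 4))" for j :: nat
    proof -
      have avg_small: "cmod (avg (h j) u x) \<le> 2 ^ j / 2" for x
      proof -
        have "cmod (avg (h j) u x) \<le> a j + a j powr (1 - p) * C / V j"
          using avg_powr_le[OF uL h p a Lp] by (simp add: ball_vol_h)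
        also have "a j powr (1 - p) * C / V j = a j * (C / (C + 1))"
        proof -
          have "a j powr (1 - p) = a j * a j powr (- p)"
            using a[of j] by (simp add: powr_diff powr_minus_divide)
          then show ?thesis using a[of j] by (simp add: V_def)
        qed
        also have "a j * (C / (C + 1)) \<le> a j * 1" using a[of j] C by (intro mult_left_mono) auto
        finally show ?thesis by (simp add: a_def)
      qed
      have "emeasure lborel {x. 2 ^ j < cmod (u x)} \<le> ennreal (4 / (2 ^ j)\<^sup>2 * l2sq (\<lambda>x. u x - avg (h j) u x))"
      proof (rule level_set_le)
        show "(\<lambda>x. u x - avg (h j) u x) \<in> L2" by (rule avg_error_le(1)[OF c u h])
        fix x assume "2 ^ j < cmod (u x)"
        then show "2 ^ j / 2 \<le> cmod (u x - avg (h j) u x)"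
          using avg_small[of x] norm_triangle_ineq2[of "u x" "avg (h j) u x"] by linarith
      qed auto
      also have "\<dots> \<le> ennreal (4 / (2 ^ j)\<^sup>2 * (D * h j ^ 4))"
      proof (intro ennreal_leI mult_left_mono)
        have "l2sq (\<lambda>x. u x - avg (h j) u x) \<le> D * h j ^ 4 * T_fun c u"
          using avg_error_le(2)[OF c u h, of j] by (simp add: D_def N_def)
        also have "\<dots> \<le> D * h j ^ 4 * 1" using D h[of j] T1 by (intro mult_left_mono) auto
        finally show "l2sq (\<lambda>x. u x - avg (h j) u x) \<le> D * h j ^ 4" by simp
      qed auto
      finally show ?thesis .
    qed
    have sq: "(\<integral>\<^sup>+x. ennreal ((cmod (u x))\<^sup>2) \<partial>lborel) \<le> ennreal (1 / c)"
    proof -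
      have "(\<integral>\<^sup>+x. ennreal ((cmod (u x))\<^sup>2) \<partial>lborel) = ennreal (l2sq u)"
        unfolding l2sq_def by (rule nn_integral_eq_integral[OF L2_integrable_sq[OF uL]]) simp
      also have "\<dots> \<le> ennreal (1 / c)"
        using l2sq_le_T_fun[OF c u] T1 c by (intro ennreal_leI) (simp add: field_simps)
      finally show ?thesis .
    qed
    have "(\<integral>\<^sup>+x. (\<Sum>j. ennreal ((2 ^ Suc j) powr q) * indicator {x. 2 ^ j < cmod (u x)} x) \<partial>lborel)
        = (\<Sum>j. \<integral>\<^sup>+x. ennreal ((2 ^ Suc j) powr q) * indicator {x. 2 ^ j < cmod (u x)} x \<partial>lborel)"
      by (rule nn_integral_suminf) measurable
    also have "\<dots> = (\<Sum>j. ennreal ((2 ^ Suc j) powr q) * emeasure lborel {x. 2 ^ j < cmod (u x)})"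
      by (intro suminf_cong nn_integral_cmult_indicator) measurable
    also have "\<dots> \<le> (\<Sum>j. ennreal (B * r ^ j))"
    proof (intro suminf_le)
      fix j :: nat
      have "ennreal ((2 ^ Suc j) powr q) * emeasure lborel {x. 2 ^ j < cmod (u x)}
          \<le> ennreal ((2 ^ Suc j) powr q) * ennreal (4 / (2 ^ j)\<^sup>2 * (D * h j ^ 4))"
        by (intro mult_left_mono E) simp
      also have "\<dots> = ennreal ((2 ^ Suc j) powr q * (4 / (2 ^ j)\<^sup>2 * (D * h j ^ 4)))"
        by (rule ennreal_mult'[symmetric]) (use D in simp)
      finally show "ennreal ((2 ^ Suc j) powr q) * emeasure lborel {x. 2 ^ j < cmod (u x)} \<le> ennreal (B * r ^ j)"
        by (simp only: term_eq)
    qed auto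
    also have "\<dots> = ennreal (\<Sum>j. B * r ^ j)"
      using B r by (intro suminf_ennreal2 summable_mult summable_geometric) auto
    also have "(\<Sum>j. B * r ^ j) = B * (1 / (1 - r))"
      using r by (subst suminf_mult) (auto simp: suminf_geometric summable_geometric)
    finally have tail: "(\<integral>\<^sup>+x. (\<Sum>j. ennreal ((2 ^ Suc j) powr q) * indicator {x. 2 ^ j < cmod (u x)} x) \<partial>lborel)
        \<le> ennreal (B * (1 / (1 - r)))" .
    have "(\<integral>\<^sup>+x. ennreal (cmod (u x) powr q) \<partial>lborel)
        \<le> (\<integral>\<^sup>+x. ennreal ((cmod (u x))\<^sup>2) + (\<Sum>j. ennreal ((2 ^ Suc j) powr q) * indicator {x. 2 ^ j < cmod (u x)} x) \<partial>lborel)"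
    proof (rule nn_integral_mono)
      fix x
      have "indicator {x. 2 ^ j < x} (cmod (u x)) = (indicator {x. 2 ^ j < cmod (u x)} x :: ennreal)" for j :: nat
        by (auto simp: indicator_def)
      then show "ennreal (cmod (u x) powr q)
          \<le> ennreal ((cmod (u x))\<^sup>2) + (\<Sum>j. ennreal ((2 ^ Suc j) powr q) * indicator {x. 2 ^ j < cmod (u x)} x)"
        using powr_dyadic_le[OF norm_ge_zero q(1), of "u x"] by (simp only:)
    qed
    also have "\<dots> = (\<integral>\<^sup>+x. ennreal ((cmod (u x))\<^sup>2) \<partial>lborel)
        + (\<integral>\<^sup>+x. (\<Sum>j. ennreal ((2 ^ Suc j) powr q) * indicator {x. 2 ^ j < cmod (u x)} x) \<partial>lborel)"
      by (rule nn_integral_add) measurable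
    also have "\<dots> \<le> ennreal (1 / c) + ennreal (B * (1 / (1 - r)))"
      by (intro add_mono sq tail)
    also have "\<dots> = ennreal C'"
      unfolding C'_def using c B r by (intro ennreal_plus[symmetric]) auto
    finally show "integrable lborel (\<lambda>x. cmod (u x) powr q) \<and> (LINT x|lborel. cmod (u x) powr q) \<le> C'"
      using integrable_bound_from_nn[of "\<lambda>x. cmod (u x) powr q" lborel C'] C'0 by auto
  qed
  then show thesis using that C'0 by blast
qed

text \<open>
  Iterate \<open>sobolev_step\<close>, starting from \<open>p = 2\<close>. The map \<open>p \<mapsto> 2 + 4p/N\<close> has the critical exponent \<open>2N/(N - 4)\<close> as its fixed
  point when \<open>N > 4\<close>, and none that is positive otherwise; below a subcritical \<open>P\<close> its gain is bounded below, so finitely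
  many steps reach \<open>P\<close>.
\<close>

theorem sobolev_bound_exists:
  fixes c P :: real
  defines "N \<equiv> real DIM('a::euclidean_space)"
  assumes c: "c > 0" and P: "P \<ge> 2" "P * (N - 4) < 2 * N"
  obtains C where "C \<ge> 0" "sobolev_bound TYPE('a) c P C"
proof -
  have N: "N > 0" by (simp add: N_def)
  \<comment> \<open>A lower bound for the gain \<open>2 + 4 p / N - p\<close> on \<open>[0, P]\<close>; half of it is used in each step.\<close>
  define d where "d = min 2 (2 - P * (1 - 4 / N))"
  have d: "d > 0" using P(2) N by (simp add: d_def field_simps)
  have adv: "p + d \<le> 2 + 4 * p / N" if "0 \<le> p" "p \<le> P" for p
  proof -
    have "p * (1 - 4 / N) \<le> max 0 (P * (1 - 4 / N))"
    proof (cases "1 - 4 / N \<ge> 0")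
      case True
      then show ?thesis using that by (intro max.coboundedI2 mult_right_mono) auto
    next
      case False
      then show ?thesis using that by (intro max.coboundedI1) (simp add: mult_nonneg_nonpos)
    qed
    then show ?thesis by (simp add: d_def algebra_simps max_def min_def split: if_splits)
  qed
  have ex: "\<exists>C\<ge>0. sobolev_bound TYPE('a) c (min P (2 + real k * (d / 2))) C" for k
  proof (induction k)
    case 0
    show ?case using sobolev_bound_2[OF c, where ?'a='a] P c by (intro exI[of _ "1 / c"]) simp
  next
    case (Suc k)
    then obtain C where C: "C \<ge> 0" "sobolev_bound TYPE('a) c (min P (2 + real k * (d / 2))) C" by blast
    define p where "p = min P (2 + real k * (d / 2))"
    define q where "q = min P (2 + real (Suc k) * (d / 2))"
    have p: "p \<ge> 2" "p \<le> P" using P d by (auto simp: p_def)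
    have q: "q \<ge> 2" "q \<le> p + d / 2" using P d by (auto simp: q_def p_def field_simps min_def)
    have "q < 2 + 4 * p / N" using adv[of p] p q d by linarith
    then obtain C' where "C' \<ge> 0" "sobolev_bound TYPE('a) c q C'"
      using sobolev_step[OF c, of p C q, where ?'a='a] C p q unfolding N_def p_def by auto
    then show ?case unfolding q_def by blast
  qed
  obtain k :: nat where "P / (d / 2) \<le> real k" using real_arch_simple by blast
  then have "min P (2 + real k * (d / 2)) = P" using d by (simp add: field_simps)
  then show thesis using ex[of k] that by auto
qed

theorem sobolev_inequality:
  fixes c P :: real
  defines "N \<equiv> real DIM('a::euclidean_space)"
  assumes c: "c > 0" and P: "P \<ge> 2" "P * (N - 4) < 2 * N"
  obtains C where "C > 0"
    "\<And>u::'a \<Rightarrow> complex. u \<in> H2 \<Longrightarrow> integrable lborel (\<lambda>x. cmod (u x) powr P)"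
    "\<And>u::'a \<Rightarrow> complex. u \<in> H2 \<Longrightarrow> (LINT x|lborel. cmod (u x) powr P) \<le> C * T_fun c u powr (P / 2)"
proof -
  obtain C where C: "C \<ge> 0" "sobolev_bound TYPE('a) c P C"
    using sobolev_bound_exists[OF c, of P, where ?'a='a] P unfolding N_def by blast
  have main: "integrable lborel (\<lambda>x. cmod (u x) powr P) \<and>
      (LINT x|lborel. cmod (u x) powr P) \<le> (C + 1) * T_fun c u powr (P / 2)" if u: "u \<in> H2" for u :: "'a \<Rightarrow> complex"
  proof (cases "T_fun c u = 0")
    case True
    then have "l2sq u = 0" using l2sq_le_T_fun[OF c u] l2sq_nonneg[of u] by simp
    then have "AE x in lborel. u x = 0" by (rule l2sq_zero_imp_AE[OF H2_L2[OF u]])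
    then have AE0: "AE x in lborel. cmod (u x) powr P = 0" by eventually_elim simp
    have meas: "(\<lambda>x. cmod (u x) powr P) \<in> borel_measurable lborel"
      using H2_measurable[OF u] by measurable
    have "integrable lborel (\<lambda>x. cmod (u x) powr P) = integrable lborel (\<lambda>x::'a. 0::real)"
      by (rule integrable_cong_AE[OF meas _ AE0]) simp
    moreover have "(LINT x|lborel. cmod (u x) powr P) = 0" by (rule integral_eq_zero_AE[OF AE0])
    ultimately show ?thesis using C by simp
  next
    case False
    define t where "t = T_fun c u"
    have t: "t > 0" using False T_fun_nonneg[OF c u] by (simp add: t_def)
    define a where "a = complex_of_real (1 / sqrt t)"
    have na: "cmod a = 1 / sqrt t" using t by (simp add: a_def norm_divide)
    have "T_fun c (\<lambda>x. a * u x) \<le> 1"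
      unfolding T_fun_cmult[OF u] na using t by (simp add: t_def[symmetric] power_divide)
    then have 1: "integrable lborel (\<lambda>x. cmod (a * u x) powr P)" "(LINT x|lborel. cmod (a * u x) powr P) \<le> C"
      using C(2) H2_cmult[OF u, of a] by (auto simp: sobolev_bound_def)
    have s: "(1 / sqrt t) powr P = 1 / t powr (P / 2)"
      using t by (simp add: powr_divide powr_half_sqrt[symmetric] powr_powr)
    have eq: "cmod (a * u x) powr P = 1 / t powr (P / 2) * cmod (u x) powr P" for x
      unfolding norm_mult na using t by (subst powr_mult) (auto simp: s)
    have t': "t powr (P / 2) > 0" using t by simp
    have int: "integrable lborel (\<lambda>x. cmod (u x) powr P)"
      using integrable_mult_right[OF 1(1)[unfolded eq], of "t powr (P / 2)"] t' by simp
    have "1 / t powr (P / 2) * (LINT x|lborel. cmod (u x) powr P) \<le> C" using 1(2) unfolding eq by simp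
    then have "(LINT x|lborel. cmod (u x) powr P) \<le> C * t powr (P / 2)" using t' by (simp add: field_simps)
    also have "\<dots> \<le> (C + 1) * t powr (P / 2)" using t' by (intro mult_right_mono) auto
    finally show ?thesis using int by (simp add: t_def)
  qed
  show thesis by (rule that[of "C + 1"]) (use main C in auto)
qed

text \<open>
  Where \<open>\<bar>u\<bar> \<le> 2\<delta>\<close> the integrand is at most \<open>(2\<delta>) powr (p - 2)\<close> times \<open>\<bar>u\<bar>\<^sup>2\<close>. Elsewhere \<open>\<bar>u\<bar>\<close> is at most twice the distance to
  the average, which is small in \<open>L\<^sup>2\<close> for small radius; this settles the values up to \<open>M\<close>, and values above \<open>M\<close> are
  controlled by a higher subcritical exponent \<open>q\<close>. The constants are chosen in the order \<open>M\<close>, radius, \<open>\<delta>\<close>.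
\<close>

theorem small_averages_imp_small_norm:
  fixes c p R :: real
  defines "N \<equiv> real DIM('a::euclidean_space)"
  assumes c: "c > 0" and p: "p > 2" "p * (N - 4) < 2 * N" and R: "R \<ge> 0"
  obtains n :: nat and \<delta> :: real where "\<delta> > 0"
    "\<And>u::'a \<Rightarrow> complex. u \<in> H2 \<Longrightarrow> T_fun c u \<le> R \<Longrightarrow> (\<And>x. cmod (avg (1 / real (Suc n)) u x) \<le> \<delta>)
       \<Longrightarrow> (LINT x|lborel. cmod (u x) powr p) \<le> 1 / 2"
proof -
  have N: "N > 0" by (simp add: N_def)
  obtain q where q: "q > p" "q * (N - 4) < 2 * N"
  proof (cases "N \<le> 4")
    case True
    then have "(p + 1) * (N - 4) \<le> 0" using p by (intro mult_nonneg_nonpos) auto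
    then show thesis using that[of "p + 1"] N by linarith
  next
    case False
    then have "p < 2 * N / (N - 4)" using p by (simp add: field_simps)
    then obtain q where "p < q" "q < 2 * N / (N - 4)" using dense by blast
    then show thesis using that[of q] False by (simp add: field_simps)
  qed
  obtain C where C: "C > 0" "\<And>u::'a \<Rightarrow> complex. u \<in> H2 \<Longrightarrow> integrable lborel (\<lambda>x. cmod (u x) powr q)"
    "\<And>u::'a \<Rightarrow> complex. u \<in> H2 \<Longrightarrow> (LINT x|lborel. cmod (u x) powr q) \<le> C * T_fun c u powr (q / 2)"
    using sobolev_inequality[OF c, of q, where ?'a='a] q p unfolding N_def by auto
  define D where "D = N ^ 4 * (2 + 2 / c)"
  have D: "D \<ge> 0" using c N by (simp add: D_def)
  obtain M where M: "M > 0" "M powr (p - q) * (C * R powr (q / 2)) < 1 / 6"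
  proof -
    have "((\<lambda>M::real. M powr (p - q) * (C * R powr (q / 2))) \<longlongrightarrow> 0 * (C * R powr (q / 2))) at_top"
      using q by (intro tendsto_mult tendsto_const tendsto_neg_powr filterlim_ident) auto
    then have "\<forall>\<^sub>F M::real in at_top. M powr (p - q) * (C * R powr (q / 2)) < 1 / 6"
      by (rule order_tendstoD(2)) simp
    then have "\<forall>\<^sub>F M::real in at_top. M > 0 \<and> M powr (p - q) * (C * R powr (q / 2)) < 1 / 6"
      using eventually_gt_at_top[of "0::real"] by eventually_elim simp
    then show thesis using that eventually_happens'[OF trivial_limit_at_top_linorder] by blast
  qed
  obtain n :: nat where n: "4 * M powr (p - 2) * (D * (1 / real (Suc n)) ^ 4 * R) < 1 / 6"
  proof -
    have "(\<lambda>n. 4 * M powr (p - 2) * (D * (inverse (real (Suc n))) ^ 4 * R)) \<longlonglongrightarrow> 4 * M powr (p - 2) * (D * 0 ^ 4 * R)"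
      by (intro tendsto_intros LIMSEQ_inverse_real_of_nat)
    then have "\<forall>\<^sub>F n in sequentially. 4 * M powr (p - 2) * (D * (inverse (real (Suc n))) ^ 4 * R) < 1 / 6"
      by (rule order_tendstoD(2)) simp
    then show thesis using that eventually_happens'[OF sequentially_bot] by (auto simp: inverse_eq_divide)
  qed
  obtain \<delta> where \<delta>: "\<delta> > 0" "(2 * \<delta>) powr (p - 2) * (R / c) < 1 / 6"
  proof -
    have "((\<lambda>\<delta>::real. (2 * \<delta>) powr (p - 2) * (R / c)) \<longlongrightarrow> (2 * 0) powr (p - 2) * (R / c)) (at_right 0)"
      using p by (intro tendsto_mult tendsto_powr' tendsto_const tendsto_ident_at)
        (auto simp: eventually_at_filter)
    then have "\<forall>\<^sub>F \<delta>::real in at_right 0. (2 * \<delta>) powr (p - 2) * (R / c) < 1 / 6"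
      by (rule order_tendstoD(2)) (use p in simp)
    then have "\<forall>\<^sub>F \<delta>::real in at_right 0. \<delta> > 0 \<and> (2 * \<delta>) powr (p - 2) * (R / c) < 1 / 6"
      using eventually_at_right_less[of "0::real"] by eventually_elim simp
    then show thesis using that eventually_happens'[OF trivial_limit_at_right_real] by blast
  qed
  define h where "h = 1 / real (Suc n)"
  have h: "h > 0" by (simp add: h_def)
  have main: "(LINT x|lborel. cmod (u x) powr p) \<le> 1 / 2"
    if u: "u \<in> H2" and T: "T_fun c u \<le> R" and small: "\<And>x. cmod (avg h u x) \<le> \<delta>" for u :: "'a \<Rightarrow> complex"
  proof -
    note T0 = T_fun_nonneg[OF c u]
    define w where "w x = u x - avg h u x" for x
    have wL: "w \<in> L2" unfolding w_def[abs_def] by (rule avg_error_le(1)[OF c u h])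
    have pt: "cmod (u x) powr p \<le> (2 * \<delta>) powr (p - 2) * (cmod (u x))\<^sup>2
        + 4 * M powr (p - 2) * (cmod (w x))\<^sup>2 + M powr (p - q) * cmod (u x) powr q" for x
    proof -
      define s where "s = cmod (u x)"
      have nn: "0 \<le> (2 * \<delta>) powr (p - 2) * s\<^sup>2" "0 \<le> 4 * M powr (p - 2) * (cmod (w x))\<^sup>2"
        "0 \<le> M powr (p - q) * s powr q" by auto
      have "s powr p \<le> (2 * \<delta>) powr (p - 2) * s\<^sup>2 + 4 * M powr (p - 2) * (cmod (w x))\<^sup>2 + M powr (p - q) * s powr q"
      proof (cases "s = 0")
        case False
        then have s: "s > 0" by (simp add: s_def)
        have split2: "s powr p = s powr (p - 2) * s\<^sup>2"
        proof -
          have "s powr p = s powr ((p - 2) + 2)" by simp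
          also have "\<dots> = s powr (p - 2) * s powr 2" by (rule powr_add)
          finally show ?thesis using s by simp
        qed
        consider "s \<le> 2 * \<delta>" | "s > 2 * \<delta>" "s \<le> M" | "s > M" by linarith
        then show ?thesis
        proof cases
          case 1
          then have "s powr (p - 2) * s\<^sup>2 \<le> (2 * \<delta>) powr (p - 2) * s\<^sup>2"
            using s p by (intro mult_right_mono powr_mono2) auto
          then show ?thesis using nn split2 by linarith
        next
          case 2
          have "s \<le> 2 * cmod (w x)"
            using 2 small[of x] norm_triangle_ineq2[of "u x" "avg h u x"] by (simp add: s_def w_def)
          then have "s\<^sup>2 \<le> (2 * cmod (w x))\<^sup>2" using s by (intro power_mono) auto
          then have "s powr (p - 2) * s\<^sup>2 \<le> M powr (p - 2) * (2 * cmod (w x))\<^sup>2"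
            using s p 2 by (intro mult_mono powr_mono2) auto
          then have "s powr p \<le> 4 * M powr (p - 2) * (cmod (w x))\<^sup>2"
            using split2 by (simp add: power_mult_distrib)
          then show ?thesis using nn by linarith
        next
          case 3
          have "s powr p = s powr (p - q) * s powr q" using s by (simp flip: powr_add)
          also have "\<dots> \<le> M powr (p - q) * s powr q"
            using 3 M q by (intro mult_right_mono powr_mono2') auto
          finally show ?thesis using nn by linarith
        qed
      qed (use nn in simp)
      then show ?thesis by (simp add: s_def)
    qed
    have int: "integrable lborel (\<lambda>x. (2 * \<delta>) powr (p - 2) * (cmod (u x))\<^sup>2)"
      "integrable lborel (\<lambda>x. 4 * M powr (p - 2) * (cmod (w x))\<^sup>2)"
      "integrable lborel (\<lambda>x. M powr (p - q) * cmod (u x) powr q)"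
      by (intro integrable_mult_right L2_integrable_sq wL H2_L2 u C(2))+
    have "(LINT x|lborel. cmod (u x) powr p) \<le> (LINT x|lborel. (2 * \<delta>) powr (p - 2) * (cmod (u x))\<^sup>2
        + 4 * M powr (p - 2) * (cmod (w x))\<^sup>2 + M powr (p - q) * cmod (u x) powr q)"
    proof (rule integral_mono'[OF _ pt])
      show "integrable lborel (\<lambda>x. (2 * \<delta>) powr (p - 2) * (cmod (u x))\<^sup>2
        + 4 * M powr (p - 2) * (cmod (w x))\<^sup>2 + M powr (p - q) * cmod (u x) powr q)"
        using int by (intro Bochner_Integration.integrable_add)
    qed simp
    also have "\<dots> = (2 * \<delta>) powr (p - 2) * l2sq u + 4 * M powr (p - 2) * l2sq w
        + M powr (p - q) * (LINT x|lborel. cmod (u x) powr q)"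
      using int by (simp add: l2sq_def)
    also have "\<dots> \<le> (2 * \<delta>) powr (p - 2) * (R / c) + 4 * M powr (p - 2) * (D * h ^ 4 * R)
        + M powr (p - q) * (C * R powr (q / 2))"
    proof (intro add_mono mult_left_mono)
      show "l2sq u \<le> R / c" using l2sq_le_T_fun[OF c u] T c by (simp add: field_simps)
      have "l2sq w \<le> D * h ^ 4 * T_fun c u"
        using avg_error_le(2)[OF c u h] by (simp add: w_def[abs_def] D_def N_def)
      also have "\<dots> \<le> D * h ^ 4 * R" using D h T by (intro mult_left_mono) auto
      finally show "l2sq w \<le> D * h ^ 4 * R" .
      have "(LINT x|lborel. cmod (u x) powr q) \<le> C * T_fun c u powr (q / 2)" by (rule C(3)[OF u])
      also have "\<dots> \<le> C * R powr (q / 2)" using C T T0 p q by (intro mult_left_mono powr_mono2) auto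
      finally show "(LINT x|lborel. cmod (u x) powr q) \<le> C * R powr (q / 2)" .
    qed auto
    also have "\<dots> \<le> 1 / 2" using M(2) n \<delta>(2) unfolding h_def by linarith
    finally show ?thesis .
  qed
  show thesis by (rule that[OF \<delta>(1), of n]) (rule main, auto simp: h_def)
qed

section \<open>Splitting of mass and strong limits of midpoints\<close>

text \<open>
  If \<open>b\<close> is at most a small multiple \<open>\<eta>\<close> of \<open>a\<close>, continuity of the power at \<open>1\<close> suffices; otherwise \<open>a\<close> is at most a multiple of
  \<open>b\<close>.
\<close>

lemma powr_perturbation:
  fixes p e :: real
  assumes p: "p > 0" and e: "e > 0"
  obtains C where "C \<ge> 0"
    "\<And>a b :: complex. \<bar>cmod (a + b) powr p - cmod a powr p\<bar> \<le> e * cmod a powr p + C * cmod b powr p"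
proof -
  have "((\<lambda>\<eta>::real. (1 + \<eta>) powr p) \<longlongrightarrow> (1 + 0) powr p) (at_right 0)"
    by (intro tendsto_intros) auto
  then have "\<forall>\<^sub>F \<eta>::real in at_right 0. (1 + \<eta>) powr p < 1 + e"
    by (rule order_tendstoD(2)) (use e in simp)
  moreover have "((\<lambda>\<eta>::real. (1 - \<eta>) powr p) \<longlongrightarrow> (1 - 0) powr p) (at_right 0)"
    by (intro tendsto_intros) auto
  then have "\<forall>\<^sub>F \<eta>::real in at_right 0. 1 - e < (1 - \<eta>) powr p"
    by (rule order_tendstoD(1)) (use e in simp)
  moreover have "\<forall>\<^sub>F \<eta>::real in at_right 0. \<eta> < 1"
    by (rule order_tendstoD(2)[OF tendsto_ident_at]) simp
  moreover have "\<forall>\<^sub>F \<eta>::real in at_right 0. 0 < \<eta>"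
    by (rule eventually_at_right_less)
  ultimately have "\<forall>\<^sub>F \<eta>::real in at_right 0. 0 < \<eta> \<and> \<eta> < 1 \<and> (1 + \<eta>) powr p < 1 + e \<and> 1 - e < (1 - \<eta>) powr p"
    by eventually_elim simp
  then obtain \<eta> :: real where \<eta>: "0 < \<eta>" "\<eta> < 1" "(1 + \<eta>) powr p < 1 + e" "1 - e < (1 - \<eta>) powr p"
    using eventually_happens'[OF trivial_limit_at_right_real] by blast
  define C where "C = (1 + 1 / \<eta>) powr p + (1 / \<eta>) powr p"
  have main: "\<bar>cmod (a + b) powr p - cmod a powr p\<bar> \<le> e * cmod a powr p + C * cmod b powr p" for a b :: complex
  proof (cases "cmod b \<le> \<eta> * cmod a")
    case True
    have ub: "cmod (a + b) \<le> (1 + \<eta>) * cmod a"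
      using norm_triangle_ineq[of a b] True by (simp add: algebra_simps)
    have lb: "(1 - \<eta>) * cmod a \<le> cmod (a + b)"
      using norm_triangle_ineq2[of a "- b"] True by (simp add: algebra_simps)
    have "cmod (a + b) powr p \<le> (1 + \<eta>) powr p * cmod a powr p"
      using powr_mono2[OF _ _ ub, of p] p \<eta> by (simp add: powr_mult)
    also have "\<dots> \<le> (1 + e) * cmod a powr p" using \<eta> by (intro mult_right_mono) auto
    finally have 1: "cmod (a + b) powr p \<le> (1 + e) * cmod a powr p" .
    have "(1 - e) * cmod a powr p \<le> (1 - \<eta>) powr p * cmod a powr p" using \<eta> by (intro mult_right_mono) auto
    also have "\<dots> \<le> cmod (a + b) powr p"
      using powr_mono2[OF _ _ lb, of p] p \<eta> by (simp add: powr_mult)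
    finally have 2: "(1 - e) * cmod a powr p \<le> cmod (a + b) powr p" .
    have "\<bar>cmod (a + b) powr p - cmod a powr p\<bar> \<le> e * cmod a powr p"
      using 1 2 by (simp add: abs_le_iff algebra_simps)
    moreover have "0 \<le> C * cmod b powr p" by (simp add: C_def)
    ultimately show ?thesis by linarith
  next
    case False
    then have a: "cmod a \<le> 1 / \<eta> * cmod b" using \<eta> by (simp add: field_simps)
    have ab: "cmod (a + b) \<le> (1 + 1 / \<eta>) * cmod b"
      using norm_triangle_ineq[of a b] a by (simp add: algebra_simps)
    have "cmod a powr p \<le> (1 / \<eta>) powr p * cmod b powr p"
      using powr_mono2[OF _ _ a, of p] p \<eta> by (simp add: powr_mult powr_divide)
    moreover have "cmod (a + b) powr p \<le> (1 + 1 / \<eta>) powr p * cmod b powr p"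
      using powr_mono2[OF _ _ ab, of p] p \<eta> by (subst powr_mult[symmetric]) auto
    ultimately have "cmod (a + b) powr p + cmod a powr p \<le> C * cmod b powr p"
      by (simp add: C_def distrib_right)
    moreover have "\<bar>cmod (a + b) powr p - cmod a powr p\<bar> \<le> cmod (a + b) powr p + cmod a powr p"
      using powr_ge_zero[of "cmod (a + b)" p] powr_ge_zero[of "cmod a" p] by linarith
    moreover have "0 \<le> e * cmod a powr p" using e by simp
    ultimately show ?thesis by linarith
  qed
  show thesis by (rule that[of C]) (use main in \<open>auto simp: C_def\<close>)
qed

text \<open>
  By \<open>powr_perturbation\<close> the defect \<open>D\<close> of the splitting is at most \<open>e\<bar>f\<^sub>n - g\<bar>\<^sup>p\<close> plus an integrable function. The part \<open>W\<close> of
  the defect above \<open>e\<bar>f\<^sub>n - g\<bar>\<^sup>p\<close> is therefore dominated and tends to zero in the mean, and the rest is at most \<open>e K\<close>.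
\<close>

theorem brezis_lieb:
  fixes f :: "nat \<Rightarrow> 'b \<Rightarrow> complex"
  assumes p: "p > 0"
    and meas: "\<And>n. f n \<in> borel_measurable M" "g \<in> borel_measurable M"
    and lim: "AE x in M. (\<lambda>n. f n x) \<longlonglongrightarrow> g x"
    and int: "\<And>n. integrable M (\<lambda>x. cmod (f n x) powr p)" "integrable M (\<lambda>x. cmod (g x) powr p)"
      "\<And>n. integrable M (\<lambda>x. cmod (f n x - g x) powr p)"
    and bound: "\<And>n. (LINT x|M. cmod (f n x - g x) powr p) \<le> K"
  shows "(\<lambda>n. (LINT x|M. cmod (f n x) powr p) - (LINT x|M. cmod (f n x - g x) powr p))
    \<longlonglongrightarrow> (LINT x|M. cmod (g x) powr p)"
proof (rule LIMSEQ_I)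
  note [measurable] = meas
  fix r :: real assume r: "r > 0"
  have "0 \<le> (LINT x|M. cmod (f 0 x - g x) powr p)" by (intro integral_nonneg_AE) simp
  then have K: "K \<ge> 0" using bound[of 0] by linarith
  define e where "e = r / (2 * (K + 1))"
  have e: "e > 0" "e * K < r / 2"
    using r K by (auto simp: e_def field_simps)
  obtain C where C: "C \<ge> 0" "\<And>a b :: complex. \<bar>cmod (a + b) powr p - cmod a powr p\<bar> \<le> e * cmod a powr p + C * cmod b powr p"
    using powr_perturbation[OF p e(1)] by metis
  define D where "D n x = cmod (f n x) powr p - cmod (f n x - g x) powr p - cmod (g x) powr p" for n x
  define W where "W n x = max 0 (\<bar>D n x\<bar> - e * cmod (f n x - g x) powr p)" for n x
  have D_int: "integrable M (D n)" for n
    unfolding D_def[abs_def] by (intro Bochner_Integration.integrable_diff int)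
  have W_le: "W n x \<le> (C + 1) * cmod (g x) powr p" for n x
  proof -
    have "\<bar>cmod (f n x) powr p - cmod (f n x - g x) powr p\<bar> \<le> e * cmod (f n x - g x) powr p + C * cmod (g x) powr p"
      using C(2)[of "f n x - g x" "g x"] by simp
    moreover have "0 \<le> cmod (g x) powr p" by simp
    ultimately have "\<bar>D n x\<bar> - e * cmod (f n x - g x) powr p \<le> (C + 1) * cmod (g x) powr p"
      unfolding D_def by (simp only: distrib_right mult_1)
    moreover have "0 \<le> (C + 1) * cmod (g x) powr p" using C by simp
    ultimately show ?thesis unfolding W_def by simp
  qed
  have "(\<lambda>n. LINT x|M. W n x) \<longlonglongrightarrow> (LINT x|M. 0)"
  proof (rule integral_dominated_convergence)
    show "integrable M (\<lambda>x. (C + 1) * cmod (g x) powr p)" by (intro integrable_mult_right int)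
    show "AE x in M. (\<lambda>n. W n x) \<longlonglongrightarrow> 0"
      using lim
    proof eventually_elim
      case (elim x)
      have "(\<lambda>n. cmod (f n x - g x)) \<longlonglongrightarrow> cmod (g x - g x)" by (intro tendsto_intros elim)
      then have 1: "(\<lambda>n. cmod (f n x - g x) powr p) \<longlonglongrightarrow> 0 powr p"
        using p by (intro tendsto_powr') auto
      have 2: "(\<lambda>n. cmod (f n x) powr p) \<longlonglongrightarrow> cmod (g x) powr p"
        using p by (intro tendsto_powr' tendsto_norm elim) auto
      have "(\<lambda>n. W n x) \<longlonglongrightarrow> max 0 (\<bar>cmod (g x) powr p - 0 powr p - cmod (g x) powr p\<bar> - e * 0 powr p)"
        unfolding W_def D_def by (intro tendsto_intros 1 2)
      then show ?case by simp
    qed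
    show "AE x in M. norm (W n x) \<le> (C + 1) * cmod (g x) powr p" for n
      using W_le[of n] by (intro AE_I2) (auto simp: W_def)
    show "W n \<in> borel_measurable M" for n unfolding W_def D_def by measurable
  qed simp
  then have "\<forall>\<^sub>F n in sequentially. (LINT x|M. W n x) < r / 2"
    using r by (intro order_tendstoD(2)[where y="LINT x|M. 0"]) auto
  then obtain N where N: "\<And>n. n \<ge> N \<Longrightarrow> (LINT x|M. W n x) < r / 2"
    by (auto simp: eventually_at_top_linorder)
  have W_int: "integrable M (W n)" for n
  proof (rule Bochner_Integration.integrable_bound)
    show "integrable M (\<lambda>x. (C + 1) * cmod (g x) powr p)" by (intro integrable_mult_right int)
    show "W n \<in> borel_measurable M" unfolding W_def D_def by measurable
    show "AE x in M. norm (W n x) \<le> norm ((C + 1) * cmod (g x) powr p)"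
      using W_le[of n] C by (intro AE_I2) (auto simp: W_def)
  qed
  have "\<bar>(LINT x|M. D n x)\<bar> < r" if "n \<ge> N" for n
  proof -
    have "\<bar>(LINT x|M. D n x)\<bar> \<le> (LINT x|M. \<bar>D n x\<bar>)" by (rule integral_abs_bound)
    also have "\<dots> \<le> (LINT x|M. W n x + e * cmod (f n x - g x) powr p)"
      using D_int W_int int by (intro integral_mono integrable_abs Bochner_Integration.integrable_add integrable_mult_right)
        (auto simp: W_def)
    also have "\<dots> = (LINT x|M. W n x) + e * (LINT x|M. cmod (f n x - g x) powr p)"
      using W_int[of n] int(3)[of n] by simp
    also have "\<dots> \<le> (LINT x|M. W n x) + e * K" using e by (intro add_left_mono mult_left_mono bound) auto
    also have "\<dots> < r" using N[OF that] e by linarith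
    finally show ?thesis .
  qed
  moreover have "(LINT x|M. D n x) = (LINT x|M. cmod (f n x) powr p) - (LINT x|M. cmod (f n x - g x) powr p)
      - (LINT x|M. cmod (g x) powr p)" for n
    unfolding D_def using int by simp
  ultimately show "\<exists>no. \<forall>n\<ge>no. norm ((LINT x|M. cmod (f n x) powr p) - (LINT x|M. cmod (f n x - g x) powr p)
      - (LINT x|M. cmod (g x) powr p)) < r"
    by (intro exI[of _ N]) simp
qed

text \<open>
  A substitute for the convex hull: the parallelogram law only needs midpoints, and induction over their
  formation replaces reasoning about coefficients.
\<close>

inductive_set mid_hull :: "('b \<Rightarrow> complex) set \<Rightarrow> ('b \<Rightarrow> complex) set" for S where
  mid_base: "f \<in> S \<Longrightarrow> f \<in> mid_hull S"
| mid_step: "f \<in> mid_hull S \<Longrightarrow> g \<in> mid_hull S \<Longrightarrow> (\<lambda>x. (f x + g x) / 2) \<in> mid_hull S"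

lemma mid_hull_mono: "S \<subseteq> T \<Longrightarrow> mid_hull S \<subseteq> mid_hull T"
proof
  fix f assume "S \<subseteq> T" "f \<in> mid_hull S"
  from this(2) show "f \<in> mid_hull T"
    by (induction rule: mid_hull.induct) (use \<open>S \<subseteq> T\<close> in \<open>auto intro: mid_hull.intros\<close>)
qed

lemma mid_hull_H2: "f \<in> mid_hull S \<Longrightarrow> S \<subseteq> H2 \<Longrightarrow> f \<in> H2"
  by (induction rule: mid_hull.induct) (auto intro: H2_midpoint)

lemma mid_hull_avg:
  assumes "f \<in> mid_hull S" "S \<subseteq> H2" "\<And>s. s \<in> S \<Longrightarrow> cmod (avg h s x - l) \<le> e"
  shows "cmod (avg h f x - l) \<le> e"
  using assms(1)
proof (induction rule: mid_hull.induct)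
  case (mid_step f g)
  have "avg h (\<lambda>x. (f x + g x) / 2) x - l = ((avg h f x - l) + (avg h g x - l)) / 2"
    using avg_midpoint[OF H2_L2[OF mid_hull_H2[OF mid_step.hyps(1) assms(2)]] H2_L2[OF mid_hull_H2[OF mid_step.hyps(2) assms(2)]]]
    by (simp add: field_simps)
  moreover have "cmod ((avg h f x - l) + (avg h g x - l)) \<le> e + e"
    using norm_triangle_ineq add_mono[OF mid_step.IH] order_trans by blast
  ultimately show ?case by (simp only: norm_divide norm_numeral)
qed (rule assms(3))

lemma T_fun_midpoint:
  assumes "u \<in> H2" "v \<in> H2"
  shows "T_fun c (\<lambda>x. u x - v x) = 2 * T_fun c u + 2 * T_fun c v - 4 * T_fun c (\<lambda>x. (u x + v x) / 2)"
  using T_fun_parallelogram[OF assms, of c] T_fun_cmult[OF H2_add[OF assms], of c "1/2"]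
  by (simp add: power2_eq_square)

text \<open>
  The functional does not see null sets, since the zero function serves as all derivatives of a null function.
\<close>

lemma T_fun_null:
  assumes u: "u \<in> H2" and "l2sq u = 0"
  shows "T_fun c u = 0"
proof -
  have uL: "u \<in> L2" by (rule H2_L2[OF u])
  have AE0: "AE x in lborel. u x = 0" by (rule l2sq_zero_imp_AE[OF uL assms(2)])
  have "weak_deriv i u (\<lambda>x. 0)" for i
    unfolding weak_deriv_def
  proof (intro conjI ballI uL L2_zero)
    fix \<phi> :: "'a \<Rightarrow> complex" assume "\<phi> \<in> test_functions"
    have "(LINT x|lborel. u x * dir_deriv i \<phi> x) = 0"
      by (rule integral_eq_zero_AE) (use AE0 in eventually_elim, simp)
    then show "(LINT x|lborel. u x * dir_deriv i \<phi> x) = - (LINT x|lborel. 0 * \<phi> x)" by simp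
  qed
  then have "sobolev_data u (\<lambda>i x. 0) (\<lambda>i j x. 0)"
    by (simp add: sobolev_data_def uL weak_deriv_zero)
  from T_fun_square[OF this, of c] show ?thesis using assms(2) by (simp add: laplacian_def)
qed

context
  fixes c :: real
  assumes c: "c > 0"
begin

lemma T_fun_add_le:
  assumes "u \<in> H2" "v \<in> H2"
  shows "T_fun c (\<lambda>x. u x + v x) \<le> 2 * T_fun c u + 2 * T_fun c v"
  using T_fun_parallelogram[OF assms, of c] T_fun_nonneg[OF c H2_diff[OF assms]] by simp

lemma T_fun_diff_le:
  assumes "u \<in> H2" "v \<in> H2"
  shows "T_fun c (\<lambda>x. u x - v x) \<le> 2 * T_fun c u + 2 * T_fun c v"
  using T_fun_parallelogram[OF assms, of c] T_fun_nonneg[OF c H2_add[OF assms]] by simp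

text \<open>
  Cauchy--Schwarz for the inner product that underlies the functional.
\<close>

lemma T_fun_cross_le:
  assumes "u \<in> H2" "v \<in> H2"
  shows "\<bar>T_fun c (\<lambda>x. u x + v x) - T_fun c u - T_fun c v\<bar> \<le> 4 * (sqrt (T_fun c u) * sqrt (T_fun c v))"
proof -
  obtain g h g' h' where D: "sobolev_data u g h" "sobolev_data v g' h'"
    using assms by (auto simp: H2_iff_sobolev_data)
  note L = sobolev_dataD(1,6)[OF D(1)] sobolev_dataD(1,6)[OF D(2)]
  define X where "X x = laplacian h x + u x" for x
  define Y where "Y x = laplacian h' x + v x" for x
  have XY: "X \<in> L2" "Y \<in> L2" unfolding X_def[abs_def] Y_def[abs_def] by (intro L2_add L)+
  have T: "T_fun c u = l2sq X + c * l2sq u" "T_fun c v = l2sq Y + c * l2sq v"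
    "T_fun c (\<lambda>x. u x + v x) = l2sq (\<lambda>x. X x + Y x) + c * l2sq (\<lambda>x. u x + v x)"
    using T_fun_square[OF D(1), of c] T_fun_square[OF D(2), of c] T_fun_lin_eq[OF D, of c 1 1]
    by (simp_all add: X_def[abs_def] Y_def[abs_def])
  have cross: "\<bar>Re (LINT x|lborel. f x * cnj (g x))\<bar> \<le> sqrt (l2sq f) * sqrt (l2sq g)"
    if "f \<in> L2" "g \<in> L2" for f g :: "'a \<Rightarrow> complex"
    using order_trans[OF abs_Re_le_cmod L2_cauchy_schwarz[OF that(1) L2_cnj[OF that(2)]]] by (simp add: l2sq_cnj)
  have le: "sqrt (l2sq X) \<le> sqrt (T_fun c u)" "sqrt (l2sq Y) \<le> sqrt (T_fun c v)"
    "sqrt (c * l2sq u) \<le> sqrt (T_fun c u)" "sqrt (c * l2sq v) \<le> sqrt (T_fun c v)"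
    unfolding T using c by (auto intro!: real_sqrt_le_mono)
  have "c * \<bar>Re (LINT x|lborel. u x * cnj (v x))\<bar> \<le> c * (sqrt (l2sq u) * sqrt (l2sq v))"
    using c by (intro mult_left_mono cross L) auto
  also have "\<dots> = sqrt (c * l2sq u) * sqrt (c * l2sq v)"
    using c by (simp add: real_sqrt_mult mult_ac)
  also have "\<dots> \<le> sqrt (T_fun c u) * sqrt (T_fun c v)"
    using c T_fun_nonneg[OF c assms(1)] by (intro mult_mono le) auto
  finally have 1: "c * \<bar>Re (LINT x|lborel. u x * cnj (v x))\<bar> \<le> sqrt (T_fun c u) * sqrt (T_fun c v)" .
  have "\<bar>Re (LINT x|lborel. X x * cnj (Y x))\<bar> \<le> sqrt (l2sq X) * sqrt (l2sq Y)" by (rule cross[OF XY])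
  also have "\<dots> \<le> sqrt (T_fun c u) * sqrt (T_fun c v)" using T_fun_nonneg[OF c assms(1)] by (intro mult_mono le) auto
  finally have 2: "\<bar>Re (LINT x|lborel. X x * cnj (Y x))\<bar> \<le> sqrt (T_fun c u) * sqrt (T_fun c v)" .
  have "T_fun c (\<lambda>x. u x + v x) - T_fun c u - T_fun c v
      = 2 * Re (LINT x|lborel. X x * cnj (Y x)) + 2 * (c * Re (LINT x|lborel. u x * cnj (v x)))"
    unfolding T l2sq_add[OF XY] l2sq_add[OF L(1,3)] by (simp add: algebra_simps)
  moreover have "\<bar>c * Re (LINT x|lborel. u x * cnj (v x))\<bar> = c * \<bar>Re (LINT x|lborel. u x * cnj (v x))\<bar>"
    using c by (simp add: abs_mult)
  ultimately show ?thesis using 1 2 by linarith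
qed

text \<open>
  By \<open>avg_error_le\<close> the averages determine the function as the radius tends to zero.
\<close>

lemma zero_averages_imp_T_fun_zero:
  fixes u :: "'a::euclidean_space \<Rightarrow> complex"
  assumes u: "u \<in> H2" and zero: "\<And>m x. avg (1 / real (Suc m)) u x = 0"
  shows "T_fun c u = 0"
proof (rule T_fun_null[OF u])
  let ?D = "real DIM('a) ^ 4 * (2 + 2 / c)"
  have "l2sq u \<le> ?D * (1 / real (Suc m)) ^ 4 * T_fun c u" for m
    using avg_error_le(2)[OF c u, of "1 / real (Suc m)"] by (simp only: zero diff_zero) simp
  then have "l2sq u \<le> ?D * inverse (real (Suc m)) ^ 4 * T_fun c u" for m
    by (simp only: inverse_eq_divide)
  moreover have "(\<lambda>m. ?D * inverse (real (Suc m)) ^ 4 * T_fun c u) \<longlonglongrightarrow> ?D * 0 ^ 4 * T_fun c u"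
    by (intro tendsto_intros LIMSEQ_inverse_real_of_nat)
  ultimately have "l2sq u \<le> ?D * 0 ^ 4 * T_fun c u"
    by (intro LIMSEQ_le_const) auto
  then show "l2sq u = 0" using l2sq_nonneg[of u] by simp
qed

lemma avg_tendsto:
  fixes u :: "nat \<Rightarrow> 'a::euclidean_space \<Rightarrow> complex"
  assumes u: "\<And>n. u n \<in> H2" and v: "v \<in> H2" and h: "h > 0"
    and lim: "(\<lambda>n. T_fun c (\<lambda>x. u n x - v x)) \<longlonglongrightarrow> 0"
  shows "(\<lambda>n. avg h (u n) x) \<longlonglongrightarrow> avg h v x"
proof -
  let ?V = "ball_vol TYPE('a) h"
  have V: "?V > 0" by (rule ball_vol_pos[OF h])
  have "(\<lambda>n. cmod (avg h (u n) x - avg h v x)) \<longlonglongrightarrow> 0"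
  proof (rule Lim_null_comparison)
    show "(\<lambda>n. sqrt (T_fun c (\<lambda>x. u n x - v x) / c / ?V)) \<longlonglongrightarrow> 0"
      using tendsto_real_sqrt[OF tendsto_divide[OF tendsto_divide[OF lim tendsto_const[of c]] tendsto_const[of ?V]]] c V by simp
    have "cmod (avg h (u n) x - avg h v x) \<le> sqrt (T_fun c (\<lambda>x. u n x - v x) / c / ?V)" for n
    proof (rule real_le_rsqrt)
      have "(cmod (avg h (u n) x - avg h v x))\<^sup>2 \<le> l2sq (\<lambda>x. u n x - v x) / ?V"
        using avg_sq_le[OF L2_diff[OF H2_L2[OF u[of n]] H2_L2[OF v]] h] by (simp add: avg_diff H2_L2 u v)
      also have "\<dots> \<le> T_fun c (\<lambda>x. u n x - v x) / c / ?V"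
        using V by (intro divide_right_mono l2sq_le_T_fun[OF c] H2_diff u v) auto
      finally show "(cmod (avg h (u n) x - avg h v x))\<^sup>2 \<le> T_fun c (\<lambda>x. u n x - v x) / c / ?V" .
    qed
    then show "\<forall>\<^sub>F n in sequentially. norm (cmod (avg h (u n) x - avg h v x)) \<le> sqrt (T_fun c (\<lambda>x. u n x - v x) / c / ?V)"
      by simp
  qed
  then show ?thesis by (simp only: tendsto_norm_zero_iff LIM_zero_iff)
qed

lemma midpoint_averages_converge:
  fixes w :: "nat \<Rightarrow> 'a::euclidean_space \<Rightarrow> complex"
  assumes w: "\<And>n. w n \<in> H2" and R: "\<And>n. T_fun c (w n) \<le> R"
  obtains g v where "\<And>n. g n \<in> mid_hull (w ` {n..})" "v \<in> H2" "(\<lambda>n. T_fun c (\<lambda>x. g n x - v x)) \<longlonglongrightarrow> 0"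
proof -
  define S where "S n = mid_hull (w ` {n..})" for n
  have SH: "f \<in> H2" if "f \<in> S n" for f n using that w unfolding S_def by (intro mid_hull_H2) auto
  obtain g where g: "\<And>n. g n \<in> S n"
    "\<And>e. e > 0 \<Longrightarrow> \<exists>M. \<forall>m\<ge>M. \<forall>n\<ge>M. T_fun c (\<lambda>x. g m x - g n x) < e"
  proof (rule midpoint_closed_near_minimizers_Cauchy[of S "T_fun c" R])
    show "S (Suc n) \<subseteq> S n" for n unfolding S_def by (intro mid_hull_mono) auto
    show "(\<lambda>x. (f x + g x) / 2) \<in> S n" if "f \<in> S n" "g \<in> S n" for n f g
      using that unfolding S_def by (rule mid_hull.intros)
    show "T_fun c (\<lambda>x. f x - g x) = 2 * T_fun c f + 2 * T_fun c g - 4 * T_fun c (\<lambda>x. (f x + g x) / 2)"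
      if "f \<in> S 0" "g \<in> S 0" for f g by (intro T_fun_midpoint SH[OF that(1)] SH[OF that(2)])
    show "0 \<le> T_fun c f" if "f \<in> S 0" for f by (rule T_fun_nonneg[OF c SH[OF that]])
    show "\<exists>f\<in>S n. T_fun c f \<le> R" for n
      using R by (intro bexI[of _ "w n"]) (auto simp: S_def intro: mid_hull.intros)
  qed auto
  obtain v where "v \<in> H2" "(\<lambda>n. T_fun c (\<lambda>x. g n x - v x)) \<longlonglongrightarrow> 0"
    by (rule H2_complete[OF c SH[OF g(1)] g(2)], assumption) (rule that)
  then show thesis using that[of g v] g(1) by (simp add: S_def)
qed

text \<open>
  The average at a point is an affine functional, so on midpoints of a tail it stays as close to its limit as on the tail.
  Hence the strong limit of midpoints is determined by the original sequence.
\<close>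

lemma midpoint_limit_avg:
  fixes w :: "nat \<Rightarrow> 'a::euclidean_space \<Rightarrow> complex"
  assumes w: "\<And>n. w n \<in> H2" and g: "\<And>n. g n \<in> mid_hull (w ` {n..})" and v: "v \<in> H2"
    and lim: "(\<lambda>n. T_fun c (\<lambda>x. g n x - v x)) \<longlonglongrightarrow> 0" and h: "h > 0"
    and l: "(\<lambda>n. avg h (w n) x) \<longlonglongrightarrow> l"
  shows "avg h v x = l"
proof -
  have gH: "g n \<in> H2" for n using g[of n] w by (intro mid_hull_H2) auto
  have "(\<lambda>n. avg h (g n) x) \<longlonglongrightarrow> l"
  proof (rule LIMSEQ_I)
    fix e :: real assume e: "e > 0"
    then obtain N where N: "\<And>n. n \<ge> N \<Longrightarrow> cmod (avg h (w n) x - l) < e / 2"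
      using LIMSEQ_D[OF l, of "e / 2"] by auto
    have "cmod (avg h (g n) x - l) < e" if "n \<ge> N" for n
    proof -
      have "cmod (avg h (g n) x - l) \<le> e / 2"
      proof (rule mid_hull_avg[OF g[of n]])
        show "w ` {n..} \<subseteq> H2" using w by auto
        fix s assume "s \<in> w ` {n..}"
        then obtain m where "s = w m" "m \<ge> n" by auto
        then show "cmod (avg h s x - l) \<le> e / 2" using N[of m] that by (simp add: less_imp_le)
      qed
      then show ?thesis using e by linarith
    qed
    then show "\<exists>no. \<forall>n\<ge>no. norm (avg h (g n) x - l) < e" by blast
  qed
  then show ?thesis
    using avg_tendsto[OF gH v h lim, of x] LIMSEQ_unique by blast
qed

text \<open>
  A diagonal argument handles a countable dense set of centres; equicontinuity extends the convergence to all centres. The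
  factor \<open>sqrt (V m)\<close> makes the averages bounded uniformly in the radius.
\<close>

lemma bounded_H2_averages_subsequence:
  fixes u :: "nat \<Rightarrow> 'a::euclidean_space \<Rightarrow> complex"
  assumes u: "\<And>n. u n \<in> H2" and R: "\<And>n. T_fun c (u n) \<le> R"
  obtains k where "strict_mono (k :: nat \<Rightarrow> nat)"
    "\<And>m x. \<exists>l. (\<lambda>n. avg (1 / real (Suc m)) (u (k n)) x) \<longlonglongrightarrow> l"
proof -
  define h where "h m = 1 / real (Suc m)" for m
  have h: "h m > 0" for m by (simp add: h_def)
  define V where "V m = ball_vol TYPE('a) (h m)" for m
  have V: "V m > 0" for m unfolding V_def by (rule ball_vol_pos[OF h])
  obtain D :: "'a set" where D: "countable D" "\<And>X. open X \<Longrightarrow> X \<noteq> {} \<Longrightarrow> \<exists>d\<in>D. d \<in> X"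
    using countable_dense_setE by blast
  have R0: "R \<ge> 0" using R[of 0] T_fun_nonneg[OF c u[of 0]] by linarith
  define F where "F n p = complex_of_real (sqrt (V (fst p))) * avg (h (fst p)) (u n) (snd p)" for n p
  have "cmod (F n p) \<le> sqrt (R / c)" for n p
  proof -
    have "(cmod (avg (h (fst p)) (u n) (snd p)))\<^sup>2 \<le> l2sq (u n) / V (fst p)"
      unfolding V_def by (rule avg_sq_le[OF H2_L2[OF u] h])
    then have "V (fst p) * (cmod (avg (h (fst p)) (u n) (snd p)))\<^sup>2 \<le> l2sq (u n)"
      using V[of "fst p"] by (simp add: field_simps)
    also have "\<dots> \<le> R / c" using l2sq_le_T_fun[OF c u[of n]] R[of n] c
      by (meson divide_right_mono less_imp_le order_trans)
    finally have "sqrt (V (fst p) * (cmod (avg (h (fst p)) (u n) (snd p)))\<^sup>2) \<le> sqrt (R / c)" by simp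
    then show ?thesis using V[of "fst p"] by (simp add: F_def norm_mult real_sqrt_mult)
  qed
  note F_le = this
  have "countable ((UNIV :: nat set) \<times> D)" using D(1) by (intro countable_SIGMA) auto
  then obtain k where k: "strict_mono (k :: nat \<Rightarrow> nat)"
    "\<And>p. p \<in> (UNIV :: nat set) \<times> D \<Longrightarrow> \<exists>l. (\<lambda>n. F (k n) p) \<longlonglongrightarrow> l"
    by (rule function_convergent_subsequence[where f=F and M="sqrt (R / c)"]) (use F_le in auto)
  have dense: "convergent (\<lambda>n. avg (h m) (u (k n)) d)" if d: "d \<in> D" for m d
  proof -
    obtain l where "(\<lambda>n. F (k n) (m, d)) \<longlonglongrightarrow> l" using k(2)[of "(m, d)"] d by auto
    then have "(\<lambda>n. F (k n) (m, d) / complex_of_real (sqrt (V m))) \<longlonglongrightarrow> l / complex_of_real (sqrt (V m))"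
      using V[of m] by (intro tendsto_divide tendsto_const) auto
    moreover have "F (k n) (m, d) / complex_of_real (sqrt (V m)) = avg (h m) (u (k n)) d" for n
      using V[of m] by (simp add: F_def)
    ultimately show ?thesis by (auto simp: convergent_def)
  qed
  have "convergent (\<lambda>n. avg (h m) (u (k n)) x)" for m x
  proof -
    define B where "B = real DIM('a) * ((2 + 3 / c) * R) / V m"
    have B: "B \<ge> 0" unfolding B_def using c R0 V[of m] by (intro divide_nonneg_pos mult_nonneg_nonneg add_nonneg_nonneg) auto
    have lip: "cmod (avg (h m) (u n) x - avg (h m) (u n) y) \<le> sqrt B * norm (x - y)" for n y
    proof -
      have "(cmod (avg (h m) (u n) x - avg (h m) (u n) y))\<^sup>2
          \<le> real DIM('a) * (norm (x - y))\<^sup>2 * ((2 + 3 / c) * T_fun c (u n)) / V m"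
        unfolding V_def by (rule avg_equicontinuous[OF c u h])
      also have "\<dots> \<le> real DIM('a) * (norm (x - y))\<^sup>2 * ((2 + 3 / c) * R) / V m"
        using c V[of m] R[of n] by (intro divide_right_mono mult_left_mono) (auto intro: add_nonneg_nonneg)
      also have "\<dots> = B * (norm (x - y))\<^sup>2" unfolding B_def by (simp add: mult_ac)
      also have "\<dots> = (sqrt B * norm (x - y))\<^sup>2" using B by (simp add: power_mult_distrib)
      finally show ?thesis by (rule power2_le_imp_le) (use B in simp)
    qed
    have "Cauchy (\<lambda>n. avg (h m) (u (k n)) x)"
    proof (rule metric_CauchyI)
      fix e :: real assume e: "e > 0"
      have sB: "sqrt B + 1 > 0" using B by (simp add: add_nonneg_pos)
      define s where "s = e / 3 / (sqrt B + 1)"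
      have s_eq: "(sqrt B + 1) * s = e / 3" 
        using sB unfolding s_def by (metis less_irrefl nonzero_mult_div_cancel_left times_divide_eq_right)
      have s: "s > 0" using e sB by (simp add: s_def)
      obtain d where d: "d \<in> D" "d \<in> ball x s" using D(2)[of "ball x s"] s by (metis centre_in_ball empty_iff open_ball)
      have small: "cmod (avg (h m) (u n) x - avg (h m) (u n) d) < e / 3" for n
      proof -
        have "cmod (avg (h m) (u n) x - avg (h m) (u n) d) \<le> sqrt B * norm (x - d)" by (rule lip)
        also have "\<dots> \<le> sqrt B * s" using d B by (intro mult_left_mono) (auto simp: dist_norm)
        also have "\<dots> < (sqrt B + 1) * s" using s by (intro mult_strict_right_mono) auto
        also have "\<dots> = e / 3" using sB s_eq by simp
        finally show ?thesis .
      qed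
      obtain N where N: "\<And>i j. i \<ge> N \<Longrightarrow> j \<ge> N \<Longrightarrow> dist (avg (h m) (u (k i)) d) (avg (h m) (u (k j)) d) < e / 3"
        using metric_CauchyD[OF convergent_Cauchy[OF dense[OF d(1), of m]], of "e / 3"] e by auto
      have "dist (avg (h m) (u (k i)) x) (avg (h m) (u (k j)) x) < e" if "i \<ge> N" "j \<ge> N" for i j
      proof -
        have "dist (avg (h m) (u (k i)) x) (avg (h m) (u (k j)) x)
            \<le> dist (avg (h m) (u (k i)) x) (avg (h m) (u (k i)) d) + dist (avg (h m) (u (k i)) d) (avg (h m) (u (k j)) x)"
          by (rule dist_triangle)
        also have "dist (avg (h m) (u (k i)) d) (avg (h m) (u (k j)) x)
            \<le> dist (avg (h m) (u (k i)) d) (avg (h m) (u (k j)) d) + dist (avg (h m) (u (k j)) d) (avg (h m) (u (k j)) x)"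
          by (rule dist_triangle)
        finally show ?thesis
          using small[of "k i"] small[of "k j"] N[OF that] by (simp add: dist_norm norm_minus_commute)
      qed
      then show "\<exists>M. \<forall>i\<ge>M. \<forall>j\<ge>M. dist (avg (h m) (u (k i)) x) (avg (h m) (u (k j)) x) < e" by blast
    qed
    then show ?thesis by (rule Cauchy_convergent)
  qed
  then show thesis using that[OF k(1)] by (simp add: h_def convergent_def)
qed

end

section \<open>Weak limits of bounded sequences\<close>

lemma positive_integrable_weight:
  obtains \<rho> :: "'a::euclidean_space \<Rightarrow> real"
  where "\<rho> \<in> borel_measurable borel" "\<And>x. 0 < \<rho> x" "\<And>x. \<rho> x \<le> 1" "integrable lborel \<rho>"
proof -
  obtain h :: "'a \<Rightarrow> ennreal" where h: "h \<in> borel_measurable lborel" "integral\<^sup>N lborel h \<noteq> \<infinity>"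
    "\<And>x. 0 < h x \<and> h x < \<infinity>"
    using sigma_finite_measure.Ex_finite_integrable_function[of "lborel :: 'a measure", OF sigma_finite_lborel] by auto
  note [measurable] = h(1)
  define \<rho> where "\<rho> x = min 1 (enn2real (h x))" for x
  have m: "\<rho> \<in> borel_measurable lborel" unfolding \<rho>_def[abs_def] by measurable
  have pos: "0 < \<rho> x" for x
    using h(3)[of x] by (simp add: \<rho>_def enn2real_positive_iff)
  have "ennreal (\<rho> x) \<le> h x" for x
  proof -
    have "ennreal (\<rho> x) \<le> ennreal (enn2real (h x))" by (intro ennreal_leI) (simp add: \<rho>_def)
    also have "\<dots> = h x" using h(3)[of x] by (intro ennreal_enn2real) simp
    finally show ?thesis .
  qed
  then have "(\<integral>\<^sup>+x. ennreal (\<rho> x) \<partial>lborel) \<le> integral\<^sup>N lborel h" by (intro nn_integral_mono)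
  also have "\<dots> < \<infinity>" using h(2) by (simp add: less_top)
  finally have "integrable lborel \<rho>"
    using m pos by (intro integrableI_nonneg) (auto intro: less_imp_le)
  then show thesis using that[of \<rho>] m pos by (simp add: \<rho>_def)
qed

context
  fixes c :: real
  assumes c: "c > 0"
begin

text \<open>
  Local compactness. With a positive integrable weight \<open>\<rho>\<close> in place of a cut-off, \<open>\<integral>\<bar>d\<^sub>n\<bar>\<^sup>2\<rho>\<close> tends to zero: replacing \<open>d\<^sub>n\<close> by
  its average costs \<open>O(h\<^sup>4)\<close>, and the averages tend to zero boundedly.
\<close>

lemma vanishing_averages_imp_AE_subsequence:
  fixes d :: "nat \<Rightarrow> 'a::euclidean_space \<Rightarrow> complex"
  assumes d: "\<And>n. d n \<in> H2" and R: "\<And>n. T_fun c (d n) \<le> R"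
    and van: "\<And>m x. (\<lambda>n. avg (1 / real (Suc m)) (d n) x) \<longlonglongrightarrow> 0"
  obtains s where "strict_mono (s :: nat \<Rightarrow> nat)" "AE x in lborel. (\<lambda>n. d (s n) x) \<longlonglongrightarrow> 0"
proof -
  obtain \<rho> :: "'a \<Rightarrow> real" where \<rho>: "\<rho> \<in> borel_measurable borel" "\<And>x. 0 < \<rho> x" "\<And>x. \<rho> x \<le> 1" "integrable lborel \<rho>"
    using positive_integrable_weight by metis
  note [measurable] = \<rho>(1)
  have dL: "d n \<in> L2" for n by (rule H2_L2[OF d])
  have dm [measurable]: "d n \<in> borel_measurable borel" for n by (rule L2_measurable[OF dL])
  define h where "h m = 1 / real (Suc m)" for m
  have h: "h m > 0" for m by (simp add: h_def)
  have R0: "R \<ge> 0" using R[of 0] T_fun_nonneg[OF c d[of 0]] by linarith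
  define D where "D = real DIM('a) ^ 4 * (2 + 2 / c)"
  have D: "D \<ge> 0" using c by (simp add: D_def)
  define f where "f n x = (cmod (d n x))\<^sup>2 * \<rho> x" for n x
  have weight: "integrable lborel (\<lambda>x. (cmod (g x))\<^sup>2 * \<rho> x)" "(LINT x|lborel. (cmod (g x))\<^sup>2 * \<rho> x) \<le> l2sq g"
    if g: "g \<in> L2" for g :: "'a \<Rightarrow> complex"
  proof -
    have le: "(cmod (g x))\<^sup>2 * \<rho> x \<le> (cmod (g x))\<^sup>2" for x
      using \<rho>(2,3)[of x] by (intro mult_left_le) auto
    show int: "integrable lborel (\<lambda>x. (cmod (g x))\<^sup>2 * \<rho> x)"
    proof (rule Bochner_Integration.integrable_bound[OF L2_integrable_sq[OF g]])
      show "(\<lambda>x. (cmod (g x))\<^sup>2 * \<rho> x) \<in> borel_measurable lborel" using L2_measurable[OF g] by measurable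
      show "AE x in lborel. norm ((cmod (g x))\<^sup>2 * \<rho> x) \<le> norm ((cmod (g x))\<^sup>2)"
        using le \<rho>(2) by (intro AE_I2) (simp add: abs_mult less_imp_le)
    qed
    show "(LINT x|lborel. (cmod (g x))\<^sup>2 * \<rho> x) \<le> l2sq g"
      unfolding l2sq_def by (intro integral_mono int L2_integrable_sq g le)
  qed
  have f_nn: "0 \<le> (LINT x|lborel. f n x)" for n
    using \<rho>(2) by (intro integral_nonneg_AE AE_I2) (simp add: f_def less_imp_le)
  have "(\<lambda>n. LINT x|lborel. f n x) \<longlonglongrightarrow> 0"
  proof (rule LIMSEQ_I)
    fix e :: real assume e: "e > 0"
    have "(\<lambda>m. 2 * (D * inverse (real (Suc m)) ^ 4 * R)) \<longlonglongrightarrow> 2 * (D * 0 ^ 4 * R)"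
      by (intro tendsto_intros LIMSEQ_inverse_real_of_nat)
    then have "\<forall>\<^sub>F m in sequentially. 2 * (D * inverse (real (Suc m)) ^ 4 * R) < e / 2"
      by (rule order_tendstoD(2)) (use e in simp)
    then obtain m where "2 * (D * inverse (real (Suc m)) ^ 4 * R) < e / 2"
      using eventually_happens'[OF sequentially_bot] by blast
    then have m: "2 * (D * h m ^ 4 * R) < e / 2" by (simp only: h_def inverse_eq_divide)
    define A where "A n = avg (h m) (d n)" for n
    have A_meas [measurable]: "A n \<in> borel_measurable borel" for n unfolding A_def by measurable
    define V where "V = ball_vol TYPE('a) (h m)"
    have V: "V > 0" unfolding V_def by (rule ball_vol_pos[OF h])
    have A_le: "(cmod (A n x))\<^sup>2 \<le> R / c / V" for n x
    proof -
      have "(cmod (A n x))\<^sup>2 \<le> l2sq (d n) / V" unfolding A_def V_def by (rule avg_sq_le[OF dL h])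
      also have "\<dots> \<le> R / c / V"
      proof (rule divide_right_mono)
        have "T_fun c (d n) / c \<le> R / c" using R[of n] c by (intro divide_right_mono) auto
        then show "l2sq (d n) \<le> R / c" using l2sq_le_T_fun[OF c d[of n]] by linarith
      qed (use V in simp)
      finally show ?thesis .
    qed
    have A_bound: "norm ((cmod (A n x))\<^sup>2 * \<rho> x) \<le> R / c / V * \<rho> x" for n x
    proof -
      have "(cmod (A n x))\<^sup>2 * \<rho> x \<le> R / c / V * \<rho> x"
        using \<rho>(2)[of x] by (intro mult_right_mono A_le) auto
      then show ?thesis using \<rho>(2)[of x] by (simp add: abs_mult)
    qed
    have A_int: "integrable lborel (\<lambda>x. (cmod (A n x))\<^sup>2 * \<rho> x)" for n
    proof (rule Bochner_Integration.integrable_bound)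
      show "integrable lborel (\<lambda>x. R / c / V * \<rho> x)" by (intro integrable_mult_right \<rho>)
      show "AE x in lborel. norm ((cmod (A n x))\<^sup>2 * \<rho> x) \<le> norm (R / c / V * \<rho> x)"
        by (intro AE_I2 order_trans[OF A_bound]) (simp only: real_norm_def abs_ge_self)
      show "(\<lambda>x. (cmod (A n x))\<^sup>2 * \<rho> x) \<in> borel_measurable lborel" by measurable
    qed
    have "(\<lambda>n. LINT x|lborel. (cmod (A n x))\<^sup>2 * \<rho> x) \<longlonglongrightarrow> (LINT (x::'a)|lborel. 0)"
    proof (rule integral_dominated_convergence)
      show "integrable lborel (\<lambda>x. R / c / V * \<rho> x)" by (intro integrable_mult_right \<rho>)
      show "AE x in lborel. (\<lambda>n. (cmod (A n x))\<^sup>2 * \<rho> x) \<longlonglongrightarrow> 0"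
      proof (rule AE_I2)
        fix x
        have "(\<lambda>n. A n x) \<longlonglongrightarrow> 0" using van[of m x] by (simp add: A_def h_def)
        then have "(\<lambda>n. (cmod (A n x))\<^sup>2 * \<rho> x) \<longlonglongrightarrow> (cmod 0)\<^sup>2 * \<rho> x" by (intro tendsto_intros)
        then show "(\<lambda>n. (cmod (A n x))\<^sup>2 * \<rho> x) \<longlonglongrightarrow> 0" by simp
      qed
      show "AE x in lborel. norm ((cmod (A n x))\<^sup>2 * \<rho> x) \<le> R / c / V * \<rho> x" for n
        by (intro AE_I2 A_bound)
    qed measurable
    then have "\<forall>\<^sub>F n in sequentially. (LINT x|lborel. (cmod (A n x))\<^sup>2 * \<rho> x) < e / 4"
      by (intro order_tendstoD(2)[where y="LINT (x::'a)|lborel. 0"]) (use e in auto)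
    then obtain N where N: "\<And>n. n \<ge> N \<Longrightarrow> (LINT x|lborel. (cmod (A n x))\<^sup>2 * \<rho> x) < e / 4"
      by (auto simp: eventually_at_top_linorder)
    have "(LINT x|lborel. f n x) < e" if n: "n \<ge> N" for n
    proof -
      have E: "(\<lambda>x. d n x - A n x) \<in> L2" unfolding A_def by (rule avg_error_le(1)[OF c d h])
      have "(LINT x|lborel. f n x) \<le> (LINT x|lborel. 2 * ((cmod (d n x - A n x))\<^sup>2 * \<rho> x) + 2 * ((cmod (A n x))\<^sup>2 * \<rho> x))"
      proof (rule integral_mono)
        show "integrable lborel (f n)" unfolding f_def[abs_def] by (rule weight(1)[OF dL])
        show "integrable lborel (\<lambda>x. 2 * ((cmod (d n x - A n x))\<^sup>2 * \<rho> x) + 2 * ((cmod (A n x))\<^sup>2 * \<rho> x))"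
          by (intro Bochner_Integration.integrable_add integrable_mult_right weight(1)[OF E] A_int)
        fix x
        have "(cmod (d n x))\<^sup>2 \<le> 2 * (cmod (d n x - A n x))\<^sup>2 + 2 * (cmod (A n x))\<^sup>2"
          using norm_add_sq_le[of "d n x - A n x" "A n x"] by simp
        then have "f n x \<le> (2 * (cmod (d n x - A n x))\<^sup>2 + 2 * (cmod (A n x))\<^sup>2) * \<rho> x"
          unfolding f_def using \<rho>(2)[of x] by (intro mult_right_mono) auto
        then show "f n x \<le> 2 * ((cmod (d n x - A n x))\<^sup>2 * \<rho> x) + 2 * ((cmod (A n x))\<^sup>2 * \<rho> x)"
          by (simp add: algebra_simps)
      qed
      also have "\<dots> = 2 * (LINT x|lborel. (cmod (d n x - A n x))\<^sup>2 * \<rho> x) + 2 * (LINT x|lborel. (cmod (A n x))\<^sup>2 * \<rho> x)"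
        using weight(1)[OF E] A_int[of n] by simp
      also have "(LINT x|lborel. (cmod (d n x - A n x))\<^sup>2 * \<rho> x) \<le> D * h m ^ 4 * R"
      proof -
        have "(LINT x|lborel. (cmod (d n x - A n x))\<^sup>2 * \<rho> x) \<le> l2sq (\<lambda>x. d n x - A n x)" by (rule weight(2)[OF E])
        also have "\<dots> \<le> D * h m ^ 4 * T_fun c (d n)" unfolding A_def D_def by (rule avg_error_le(2)[OF c d h])
        also have "\<dots> \<le> D * h m ^ 4 * R" using D h[of m] R by (intro mult_left_mono) auto
        finally show ?thesis .
      qed
      finally show ?thesis using N[OF n] m by linarith
    qed
    then show "\<exists>no. \<forall>n\<ge>no. norm ((LINT x|lborel. f n x) - 0) < e"
      using f_nn by (intro exI[of _ N]) simp
  qed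
  moreover have "(LINT x|lborel. norm (f n x)) = (LINT x|lborel. f n x)" for n
    using \<rho>(2) by (intro Bochner_Integration.integral_cong) (auto simp: f_def less_imp_le)
  ultimately have lim: "(\<lambda>n. LINT x|lborel. norm (f n x)) \<longlonglongrightarrow> 0" by simp
  have "integrable lborel (f n)" for n unfolding f_def[abs_def] by (rule weight(1)[OF dL])
  from tendsto_L1_AE_subseq[OF this lim] obtain s where s: "strict_mono s" "AE x in lborel. (\<lambda>n. f (s n) x) \<longlonglongrightarrow> 0"
    by blast
  from s(2) have "AE x in lborel. (\<lambda>n. d (s n) x) \<longlonglongrightarrow> 0"
  proof eventually_elim
    case (elim x)
    have "(\<lambda>n. sqrt (f (s n) x / \<rho> x)) \<longlonglongrightarrow> sqrt (0 / \<rho> x)"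
      using \<rho>(2)[of x] by (intro tendsto_intros elim) auto
    moreover have "sqrt (f (s n) x / \<rho> x) = cmod (d (s n) x)" for n
      using \<rho>(2)[of x] by (simp add: f_def)
    ultimately show ?case by (simp add: tendsto_norm_zero_iff)
  qed
  then show thesis using that s(1) by blast
qed

text \<open>
  The weak limit \<open>v\<close> is obtained as a strong limit of midpoints. The last conclusion is the half that is needed of the weak
  convergence of \<open>u (r n)\<close> in the energy: the cross term of \<open>v\<close> and \<open>u (r n) - v\<close> is asymptotically
  nonnegative. Otherwise midpoints of the offending terms would converge strongly to \<open>v\<close>, where the cross term
  vanishes.
\<close>

theorem H2_bounded_subsequence:
  fixes u :: "nat \<Rightarrow> 'a::euclidean_space \<Rightarrow> complex"
  assumes u: "\<And>n. u n \<in> H2" and R: "\<And>n. T_fun c (u n) \<le> R"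
  obtains r v where "strict_mono (r :: nat \<Rightarrow> nat)" "v \<in> H2"
    "\<And>m x. (\<lambda>n. avg (1 / real (Suc m)) (u (r n)) x) \<longlonglongrightarrow> avg (1 / real (Suc m)) v x"
    "AE x in lborel. (\<lambda>n. u (r n) x) \<longlonglongrightarrow> v x"
    "\<And>e. e > 0 \<Longrightarrow> \<forall>\<^sub>F n in sequentially. T_fun c v + T_fun c (\<lambda>x. u (r n) x - v x) \<le> T_fun c (u (r n)) + e"
proof -
  obtain k where k: "strict_mono (k :: nat \<Rightarrow> nat)"
    "\<And>m x. \<exists>l. (\<lambda>n. avg (1 / real (Suc m)) (u (k n)) x) \<longlonglongrightarrow> l"
    using bounded_H2_averages_subsequence[OF c, of u R] u R by blast
  define w where "w n = u (k n)" for n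
  have w: "w n \<in> H2" "T_fun c (w n) \<le> R" for n by (simp_all add: w_def u R)
  obtain L where L: "\<And>m x. (\<lambda>n. avg (1 / real (Suc m)) (w n) x) \<longlonglongrightarrow> L m x"
    using k(2) unfolding w_def by metis
  obtain g v where g: "\<And>n. g n \<in> mid_hull (w ` {n..})" and v: "v \<in> H2" and gv: "(\<lambda>n. T_fun c (\<lambda>x. g n x - v x)) \<longlonglongrightarrow> 0"
    using midpoint_averages_converge[OF c, of w R] w by blast
  have Lv: "avg (1 / real (Suc m)) v x = L m x" for m x
    by (rule midpoint_limit_avg[OF c w(1) g v gv _ L]) simp
  have wv: "(\<lambda>n. avg (1 / real (Suc m)) (w n) x) \<longlonglongrightarrow> avg (1 / real (Suc m)) v x" for m x
    using L Lv by simp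
  have dH: "(\<lambda>x. w n x - v x) \<in> H2" for n by (intro H2_diff w v)
  obtain s where s: "strict_mono (s :: nat \<Rightarrow> nat)" "AE x in lborel. (\<lambda>n. w (s n) x - v x) \<longlonglongrightarrow> 0"
  proof (rule vanishing_averages_imp_AE_subsequence[of "\<lambda>n x. w n x - v x" "2 * R + 2 * T_fun c v"])
    show "T_fun c (\<lambda>x. w n x - v x) \<le> 2 * R + 2 * T_fun c v" for n
      using T_fun_diff_le[OF c w(1)[of n] v] w(2)[of n] by linarith
    show "(\<lambda>n. avg (1 / real (Suc m)) (\<lambda>x. w n x - v x) x) \<longlonglongrightarrow> 0" for m x
      using tendsto_diff[OF wv[of m x] tendsto_const[of "avg (1 / real (Suc m)) v x"]]
      by (simp add: avg_diff H2_L2 w v)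
  qed (use dH in auto)
  show thesis
  proof
    show "strict_mono (k \<circ> s)" using k(1) s(1) by (rule strict_mono_o)
    show "v \<in> H2" by (rule v)
    show "(\<lambda>n. avg (1 / real (Suc m)) (u ((k \<circ> s) n)) x) \<longlonglongrightarrow> avg (1 / real (Suc m)) v x" for m x
      using LIMSEQ_subseq_LIMSEQ[OF wv[of m x] s(1)] by (simp add: o_def w_def)
    show "AE x in lborel. (\<lambda>n. u ((k \<circ> s) n) x) \<longlonglongrightarrow> v x"
      using s(2) by eventually_elim (simp add: w_def LIM_zero_iff)
    fix e :: real assume e: "e > 0"
    show "\<forall>\<^sub>F n in sequentially. T_fun c v + T_fun c (\<lambda>x. u ((k \<circ> s) n) x - v x) \<le> T_fun c (u ((k \<circ> s) n)) + e"
    proof (rule ccontr)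
      assume neg: "\<not> ?thesis"
      \<comment> \<open>The excess \<open>X\<close> is affine, hence at least \<open>e\<close> on all midpoints formed from terms at which it exceeds
        \<open>e\<close>. It is small in a neighbourhood of \<open>v\<close>, which such midpoints enter.\<close>
      define X where "X f = T_fun c v + T_fun c (\<lambda>x. f x - v x) - T_fun c f" for f
      have X_mid: "X (\<lambda>x. (f x + g x) / 2) = (X f + X g) / 2" if fg: "f \<in> H2" "g \<in> H2" for f g
      proof -
        have "T_fun c (\<lambda>x. (f x - v x) - (g x - v x)) = 2 * T_fun c (\<lambda>x. f x - v x) + 2 * T_fun c (\<lambda>x. g x - v x)
            - 4 * T_fun c (\<lambda>x. ((f x - v x) + (g x - v x)) / 2)"
          by (intro T_fun_midpoint H2_diff fg v)
        moreover have "(\<lambda>x. ((f x - v x) + (g x - v x)) / 2) = (\<lambda>x. (f x + g x) / 2 - v x)"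
          by (simp add: fun_eq_iff field_simps)
        moreover have "(\<lambda>x. (f x - v x) - (g x - v x)) = (\<lambda>x. f x - g x)" by simp
        ultimately have "T_fun c (\<lambda>x. f x - g x) = 2 * T_fun c (\<lambda>x. f x - v x) + 2 * T_fun c (\<lambda>x. g x - v x)
            - 4 * T_fun c (\<lambda>x. (f x + g x) / 2 - v x)" by (simp only:)
        then show ?thesis using T_fun_midpoint[OF fg, of c] unfolding X_def by argo
      qed
      have X_hull: "e \<le> X f" if "f \<in> mid_hull S" "S \<subseteq> H2" "\<And>s. s \<in> S \<Longrightarrow> e \<le> X s" for f S
        using that(1)
      proof (induction rule: mid_hull.induct)
        case (mid_step f g)
        then show ?case using X_mid[OF mid_hull_H2[OF mid_step.hyps(1) that(2)] mid_hull_H2[OF mid_step.hyps(2) that(2)]] by simp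
      qed (rule that(3))
      have "infinite {n. e < X (w (s n))}"
      proof
        assume "finite {n. e < X (w (s n))}"
        then have "\<forall>\<^sub>F n in sequentially. \<not> e < X (w (s n))"
          by (simp add: MOST_iff_cofinite flip: cofinite_eq_sequentially)
        then have "\<forall>\<^sub>F n in sequentially.
            T_fun c v + T_fun c (\<lambda>x. u ((k \<circ> s) n) x - v x) \<le> T_fun c (u ((k \<circ> s) n)) + e"
          by eventually_elim (simp add: X_def w_def)
        with neg show False by simp
      qed
      then obtain j where j: "strict_mono (j :: nat \<Rightarrow> nat)" "\<And>n. j n \<in> {n. e < X (w (s n))}"
        using infinite_enumerate by blast
      define z where "z n = w (s (j n))" for n
      have z: "z n \<in> H2" "T_fun c (z n) \<le> R" "e \<le> X (z n)" for n
        using j(2)[of n] by (simp_all add: z_def w)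
      obtain g' v' where g': "\<And>n. g' n \<in> mid_hull (z ` {n..})" and v': "v' \<in> H2"
        and gv': "(\<lambda>n. T_fun c (\<lambda>x. g' n x - v' x)) \<longlonglongrightarrow> 0"
        using midpoint_averages_converge[OF c, of z R] z by blast
      have g'H: "g' n \<in> H2" for n using g'[of n] z(1) by (intro mid_hull_H2) auto
      have zv: "(\<lambda>n. avg (1 / real (Suc m)) (z n) x) \<longlonglongrightarrow> avg (1 / real (Suc m)) v x" for m x
        using LIMSEQ_subseq_LIMSEQ[OF wv[of m x] strict_mono_o[OF s(1) j(1)]] by (simp add: o_def z_def)
      have "avg (1 / real (Suc m)) v' x = avg (1 / real (Suc m)) v x" for m x
        by (rule midpoint_limit_avg[OF c z(1) g' v' gv' _ zv]) simp
      then have null: "T_fun c (\<lambda>x. v' x - v x) = 0"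
        by (intro zero_averages_imp_T_fun_zero[OF c] H2_diff v v') (simp add: avg_diff H2_L2 v v')
      have "T_fun c (\<lambda>x. g' n x - v x) \<le> 2 * T_fun c (\<lambda>x. g' n x - v' x)" for n
        using T_fun_add_le[OF c H2_diff[OF g'H[of n] v'] H2_diff[OF v' v]] null by simp
      then have lim: "(\<lambda>n. T_fun c (\<lambda>x. g' n x - v x)) \<longlonglongrightarrow> 0"
        using T_fun_nonneg[OF c H2_diff[OF g'H v]]
        by (intro tendsto_sandwich[OF _ _ tendsto_const tendsto_mult_right_zero[OF gv', of 2]]) auto
      have le: "e \<le> 4 * (sqrt (T_fun c v) * sqrt (T_fun c (\<lambda>x. g' n x - v x)))" for n
      proof -
        have "e \<le> X (g' n)" by (rule X_hull[OF g'[of n]]) (use z in auto)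
        also have "\<dots> \<le> 4 * (sqrt (T_fun c v) * sqrt (T_fun c (\<lambda>x. g' n x - v x)))"
          using T_fun_cross_le[OF c v H2_diff[OF g'H[of n] v]] by (simp add: X_def)
        finally show ?thesis .
      qed
      have "(\<lambda>n. 4 * (sqrt (T_fun c v) * sqrt (T_fun c (\<lambda>x. g' n x - v x)))) \<longlonglongrightarrow> 4 * (sqrt (T_fun c v) * sqrt 0)"
        by (intro tendsto_intros lim)
      then have "e \<le> 4 * (sqrt (T_fun c v) * sqrt 0)"
        by (rule LIMSEQ_le_const) (use le in blast)
      then show False using e by simp
    qed
  qed
qed

end

section \<open>Minimizing sequences\<close>

lemma U_set_iff: "u \<in> U_set \<sigma> \<longleftrightarrow> u \<in> H2 \<and> (LINT x|lborel. cmod (u x) powr (2 * \<sigma> + 2)) = 1"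
  by (simp add: U_set_def)

lemma powr_integral_cmult:
  "(LINT x|M. cmod (a * f x) powr p) = cmod a powr p * (LINT x|M. cmod (f x) powr p)"
  by (simp add: norm_mult powr_mult)

lemma normalized_in_U_set:
  fixes w :: "'a::euclidean_space \<Rightarrow> complex"
  assumes \<sigma>: "\<sigma> > 0" and w: "w \<in> H2" and b: "b = (LINT x|lborel. cmod (w x) powr (2 * \<sigma> + 2))" "b > 0"
  shows "(\<lambda>x. complex_of_real (b powr (- 1 / (2 * \<sigma> + 2))) * w x) \<in> U_set \<sigma>"
proof -
  have "cmod (complex_of_real (b powr (- 1 / (2 * \<sigma> + 2)))) powr (2 * \<sigma> + 2) = b powr (- 1)"
    using \<sigma> by (simp add: powr_powr)
  also have "\<dots> = 1 / b" using b(2) by (simp add: powr_minus_divide)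
  finally have s: "cmod (complex_of_real (b powr (- 1 / (2 * \<sigma> + 2)))) powr (2 * \<sigma> + 2) = 1 / b" .
  have "(LINT x|lborel. cmod (complex_of_real (b powr (- 1 / (2 * \<sigma> + 2))) * w x) powr (2 * \<sigma> + 2)) = 1"
    unfolding powr_integral_cmult s b(1)[symmetric] using b(2) by simp
  then show ?thesis using H2_cmult[OF w] by (simp add: U_set_iff)
qed

lemma U_set_nonempty:
  assumes \<sigma>: "\<sigma> > 0"
  shows "(U_set \<sigma> :: ('a::euclidean_space \<Rightarrow> complex) set) \<noteq> {}"
proof -
  define \<phi> where "\<phi> x = complex_of_real (bump 1 (0::'a) One x)" for x
  have test: "\<phi> \<in> test_functions" unfolding \<phi>_def[abs_def] by (rule bump_test) simp
  define f where "f x = cmod (\<phi> x) powr (2 * \<sigma> + 2)" for x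
  obtain R where R: "\<And>x. norm x > R \<Longrightarrow> \<phi> x = 0" using test_support[OF test] by metis
  have meas: "f \<in> borel_measurable borel"
    unfolding f_def[abs_def] using test_measurable[OF test] by measurable
  have "cmod (\<phi> x) \<le> 1" for x using bump_range[of 1 "0::'a" One x] by (simp add: \<phi>_def)
  then have f1: "norm (f x) \<le> 1" for x
    using powr_mono2[of "2 * \<sigma> + 2" "cmod (\<phi> x)" 1] \<sigma> by (simp add: f_def)
  have int: "integrable lborel f"
    by (rule integrable_bounded_support[OF meas f1, of R]) (simp add: f_def R)
  have "(LINT x|lborel. f x) \<noteq> 0"
  proof
    assume "(LINT x|lborel. f x) = 0"
    moreover have "AE x in lborel. 0 \<le> f x" by (simp add: f_def)
    ultimately have "AE x in lborel. f x = 0"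
      using integral_nonneg_eq_0_iff_AE[OF int] by blast
    then have "AE x in lborel. x \<notin> box (0::'a) One"
    proof eventually_elim
      case (elim x)
      then show ?case using bump_pos[of 1 x 0 One] by (auto simp: f_def \<phi>_def)
    qed
    then have "emeasure lborel (box (0::'a) One) = 0"
      by (subst (asm) AE_iff_measurable[of "box 0 One"]) auto
    then show False by (simp add: emeasure_lborel_box_eq)
  qed
  moreover have "0 \<le> (LINT x|lborel. f x)" by (intro integral_nonneg_AE) (simp add: f_def)
  ultimately have "(LINT x|lborel. f x) > 0" by simp
  from normalized_in_U_set[OF \<sigma> test_H2[OF test], of "LINT x|lborel. f x"] this
  show ?thesis unfolding f_def by blast
qed

context
  fixes c \<sigma> :: real
  assumes c: "c > 0" and \<sigma>: "\<sigma> > 0"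
begin

lemma T_fun_bdd_below: "bdd_below (T_fun c ` (U_set \<sigma> :: ('a::euclidean_space \<Rightarrow> complex) set))"
  by (intro bdd_belowI[of _ 0]) (auto simp: U_set_iff T_fun_nonneg[OF c])

lemma t_inf_le: "(u :: 'a::euclidean_space \<Rightarrow> complex) \<in> U_set \<sigma> \<Longrightarrow> t_inf TYPE('a) \<sigma> c \<le> T_fun c u"
  unfolding t_inf_def by (rule cINF_lower[OF T_fun_bdd_below])

text \<open>
  The exponent \<open>1 / (\<sigma> + 1)\<close> is \<open>2/p\<close>: the functional is homogeneous of degree two and the constraint of degree \<open>p\<close>.
\<close>

lemma t_inf_scaled_le:
  fixes w :: "'a::euclidean_space \<Rightarrow> complex"
  assumes w: "w \<in> H2"
  shows "t_inf TYPE('a) \<sigma> c * (LINT x|lborel. cmod (w x) powr (2 * \<sigma> + 2)) powr (1 / (\<sigma> + 1)) \<le> T_fun c w"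
proof -
  define b where "b = (LINT x|lborel. cmod (w x) powr (2 * \<sigma> + 2))"
  have "b \<ge> 0" unfolding b_def by (intro integral_nonneg_AE) simp
  show ?thesis
  proof (cases "b = 0")
    case True
    then show ?thesis using T_fun_nonneg[OF c w] by (simp add: b_def)
  next
    case False
    then have b: "b > 0" using \<open>b \<ge> 0\<close> by simp
    define s where "s = b powr (- 1 / (2 * \<sigma> + 2))"
    have s2: "s\<^sup>2 = 1 / b powr (1 / (\<sigma> + 1))"
    proof -
      have "s\<^sup>2 = s powr 2" using b by (simp add: s_def)
      also have "\<dots> = b powr (- 1 / (2 * \<sigma> + 2) * 2)" by (simp add: s_def powr_powr)
      also have "- 1 / (2 * \<sigma> + 2) * 2 = - (1 / (\<sigma> + 1))" using \<sigma> by (simp add: field_simps)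
      also have "b powr (- (1 / (\<sigma> + 1))) = 1 / b powr (1 / (\<sigma> + 1))" by (rule powr_minus_divide)
      finally show ?thesis .
    qed
    have "t_inf TYPE('a) \<sigma> c \<le> T_fun c (\<lambda>x. complex_of_real s * w x)"
      unfolding s_def by (intro t_inf_le normalized_in_U_set \<sigma> w b_def b)
    also have "\<dots> = T_fun c w / b powr (1 / (\<sigma> + 1))" by (simp add: T_fun_cmult[OF w] s2)
    finally show ?thesis using b unfolding b_def[symmetric] by (simp add: field_simps)
  qed
qed

lemma minimizing_sequence_exists:
  obtains u :: "nat \<Rightarrow> 'a::euclidean_space \<Rightarrow> complex"
  where "\<And>n. u n \<in> U_set \<sigma>" "(\<lambda>n. T_fun c (u n)) \<longlonglongrightarrow> t_inf TYPE('a) \<sigma> c"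
proof -
  have "\<exists>u\<in>(U_set \<sigma> :: ('a \<Rightarrow> complex) set). T_fun c u < t_inf TYPE('a) \<sigma> c + inverse (real (Suc n))" for n
  proof -
    have "(INF u\<in>(U_set \<sigma> :: ('a \<Rightarrow> complex) set). T_fun c u) < t_inf TYPE('a) \<sigma> c + inverse (real (Suc n))"
      by (simp add: t_inf_def)
    then show ?thesis by (subst (asm) cINF_less_iff[OF U_set_nonempty[OF \<sigma>] T_fun_bdd_below])
  qed
  then obtain u :: "nat \<Rightarrow> 'a \<Rightarrow> complex" where u: "\<And>n. u n \<in> U_set \<sigma>"
    "\<And>n. T_fun c (u n) < t_inf TYPE('a) \<sigma> c + inverse (real (Suc n))" by metis
  have "(\<lambda>n. T_fun c (u n)) \<longlonglongrightarrow> t_inf TYPE('a) \<sigma> c"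
  proof (rule tendsto_sandwich)
    show "\<forall>\<^sub>F n in sequentially. t_inf TYPE('a) \<sigma> c \<le> T_fun c (u n)"
      by (intro always_eventually allI t_inf_le u)
    show "\<forall>\<^sub>F n in sequentially. T_fun c (u n) \<le> t_inf TYPE('a) \<sigma> c + inverse (real (Suc n))"
      using u(2) by (intro always_eventually allI less_imp_le)
    show "(\<lambda>n. t_inf TYPE('a) \<sigma> c + inverse (real (Suc n))) \<longlonglongrightarrow> t_inf TYPE('a) \<sigma> c"
      using tendsto_add[OF tendsto_const LIMSEQ_inverse_real_of_nat, of "t_inf TYPE('a) \<sigma> c"] by simp
  qed simp
  then show thesis using that u(1) by blast
qed

end

lemma concave_split_eq_1:
  fixes a s :: real
  assumes "0 < a" "a \<le> 1" "0 < s" "s < 1" "a powr s + (1 - a) powr s \<le> 1"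
  shows "a = 1"
proof (rule ccontr)
  assume "a \<noteq> 1"
  then have a: "0 < a" "a < 1" using assms by auto
  have "x < x powr s" if "0 < x" "x < 1" for x
    using powr_less_mono'[of x s 1] that assms(4) by simp
  then have "a < a powr s" "1 - a < (1 - a) powr s" using a by auto
  then show False using assms(5) by linarith
qed

theorem t_inf_pos:
  fixes c \<sigma> :: real
  assumes c: "c > 0" and \<sigma>: "\<sigma> > 0" and crit: "(2 * \<sigma> + 2) * (real DIM('a::euclidean_space) - 4) < 2 * real DIM('a)"
  shows "t_inf TYPE('a) \<sigma> c > 0"
proof -
  have p2: "2 \<le> 2 * \<sigma> + 2" using \<sigma> by simp
  obtain C where C: "C > 0"
    "\<And>u::'a \<Rightarrow> complex. u \<in> H2 \<Longrightarrow> integrable lborel (\<lambda>x. cmod (u x) powr (2 * \<sigma> + 2))"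
    "\<And>u::'a \<Rightarrow> complex. u \<in> H2 \<Longrightarrow> (LINT x|lborel. cmod (u x) powr (2 * \<sigma> + 2)) \<le> C * T_fun c u powr ((2 * \<sigma> + 2) / 2)"
    by (rule sobolev_inequality[OF c p2 crit], rule that, assumption, simp_all)
  define q where "q = (2 * \<sigma> + 2) / 2"
  have q: "q > 0" using \<sigma> by (simp add: q_def)
  have "(1 / C) powr (1 / q) \<le> t_inf TYPE('a) \<sigma> c"
    unfolding t_inf_def
  proof (rule cINF_greatest[OF U_set_nonempty[OF \<sigma>]])
    fix u :: "'a \<Rightarrow> complex" assume "u \<in> U_set \<sigma>"
    then have u: "u \<in> H2" "(LINT x|lborel. cmod (u x) powr (2 * \<sigma> + 2)) = 1" by (auto simp: U_set_iff)
    have "1 / C \<le> T_fun c u powr q" using C(3)[OF u(1)] C(1) unfolding u(2) q_def by (simp add: field_simps)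
    then have "(1 / C) powr (1 / q) \<le> (T_fun c u powr q) powr (1 / q)"
      using C(1) q by (intro powr_mono2) auto
    also have "\<dots> = T_fun c u" using q T_fun_nonneg[OF c u(1)] by (simp add: powr_powr)
    finally show "(1 / C) powr (1 / q) \<le> T_fun c u" .
  qed
  moreover have "(1 / C) powr (1 / q) > 0" using C(1) by simp
  ultimately show ?thesis by linarith
qed

text \<open>
  Translate so that the average at the origin stays large, pass to the weak limit \<open>v\<close>, and compare the splitting of the
  energy with that of the mass. With all of the mass in \<open>v\<close> no energy is left for the remainder.
\<close>

theorem minimizing_sequences_converge:
  fixes c \<sigma> :: real and u :: "nat \<Rightarrow> 'a::euclidean_space \<Rightarrow> complex"
  assumes c: "c > 0" and \<sigma>: "\<sigma> > 0" and crit: "(2 * \<sigma> + 2) * (real DIM('a) - 4) < 2 * real DIM('a)"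
    and u: "\<And>n. u n \<in> H2"
    and mass: "(\<lambda>n. LINT x|lborel. cmod (u n x) powr (2 * \<sigma> + 2)) \<longlonglongrightarrow> 1"
    and energy: "(\<lambda>n. T_fun c (u n)) \<longlonglongrightarrow> t_inf TYPE('a) \<sigma> c"
  obtains r y v where "strict_mono (r :: nat \<Rightarrow> nat)" "minimizer \<sigma> c v"
    "(\<lambda>k. H2_norm (\<lambda>x. u (r k) (x + y k) - v x)) \<longlonglongrightarrow> 0"
proof -
  define p where "p = 2 * \<sigma> + 2"
  have p: "p > 2" using \<sigma> by (simp add: p_def)
  define t where "t = t_inf TYPE('a) \<sigma> c"
  have t: "t > 0" unfolding t_def by (rule t_inf_pos[OF c \<sigma> crit])
  define s where "s = 1 / (\<sigma> + 1)"
  have s: "0 < s" "s < 1" using \<sigma> by (auto simp: s_def)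
  define m where "m w = (LINT x|lborel. cmod (w x) powr p)" for w :: "'a \<Rightarrow> complex"
  have scaled: "t * m w powr s \<le> T_fun c w" if "w \<in> H2" for w
    using t_inf_scaled_le[OF c \<sigma> that] by (simp add: t_def m_def p_def s_def)
  have m_nn: "m w \<ge> 0" for w unfolding m_def by (intro integral_nonneg_AE) simp
  obtain CS where CS: "CS > 0" "\<And>w::'a \<Rightarrow> complex. w \<in> H2 \<Longrightarrow> integrable lborel (\<lambda>x. cmod (w x) powr p)"
    "\<And>w::'a \<Rightarrow> complex. w \<in> H2 \<Longrightarrow> m w \<le> CS * T_fun c w powr (p / 2)"
    by (rule sobolev_inequality[OF c less_imp_le[OF p] crit[folded p_def]], rule that, assumption,
        simp_all add: m_def)
  obtain R where R: "\<And>n. T_fun c (u n) \<le> R"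
  proof -
    obtain R where "\<And>n. \<bar>T_fun c (u n)\<bar> \<le> R"
      using convergent_imp_Bseq[OF convergentI[OF energy]] unfolding Bseq_def by auto
    then show thesis using that[of R] abs_le_D1 by blast
  qed
  have R0: "R \<ge> 0" using R[of 0] T_fun_nonneg[OF c u[of 0]] by linarith
  \<comment> \<open>If all averages at this scale were small, the mass could not be close to one. Hence every late term has a
    centre at which the average exceeds \<open>\<delta>\<close>; the translations move it to the origin.\<close>
  have "\<exists>j \<delta>. \<delta> > 0 \<and> (\<forall>w :: 'a \<Rightarrow> complex. w \<in> H2 \<longrightarrow> T_fun c w \<le> R \<longrightarrow>
      (\<forall>x. cmod (avg (1 / real (Suc j)) w x) \<le> \<delta>) \<longrightarrow> m w \<le> 1 / 2)"
  proof (rule small_averages_imp_small_norm[OF c p crit[folded p_def] R0])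
    fix j :: nat and \<delta> :: real
    assume "\<delta> > 0" "\<And>w :: 'a \<Rightarrow> complex. w \<in> H2 \<Longrightarrow> T_fun c w \<le> R \<Longrightarrow>
      (\<And>x. cmod (avg (1 / real (Suc j)) w x) \<le> \<delta>) \<Longrightarrow> (LINT x|lborel. cmod (w x) powr p) \<le> 1 / 2"
    then show ?thesis unfolding m_def by (intro exI[of _ j] exI[of _ \<delta>]) simp
  qed
  then obtain j :: nat and \<delta> :: real where \<delta>: "\<delta> > 0"
    "\<And>w::'a \<Rightarrow> complex. w \<in> H2 \<Longrightarrow> T_fun c w \<le> R \<Longrightarrow> (\<And>x. cmod (avg (1 / real (Suc j)) w x) \<le> \<delta>) \<Longrightarrow> m w \<le> 1 / 2"
    by blast
  define h where "h = 1 / real (Suc j)"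
  have h: "h > 0" by (simp add: h_def)
  have "\<forall>\<^sub>F n in sequentially. 1 / 2 < m (u n)"
    using order_tendstoD(1)[OF mass, of "1/2"] by (simp add: m_def p_def)
  then have centre: "\<forall>\<^sub>F n in sequentially. \<exists>y. \<delta> < cmod (avg h (u n) y)"
  proof eventually_elim
    case (elim n)
    show ?case
    proof (rule ccontr)
      assume "\<not> ?thesis"
      then have "m (u n) \<le> 1 / 2" by (intro \<delta>(2) u R) (simp add: h_def not_less)
      then show False using elim by simp
    qed
  qed
  define z where "z n = (SOME y. \<delta> < cmod (avg h (u n) y))" for n
  define w where "w n x = u n (x + z n)" for n x
  have w: "w n \<in> H2" "T_fun c (w n) = T_fun c (u n)" "m (w n) = m (u n)" for n
    unfolding w_def[abs_def] m_def
    using H2_translate[OF u] T_fun_translate[OF u] integral_translate[of "\<lambda>x. cmod (u n x) powr p"] H2_measurable[OF u[of n]]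
    by auto
  have avg_w: "\<forall>\<^sub>F n in sequentially. \<delta> < cmod (avg h (w n) 0)"
    using centre
  proof eventually_elim
    case (elim n)
    from someI_ex[OF elim] show ?case
      using avg_translate[of h "u n" "z n" 0] by (simp add: w_def[abs_def] z_def)
  qed
  obtain r v where r: "strict_mono (r :: nat \<Rightarrow> nat)" and v: "v \<in> H2"
    and avg_lim: "\<And>k x. (\<lambda>n. avg (1 / real (Suc k)) (w (r n)) x) \<longlonglongrightarrow> avg (1 / real (Suc k)) v x"
    and AE_lim: "AE x in lborel. (\<lambda>n. w (r n) x) \<longlonglongrightarrow> v x"
    and T_split: "\<And>e. e > 0 \<Longrightarrow> \<forall>\<^sub>F n in sequentially. T_fun c v + T_fun c (\<lambda>x. w (r n) x - v x) \<le> T_fun c (w (r n)) + e"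
  proof (rule H2_bounded_subsequence[OF c, of w R])
    show "T_fun c (w n) \<le> R" for n using w(2) R by simp
  qed (use w(1) in auto)
  define d where "d n x = w (r n) x - v x" for n x
  have d: "d n \<in> H2" for n unfolding d_def[abs_def] by (intro H2_diff w v)
  have mw: "(\<lambda>n. m (w (r n))) \<longlonglongrightarrow> 1"
    using LIMSEQ_subseq_LIMSEQ[OF mass r] by (simp add: o_def m_def p_def w(3)[unfolded m_def p_def])
  have Tw: "(\<lambda>n. T_fun c (w (r n))) \<longlonglongrightarrow> t"
    using LIMSEQ_subseq_LIMSEQ[OF energy r] by (simp add: o_def w(2) t_def)
  \<comment> \<open>The limit carries mass because the averages near the centre converge.\<close>
  have "\<delta> \<le> cmod (avg h v 0)"
  proof (rule LIMSEQ_le_const)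
    show "(\<lambda>n. cmod (avg h (w (r n)) 0)) \<longlonglongrightarrow> cmod (avg h v 0)"
      unfolding h_def by (intro tendsto_norm avg_lim)
    show "\<exists>N. \<forall>n\<ge>N. \<delta> \<le> cmod (avg h (w (r n)) 0)"
      using eventually_subseq[OF r avg_w] by (auto simp: eventually_at_top_linorder intro: less_imp_le)
  qed
  then have avg_v: "cmod (avg h v 0) > 0" using \<delta>(1) by linarith
  have mv: "m v > 0"
  proof (rule ccontr)
    assume "\<not> m v > 0"
    then have "m v = 0" using m_nn[of v] by simp
    then have "AE x in lborel. cmod (v x) powr p = 0"
      using integral_nonneg_eq_0_iff_AE[OF CS(2)[OF v]] by (simp add: m_def)
    then have "AE x in lborel. v x = 0" by eventually_elim simp
    then have "l2sq v = 0"
      using l2sq_cong_AE[OF H2_measurable[OF v], of "\<lambda>_. 0"] by (simp add: l2sq_def)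
    then have "(cmod (avg h v 0))\<^sup>2 \<le> 0" using avg_sq_le[OF H2_L2[OF v] h, of 0] by simp
    then show False using avg_v by simp
  qed
  obtain K where K: "\<And>n. m (d n) \<le> K"
  proof -
    have "m (d n) \<le> CS * (2 * R + 2 * T_fun c v) powr (p / 2)" for n
    proof -
      have "T_fun c (d n) \<le> 2 * R + 2 * T_fun c v"
        using T_fun_diff_le[OF c w(1)[of "r n"] v] w(2)[of "r n"] R[of "r n"] by (simp add: d_def[abs_def])
      then have "CS * T_fun c (d n) powr (p / 2) \<le> CS * (2 * R + 2 * T_fun c v) powr (p / 2)"
        using CS(1) p T_fun_nonneg[OF c d[of n]] by (intro mult_left_mono powr_mono2) auto
      then show ?thesis using CS(3)[OF d[of n]] by linarith
    qed
    then show thesis using that by blast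
  qed
  have "(\<lambda>n. m (w (r n)) - m (d n)) \<longlonglongrightarrow> m v"
    unfolding m_def d_def
  proof (rule brezis_lieb[OF _ _ _ AE_lim])
    show "(LINT x|lborel. cmod (w (r n) x - v x) powr p) \<le> K" for n
      using K[of n] by (simp add: m_def d_def)
    show "integrable lborel (\<lambda>x. cmod (w (r n) x - v x) powr p)" for n
      using CS(2)[OF d[of n]] by (simp add: d_def)
    show "w (r n) \<in> borel_measurable lborel" "v \<in> borel_measurable lborel" for n
      using H2_measurable[OF w(1)] H2_measurable[OF v] by auto
  qed (use p CS(2) v w(1) in auto)
  from tendsto_diff[OF mw this] have md: "(\<lambda>n. m (d n)) \<longlonglongrightarrow> 1 - m v" by simp
  have mv1: "m v \<le> 1" using LIMSEQ_le_const[OF md, of 0] m_nn by fastforce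
  have split_le: "t * m v powr s + t * (1 - m v) powr s \<le> t"
  proof (rule field_le_epsilon)
    fix e :: real assume e: "e > 0"
    have "(\<lambda>n. t * m v powr s + t * m (d n) powr s) \<longlonglongrightarrow> t * m v powr s + t * (1 - m v) powr s"
      using s m_nn by (intro tendsto_intros tendsto_powr' md) auto
    moreover have "(\<lambda>n. T_fun c (w (r n)) + e) \<longlonglongrightarrow> t + e" by (intro tendsto_intros Tw)
    moreover have "\<forall>\<^sub>F n in sequentially. t * m v powr s + t * m (d n) powr s \<le> T_fun c (w (r n)) + e"
      using T_split[OF e]
    proof eventually_elim
      case (elim n)
      then show ?case using scaled[OF v] scaled[OF d[of n]] by (simp add: d_def[abs_def])
    qed
    ultimately show "t * m v powr s + t * (1 - m v) powr s \<le> t + e"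
      by (intro tendsto_le[OF sequentially_bot])
  qed
  have "m v powr s + (1 - m v) powr s \<le> 1"
    using split_le t by (simp flip: distrib_left)
  then have mv_eq: "m v = 1" by (rule concave_split_eq_1[OF mv mv1 s])
  then have vU: "v \<in> U_set \<sigma>" using v by (simp add: U_set_iff m_def p_def)
  then have Tv_ge: "t \<le> T_fun c v" unfolding t_def by (rule t_inf_le[OF c \<sigma>])
  have "T_fun c v \<le> t"
  proof (rule field_le_epsilon)
    fix e :: real assume e: "e > 0"
    have "(\<lambda>n. T_fun c (w (r n)) + e) \<longlonglongrightarrow> t + e" by (intro tendsto_intros Tw)
    moreover have "\<forall>\<^sub>F n in sequentially. T_fun c v \<le> T_fun c (w (r n)) + e"
      using T_split[OF e]
    proof eventually_elim
      case (elim n)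
      then show ?case using T_fun_nonneg[OF c d[of n]] by (simp add: d_def[abs_def])
    qed
    ultimately show "T_fun c v \<le> t + e" by (intro tendsto_le[OF sequentially_bot _ tendsto_const])
  qed
  with Tv_ge have Tv: "T_fun c v = t" by simp
  have Td: "(\<lambda>n. T_fun c (d n)) \<longlonglongrightarrow> 0"
  proof (rule LIMSEQ_I)
    fix e :: real assume e: "e > 0"
    have "\<forall>\<^sub>F n in sequentially. T_fun c (w (r n)) < t + e / 2"
      by (rule order_tendstoD(2)[OF Tw]) (use e in simp)
    moreover have "\<forall>\<^sub>F n in sequentially. T_fun c v + T_fun c (\<lambda>x. w (r n) x - v x) \<le> T_fun c (w (r n)) + e / 2"
      by (rule T_split) (use e in simp)
    ultimately have "\<forall>\<^sub>F n in sequentially. norm (T_fun c (d n) - 0) < e"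
    proof eventually_elim
      case (elim n)
      then show ?case using Tv T_fun_nonneg[OF c d[of n]] by (simp add: d_def[abs_def])
    qed
    then show "\<exists>no. \<forall>n\<ge>no. norm (T_fun c (d n) - 0) < e" by (simp add: eventually_at_top_linorder)
  qed
  obtain C where C: "C > 0" "\<And>f :: 'a \<Rightarrow> complex. f \<in> H2 \<Longrightarrow> (H2_norm f)\<^sup>2 \<le> C * T_fun c f"
    by (rule H2_norm_le_T_fun[OF c, where ?'a='a], rule that, assumption, simp_all)
  have "(\<lambda>n. H2_norm (d n)) \<longlonglongrightarrow> 0"
  proof (rule Lim_null_comparison)
    show "(\<lambda>n. sqrt (C * T_fun c (d n))) \<longlonglongrightarrow> 0"
      using tendsto_real_sqrt[OF tendsto_mult_right_zero[OF Td, of C]] by simp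
    show "\<forall>\<^sub>F n in sequentially. norm (H2_norm (d n)) \<le> sqrt (C * T_fun c (d n))"
      using C(2)[OF d] by (intro always_eventually allI real_le_rsqrt) simp
  qed
  then show thesis
    using that[OF r, of v "\<lambda>k. z (r k)"] vU Tv by (simp add: minimizer_def t_def d_def[abs_def] w_def)
qed

theorem theorem3p6:
  fixes \<sigma> c :: real
  assumes "0 < \<sigma>"
    and "DIM('a::euclidean_space) \<ge> 5 \<Longrightarrow> \<sigma> < 4 / (real DIM('a) - 4)"
    and "c > 0"
  shows "t_inf TYPE('a) \<sigma> c > 0
    \<and> (\<exists>u :: 'a \<Rightarrow> complex. minimizer \<sigma> c u)
    \<and> (\<forall>u :: nat \<Rightarrow> 'a \<Rightarrow> complex.
          (\<forall>n. u n \<in> H2)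
          \<and> (\<lambda>n. LINT x|lborel. cmod (u n x) powr (2 * \<sigma> + 2)) \<longlonglongrightarrow> 1
          \<and> (\<lambda>n. T_fun c (u n)) \<longlonglongrightarrow> t_inf TYPE('a) \<sigma> c
          \<longrightarrow> (\<exists>(r :: nat \<Rightarrow> nat) (y :: nat \<Rightarrow> 'a) (v :: 'a \<Rightarrow> complex).
                strict_mono r \<and> minimizer \<sigma> c v
                \<and> (\<lambda>k. H2_norm (\<lambda>x. u (r k) (x + y k) - v x)) \<longlonglongrightarrow> 0))"
proof -
  have crit: "(2 * \<sigma> + 2) * (real DIM('a) - 4) < 2 * real DIM('a)"
  proof (cases "DIM('a) \<ge> 5")
    case True
    then have "\<sigma> * (real DIM('a) - 4) < 4" using assms(2) by (simp add: field_simps)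
    then show ?thesis by (simp add: algebra_simps)
  next
    case False
    then have "(2 * \<sigma> + 2) * (real DIM('a) - 4) \<le> 0" using assms(1) by (intro mult_nonneg_nonpos) auto
    then show ?thesis using DIM_positive[where ?'a='a] by linarith
  qed
  have conv: "\<exists>(r :: nat \<Rightarrow> nat) (y :: nat \<Rightarrow> 'a) v. strict_mono r \<and> minimizer \<sigma> c v
      \<and> (\<lambda>k. H2_norm (\<lambda>x. u (r k) (x + y k) - v x)) \<longlonglongrightarrow> 0"
    if "\<And>n. u n \<in> H2" "(\<lambda>n. LINT x|lborel. cmod (u n x) powr (2 * \<sigma> + 2)) \<longlonglongrightarrow> 1"
      "(\<lambda>n. T_fun c (u n)) \<longlonglongrightarrow> t_inf TYPE('a) \<sigma> c" for u :: "nat \<Rightarrow> 'a \<Rightarrow> complex"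
    by (rule minimizing_sequences_converge[OF assms(3,1) crit that]) blast
  obtain u :: "nat \<Rightarrow> 'a \<Rightarrow> complex" where u: "\<And>n. u n \<in> U_set \<sigma>" "(\<lambda>n. T_fun c (u n)) \<longlonglongrightarrow> t_inf TYPE('a) \<sigma> c"
    using minimizing_sequence_exists[OF assms(3,1), where ?'a='a] by blast
  have "\<exists>v :: 'a \<Rightarrow> complex. minimizer \<sigma> c v"
    using conv[of u] u by (auto simp: U_set_iff)
  then show ?thesis
    using t_inf_pos[OF assms(3,1) crit] conv by blast
qed

end
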